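(* Let $(M,\omega)$ be a symplectic manifold with a proper Hamiltonian action of a Lie group $G$, equivariant momentum map $\mathbf{J}:M\to\mathfrak{g}^*$ and $G$-invariant Hamiltonian $h$, and let $m_e\in M$ be a relative equilibrium with generator $\xi\in\mathfrak{g}$ and momentum $\mu=\mathbf{J}(m_e)$. Let $\Psi:\mathcal{U}\subset\mathfrak{m}^*\times V\to M$ be a slice mapping at $m_e$ constructed from a chart $\psi$ and subspaces $\mathfrak{m},\mathfrak{q}\subset\mathfrak{g}$, $V,W\subset X$ as described in the context. If the spaces $\mathfrak{m}$, $\mathfrak{q}$, $V$ and $W$ are $G_{m_e}\cap G_\xi$-invariant and the slice mapping $\Psi$ is $G_{m_e}\cap G_\xi$-equivariant, then, with $G_{m_e}\cap G_\xi$-invariant choices of the complements $V_1$, $V_2$ in the reduction procedure, the maps $\Xi$, $v_1$, $B$, $\rho$ and $\mathcal{L}$ are all $G_{m_e}\cap G_\xi$-equivariant.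
   Context: Notation. A relative equilibrium $m_e$ with generator $\xi$ satisfies $F_t(m_e)=\exp(t\xi)\cdot m_e$ for the flow $F_t$ of $X_h$, equivalently $D(h-\mathbf{J}^\xi)(m_e)=0$, $\mathbf{J}^\xi=\langle\mathbf{J},\xi\rangle$. $\mathbf{J}(g\cdot m)=\mathrm{Ad}^*_{g^{-1}}\mathbf{J}(m)$; $\langle\mathrm{ad}^*_\zeta\nu,\eta\rangle=\langle\nu,[\zeta,\eta]\rangle$; $\mathfrak{s}\cdot m=\{\zeta_M(m):\zeta\in\mathfrak{s}\}$. $G_{m_e},G_\mu,G_\xi$ are isotropy subgroups (for the action on $M$, the coadjoint and the adjoint action), $\mathfrak{g}_{m_e},\mathfrak{g}_\mu$ the Lie algebras of the first two. $\mathfrak{g}=\mathfrak{g}_{m_e}\oplus\mathfrak{m}\oplus\mathfrak{q}$ with $\mathfrak{g}_\mu=\mathfrak{g}_{m_e}\oplus\mathfrak{m}$; $i$ and $\mathbb{P}$ with subscripts are the associated injections and projections. Slice mapping. A slice mapping at $m_e$ is a smooth map $\Psi:\mathcal{U}\to M$ on an open neighborhood $\mathcal{U}$ of $(0,0)$ in $\mathfrak{m}^*\times V$, a diffeomorphism onto its image, with (SM1) $\Psi(0,0)=m_e$; (SM2) $T_{\Psi(\eta,v)}M=(\mathfrak{m}\oplus\mathfrak{q})\cdot\Psi(\eta,v)+T_{(\eta,v)}\Psi\cdot(\mathfrak{m}^*\times V)$ for all $(\eta,v)\in\mathcal{U}$; (SM3) $D(\mathbf{J}\circ\Psi)(0,0)(\delta\eta,\delta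 v)=\mathbb{P}_{\mathfrak{m}}^*\delta\eta$. Construction: for a chart $\psi:U\subset X\to M$ with $\psi(0)=m_e$, choose $V,W\subset X$ such that $T_0\psi\cdot V$ is a complement to $\mathfrak{m}\cdot m_e$ in $\ker D\mathbf{J}(m_e)$ and $A:W\to(\mathfrak{g}_{m_e}\oplus\mathfrak{q})^\circ$, $A(w)=D\mathbf{J}(m_e)(T_0\psi(w))$, is an isomorphism; then $\Psi(\eta,v)=\psi(v+A^{-1}\mathbb{P}_{\mathfrak{m}}^*\eta)$ near $(0,0)$. $\Psi$ is $G_{m_e}\cap G_\xi$-equivariant if $\mathfrak{m}^*\subset\mathfrak{g}^*$ is $\mathrm{Ad}^*_{G_{m_e}\cap G_\xi}$-invariant and $\Psi$ is equivariant for the coadjoint action on $\mathfrak{m}^*$ and some (linear) action on $V$; $\mathcal{U}$ is chosen invariant. Reduction procedure. Put $\mathcal{H}:=h\circ\Psi$, $\mathbf{j}:=\mathbf{J}\circ\Psi$, $\mathbf{j}^\zeta=\langle\mathbf{j},\zeta\rangle$. The functions $\gamma,\beta,v_1$ below are defined on sufficiently small neighborhoods of the origin, vanish at the origin and are the unique local solutions given by the Implicit Function Theorem. Step 1: $\gamma(\eta,v,\alpha,\beta)\in\mathfrak{q}$ (with $\alpha\in\mathfrak{g}_{m_e}$, $\beta\in\mathfrak{m}$) solves $i_{\mathfrak{q}}^*\,\mathrm{ad}^*_{\xi+\alpha+\beta+\gamma}\mathbf{j}(\eta,v)=0$; set $\omega_1(\eta,v,\alpha,\beta)=\xi+\alpha+\beta+\gamma(\eta,v,\alpha,\beta)$.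 Step 2: $\beta(\eta,v,\alpha)\in\mathfrak{m}$ solves $D_{\mathfrak{m}^*}(\mathcal{H}-\mathbf{j}^\zeta)(\eta,v)|_{\zeta=\omega_1(\eta,v,\alpha,\beta)}=0$; set $\omega_2(\eta,v,\alpha)=\omega_1(\eta,v,\alpha,\beta(\eta,v,\alpha))$. Step 3: $\mathcal{L}:V\to V^*$ is defined by $\langle\mathcal{L}v,w\rangle=D_{VV}(\mathcal{H}-\mathbf{j}^\xi)(0,0)(v,w)$ (assumed Fredholm, with $V$ a Hilbert space, if $V$ is infinite dimensional); $V_0:=\ker\mathcal{L}$; $V=V_0\oplus V_1$, $V^*=\mathrm{range}\,\mathcal{L}\oplus V_2$ with $V_1,V_2$ closed; $\mathbb{P}:V^*\to V_2$ is the projection. $v_1(\eta,v_0,\alpha)\in V_1$ solves $(\mathbb{I}-\mathbb{P})D_V(\mathcal{H}-\mathbf{j}^\zeta)(\eta,v_0+v_1)|_{\zeta=\omega_2(\eta,v_0+v_1,\alpha)}=0$. Finally, for $(\eta,v_0,\alpha)\in\mathfrak{m}^*\times V_0\times\mathfrak{g}_{m_e}$ near the origin: $\Xi(\eta,v_0,\alpha)=\omega_2(\eta,v_0+v_1(\eta,v_0,\alpha),\alpha)\in\mathfrak{g}$; $B(\eta,v_0,\alpha)=\mathbb{P}D_V(\mathcal{H}-\mathbf{j}^{\zeta})(\eta,v_0+v_1(\eta,v_0,\alpha))|_{\zeta=\Xi(\eta,v_0,\alpha)}\in V_2$; $\rho(\eta,v_0,\alpha)=i_{\mathfrak{m}}^*\,\mathrm{ad}^*_{\Xi(\eta,v_0,\alpha)}\mathbf{j}(\eta,v_0+v_1(\eta,v_0,\alpha))\in\mathfrak{m}^*$.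 The group $G_{m_e}\cap G_\xi$ acts by the adjoint action on $\mathfrak{g}$ and its invariant subspaces, by the coadjoint action on $\mathfrak{m}^*$, by the given action on $V$ and by the contragredient action on $V^*$. *)

theory Defs
  imports "HOL-Analysis.Analysis" "HOL-Algebra.Group_Action"
begin

section \<open>Smooth maps between Banach spaces\<close>

text \<open>
  \<open>C\<^sup>\<infinity>\<close> in the sense of Frechet: \<open>D n x [v\<^sub>1, \<dots>, v\<^sub>n]\<close> is the value of the \<open>n\<close>-th derivative of \<open>f\<close> at
  \<open>x\<close>, a bounded multilinear map, and \<open>D (Suc n)\<close> is the derivative of \<open>D n\<close> with respect to the
  operator norm on multilinear maps. (Multilinearity in the remaining arguments follows by induction
  on \<open>n\<close>.) A sequence of functions on lists is used because the types of the iterated derivatives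
  depend on \<open>n\<close>.
\<close>

definition smooth_on :: "'a::real_normed_vector set \<Rightarrow> ('a \<Rightarrow> 'b::real_normed_vector) \<Rightarrow> bool" where
  "smooth_on S f \<longleftrightarrow> open S \<and>
     (\<exists>D :: nat \<Rightarrow> 'a \<Rightarrow> 'a list \<Rightarrow> 'b. (\<forall>x\<in>S. D 0 x [] = f x) \<and>
       (\<forall>n. \<forall>x\<in>S.
          (\<forall>vs. length vs = n \<longrightarrow> linear (\<lambda>v. D (Suc n) x (v # vs))) \<and>
          (\<exists>K. \<forall>vs. length vs = Suc n \<longrightarrow>
             norm (D (Suc n) x vs) \<le> K * prod_list (map norm vs)) \<and>
          (\<forall>\<epsilon>>0. \<exists>\<delta>>0. \<forall>y\<in>S. norm (y - x) < \<delta> \<longrightarrow> (\<forall>vs. length vs = n \<longrightarrow>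
             norm (D n y vs - D n x vs - D (Suc n) x ((y - x) # vs))
               \<le> \<epsilon> * norm (y - x) * prod_list (map norm vs)))))"


section \<open>Manifolds, tangent maps\<close>

text \<open>
  A chart is a local parametrization \<open>(U, \<phi>)\<close>, \<open>\<phi> : U \<rightarrow> M\<close>, with \<open>U\<close> open in the model space. The
  manifold is a topological space given as a type, together with an atlas.
\<close>

type_synonym ('x, 'm) atlas = "('x set \<times> ('x \<Rightarrow> 'm)) set"

definition is_chart :: "'x::real_normed_vector set \<times> ('x \<Rightarrow> 'm::topological_space) \<Rightarrow> bool" where
  "is_chart = (\<lambda>(U, \<phi>). open U \<and> open (\<phi> ` U) \<and> homeomorphism U (\<phi> ` U) \<phi> (inv_into U \<phi>))"

definition smooth_transition ::
  "'x::real_normed_vector set \<times> ('x \<Rightarrow> 'm) \<Rightarrow> 'x set \<times> ('x \<Rightarrow> 'm) \<Rightarrow> bool" where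
  "smooth_transition = (\<lambda>(U, \<phi>) (W, \<psi>). smooth_on {x \<in> U. \<phi> x \<in> \<psi> ` W} (inv_into W \<psi> \<circ> \<phi>))"

definition smooth_atlas :: "('x::real_normed_vector, 'm::topological_space) atlas \<Rightarrow> bool" where
  "smooth_atlas A \<longleftrightarrow> (\<forall>c\<in>A. is_chart c) \<and> (\<Union>(U, \<phi>)\<in>A. \<phi> ` U) = UNIV \<and>
     (\<forall>c\<in>A. \<forall>d\<in>A. smooth_transition c d)"

text \<open>Charts of the maximal atlas generated by \<open>A\<close>:\<close>

definition compatible_chart ::
  "('x::real_normed_vector, 'm::topological_space) atlas \<Rightarrow> 'x set \<times> ('x \<Rightarrow> 'm) \<Rightarrow> bool" where
  "compatible_chart A c \<longleftrightarrow>
     is_chart c \<and> (\<forall>d\<in>A. smooth_transition c d \<and> smooth_transition d c)"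

definition vec_atlas :: "('x::real_normed_vector, 'x) atlas" where
  "vec_atlas = {(UNIV, \<lambda>x. x)}"

definition prod_atlas :: "('x, 'm) atlas \<Rightarrow> ('y, 'n) atlas \<Rightarrow> ('x \<times> 'y, 'm \<times> 'n) atlas" where
  "prod_atlas A B = {(U \<times> W, map_prod \<phi> \<psi>) | U \<phi> W \<psi>. (U, \<phi>) \<in> A \<and> (W, \<psi>) \<in> B}"

definition msmooth_on ::
  "('x::real_normed_vector, 'm::topological_space) atlas \<Rightarrow>
   ('y::real_normed_vector, 'n::topological_space) atlas \<Rightarrow> 'm set \<Rightarrow> ('m \<Rightarrow> 'n) \<Rightarrow> bool" where
  "msmooth_on A B S f \<longleftrightarrow> open S \<and> continuous_on S f \<and>
     (\<forall>(U, \<phi>)\<in>A. \<forall>(W, \<psi>)\<in>B.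
        smooth_on {x \<in> U. \<phi> x \<in> S \<and> f (\<phi> x) \<in> \<psi> ` W} (inv_into W \<psi> \<circ> f \<circ> \<phi>))"

text \<open>
  Every point \<open>m\<close> gets a preferred chart of the atlas around it, and a tangent vector at \<open>m\<close> is
  represented by its coordinate vector in that chart; so each \<open>T\<^sub>mM\<close> is a copy of the model space.
  With this identification \<open>mderiv A B f m\<close> is the tangent map \<open>T\<^sub>mM \<rightarrow> T\<^bsub>f m\<^esub>N\<close> of \<open>f\<close>. For a vector
  space with \<^const>\<open>vec_atlas\<close> the identification is the canonical one.
\<close>

definition chart_at :: "('x, 'm) atlas \<Rightarrow> 'm \<Rightarrow> 'x set \<times> ('x \<Rightarrow> 'm)" where
  "chart_at A m = (SOME c. c \<in> A \<and> m \<in> snd c ` fst c)"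

definition param_at :: "('x, 'm) atlas \<Rightarrow> 'm \<Rightarrow> 'x \<Rightarrow> 'm" where
  "param_at A m = snd (chart_at A m)"

definition coord_at :: "('x, 'm) atlas \<Rightarrow> 'm \<Rightarrow> 'm \<Rightarrow> 'x" where
  "coord_at A m = inv_into (fst (chart_at A m)) (snd (chart_at A m))"

definition mderiv ::
  "('x::real_normed_vector, 'm) atlas \<Rightarrow> ('y::real_normed_vector, 'n) atlas \<Rightarrow>
   ('m \<Rightarrow> 'n) \<Rightarrow> 'm \<Rightarrow> 'x \<Rightarrow> 'y" where
  "mderiv A B f m =
     frechet_derivative (coord_at B (f m) \<circ> f \<circ> param_at A m) (at (coord_at A m m))"


section \<open>Lie groups\<close>

text \<open>
  The Lie algebra \<open>\<gg> = T\<^sub>1G\<close> is the model space \<open>'e\<close>, finite dimensional (possibly of dimension 0),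
  and \<open>\<gg>\<^sup>*\<close> is the dual \<open>'e \<Rightarrow>\<^sub>L real\<close>.
\<close>

definition lie_group :: "'g::t2_space monoid \<Rightarrow> ('e::banach, 'g) atlas \<Rightarrow> bool" where
  "lie_group G AG \<longleftrightarrow> group G \<and> carrier G = UNIV \<and> (\<exists>B::'e set. finite B \<and> span B = UNIV) \<and>
     smooth_atlas AG \<and>
     msmooth_on (prod_atlas AG AG) AG UNIV (\<lambda>(a, b). a \<otimes>\<^bsub>G\<^esub> b) \<and>
     msmooth_on AG AG UNIV (\<lambda>a. inv\<^bsub>G\<^esub> a)"

definition Ad :: "'g monoid \<Rightarrow> ('e::banach, 'g) atlas \<Rightarrow> 'g \<Rightarrow> 'e \<Rightarrow>\<^sub>L 'e" where
  "Ad G AG g = Blinfun (mderiv AG AG (\<lambda>a. g \<otimes>\<^bsub>G\<^esub> a \<otimes>\<^bsub>G\<^esub> inv\<^bsub>G\<^esub> g) \<one>\<^bsub>G\<^esub>)"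

text \<open>\<open>ad = T\<^sub>1Ad\<close>; the Lie bracket is \<open>[\<zeta>, \<eta>] = ad \<zeta> \<eta>\<close>.\<close>

definition ad :: "'g monoid \<Rightarrow> ('e::banach, 'g) atlas \<Rightarrow> 'e \<Rightarrow> 'e \<Rightarrow>\<^sub>L 'e" where
  "ad G AG \<zeta> = mderiv AG vec_atlas (Ad G AG) \<one>\<^bsub>G\<^esub> \<zeta>"

text \<open>The left coadjoint action \<open>Ad\<^sup>*\<close> of the inverse of \<open>g\<close>:\<close>

definition coAd :: "'g monoid \<Rightarrow> ('e::banach, 'g) atlas \<Rightarrow> 'g \<Rightarrow> ('e \<Rightarrow>\<^sub>L real) \<Rightarrow> 'e \<Rightarrow>\<^sub>L real" where
  "coAd G AG g \<nu> = \<nu> o\<^sub>L Ad G AG (inv\<^bsub>G\<^esub> g)"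

definition ad_star :: "'g monoid \<Rightarrow> ('e::banach, 'g) atlas \<Rightarrow> 'e \<Rightarrow> ('e \<Rightarrow>\<^sub>L real) \<Rightarrow> 'e \<Rightarrow>\<^sub>L real" where
  "ad_star G AG \<zeta> \<nu> = \<nu> o\<^sub>L ad G AG \<zeta>"

text \<open>\<open>one_param G AG \<zeta> c\<close> says that \<open>c t = exp (t \<zeta>)\<close> for all \<open>t\<close>.\<close>

definition one_param ::
  "'g::t2_space monoid \<Rightarrow> ('e::banach, 'g) atlas \<Rightarrow> 'e \<Rightarrow> (real \<Rightarrow> 'g) \<Rightarrow> bool" where
  "one_param G AG \<zeta> c \<longleftrightarrow> msmooth_on vec_atlas AG UNIV c \<and>
     (\<forall>s t. c (s + t) = c s \<otimes>\<^bsub>G\<^esub> c t) \<and> mderiv vec_atlas AG c 0 1 = \<zeta>"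

text \<open>The Lie algebra of a closed subgroup \<open>S\<close>:\<close>

definition lie_alg_of ::
  "'g::t2_space monoid \<Rightarrow> ('e::banach, 'g) atlas \<Rightarrow> 'g set \<Rightarrow> 'e set" where
  "lie_alg_of G AG S = {\<zeta>. \<exists>c. one_param G AG \<zeta> c \<and> (\<forall>t. c t \<in> S)}"


section \<open>Hamiltonian actions and relative equilibria\<close>

text \<open>
  \<open>\<omega> m\<close> is a bilinear form on \<open>T\<^sub>mM\<close>. Smoothness and closedness are expressed through the local
  representatives \<open>\<Omega> = \<phi>\<^sup>*\<omega>\<close>. Non-degeneracy is required in the weak sense, which covers strong
  symplectic forms and is the same in finite dimensions.
\<close>

definition symplectic_manifold ::
  "('x::banach, 'm::t2_space) atlas \<Rightarrow> ('m \<Rightarrow> 'x \<Rightarrow>\<^sub>L 'x \<Rightarrow>\<^sub>L real) \<Rightarrow> bool" where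
  "symplectic_manifold AM \<omega> \<longleftrightarrow> smooth_atlas AM \<and>
     (\<forall>m u v. \<omega> m u v = - \<omega> m v u) \<and>
     (\<forall>m u. (\<forall>v. \<omega> m u v = 0) \<longrightarrow> u = 0) \<and>
     (\<forall>(U, \<phi>)\<in>AM. \<exists>\<Omega> :: 'x \<Rightarrow> 'x \<Rightarrow>\<^sub>L 'x \<Rightarrow>\<^sub>L real.
        smooth_on U \<Omega> \<and>
        (\<forall>x\<in>U. \<forall>u v. blinfun_apply (blinfun_apply (\<Omega> x) u) v =
           \<omega> (\<phi> x) (mderiv vec_atlas AM \<phi> x u) (mderiv vec_atlas AM \<phi> x v)) \<and>
        (\<forall>x\<in>U. \<forall>u v w.
           blinfun_apply (blinfun_apply (frechet_derivative \<Omega> (at x) u) v) w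
           + blinfun_apply (blinfun_apply (frechet_derivative \<Omega> (at x) v) w) u
           + blinfun_apply (blinfun_apply (frechet_derivative \<Omega> (at x) w) u) v = 0))"

text \<open>\<open>\<zeta>\<^sub>M(m)\<close>:\<close>

definition inf_gen ::
  "'g monoid \<Rightarrow> ('e::banach, 'g) atlas \<Rightarrow> ('x::banach, 'm) atlas \<Rightarrow> ('g \<Rightarrow> 'm \<Rightarrow> 'm) \<Rightarrow>
   'e \<Rightarrow> 'm \<Rightarrow> 'x" where
  "inf_gen G AG AM act \<zeta> m = mderiv AG AM (\<lambda>g. act g m) \<one>\<^bsub>G\<^esub> \<zeta>"

definition proper_smooth_action ::
  "'g::t2_space monoid \<Rightarrow> ('e::banach, 'g) atlas \<Rightarrow> ('x::banach, 'm::t2_space) atlas \<Rightarrow>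
   ('g \<Rightarrow> 'm \<Rightarrow> 'm) \<Rightarrow> bool" where
  "proper_smooth_action G AG AM act \<longleftrightarrow> group_action G UNIV act \<and>
     msmooth_on (prod_atlas AG AM) AM UNIV (\<lambda>(g, m). act g m) \<and>
     proper_map euclidean euclidean (\<lambda>(g, m). (act g m, m))"

text \<open>
  A symplectic action with an equivariant momentum map \<open>J\<close>; the sign convention for Hamiltonian
  vector fields is \<open>\<omega>(X\<^sub>h, \<cdot>) = dh\<close>, and \<open>\<zeta>\<^sub>M\<close> is the Hamiltonian vector field of \<open>\<langle>J, \<zeta>\<rangle>\<close>.
\<close>

definition equivariant_momentum_map ::
  "'g::t2_space monoid \<Rightarrow> ('e::banach, 'g) atlas \<Rightarrow> ('x::banach, 'm::t2_space) atlas \<Rightarrow>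
   ('m \<Rightarrow> 'x \<Rightarrow>\<^sub>L 'x \<Rightarrow>\<^sub>L real) \<Rightarrow> ('g \<Rightarrow> 'm \<Rightarrow> 'm) \<Rightarrow> ('m \<Rightarrow> 'e \<Rightarrow>\<^sub>L real) \<Rightarrow> bool" where
  "equivariant_momentum_map G AG AM \<omega> act J \<longleftrightarrow>
     (\<forall>g m u v. \<omega> (act g m) (mderiv AM AM (act g) m u) (mderiv AM AM (act g) m v) = \<omega> m u v) \<and>
     msmooth_on AM vec_atlas UNIV J \<and>
     (\<forall>m \<zeta> v. \<omega> m (inf_gen G AG AM act \<zeta> m) v = mderiv AM vec_atlas J m v \<zeta>) \<and>
     (\<forall>g m. J (act g m) = coAd G AG g (J m))"

definition invariant_hamiltonian ::
  "('x::banach, 'm::t2_space) atlas \<Rightarrow> ('g \<Rightarrow> 'm \<Rightarrow> 'm) \<Rightarrow> ('m \<Rightarrow> real) \<Rightarrow> bool" where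
  "invariant_hamiltonian AM act h \<longleftrightarrow>
     msmooth_on AM vec_atlas UNIV h \<and> (\<forall>g m. h (act g m) = h m)"

text \<open>Integral curves of \<open>X\<^sub>h\<close>:\<close>

definition hamiltonian_trajectory ::
  "('x::banach, 'm::t2_space) atlas \<Rightarrow> ('m \<Rightarrow> 'x \<Rightarrow>\<^sub>L 'x \<Rightarrow>\<^sub>L real) \<Rightarrow> ('m \<Rightarrow> real) \<Rightarrow>
   (real \<Rightarrow> 'm) \<Rightarrow> bool" where
  "hamiltonian_trajectory AM \<omega> h c \<longleftrightarrow> msmooth_on vec_atlas AM UNIV c \<and>
     (\<forall>t v. \<omega> (c t) (mderiv vec_atlas AM c t 1) v = mderiv AM vec_atlas h (c t) v)"

text \<open>\<open>F\<^sub>t(m\<^sub>e) = exp (t \<xi>) \<cdot> m\<^sub>e\<close> for the flow \<open>F\<^sub>t\<close> of \<open>X\<^sub>h\<close>:\<close>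

definition relative_equilibrium ::
  "'g::t2_space monoid \<Rightarrow> ('e::banach, 'g) atlas \<Rightarrow> ('x::banach, 'm::t2_space) atlas \<Rightarrow>
   ('m \<Rightarrow> 'x \<Rightarrow>\<^sub>L 'x \<Rightarrow>\<^sub>L real) \<Rightarrow> ('g \<Rightarrow> 'm \<Rightarrow> 'm) \<Rightarrow> ('m \<Rightarrow> real) \<Rightarrow> 'm \<Rightarrow> 'e \<Rightarrow> bool" where
  "relative_equilibrium G AG AM \<omega> act h me \<xi> \<longleftrightarrow>
     (\<exists>c. one_param G AG \<xi> c \<and> hamiltonian_trajectory AM \<omega> h (\<lambda>t. act (c t) me))"


section \<open>Linear algebra\<close>

definition direct_sum ::
  "'a::real_vector set \<Rightarrow> 'a set \<Rightarrow> 'a set \<Rightarrow> bool" where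
  "direct_sum S T U \<longleftrightarrow> subspace S \<and> subspace T \<and> S \<inter> T = {0} \<and> S + T = U"

text \<open>Projection onto \<open>S\<close> along a complement \<open>T\<close>:\<close>

definition proj_along :: "'a::real_vector set \<Rightarrow> 'a set \<Rightarrow> 'a \<Rightarrow> 'a" where
  "proj_along S T x = (THE y. y \<in> S \<and> x - y \<in> T)"

definition annihilator :: "'e::real_normed_vector set \<Rightarrow> ('e \<Rightarrow>\<^sub>L real) set" where
  "annihilator S = {\<nu>. \<forall>\<zeta>\<in>S. blinfun_apply \<nu> \<zeta> = 0}"

definition fin_dim :: "'a::real_vector set \<Rightarrow> bool" where
  "fin_dim S \<longleftrightarrow> (\<exists>B. finite B \<and> S \<subseteq> span B)"

definition fredholm :: "('a::real_normed_vector \<Rightarrow> 'b::real_normed_vector) \<Rightarrow> bool" where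
  "fredholm L \<longleftrightarrow> bounded_linear L \<and> fin_dim {v. L v = 0} \<and> closed (range L) \<and>
     (\<exists>B. finite B \<and> span (range L \<union> B) = UNIV)"

text \<open>The Banach space \<open>'v\<close> is a Hilbert space up to an equivalent norm:\<close>

definition hilbertable :: "'v::banach itself \<Rightarrow> bool" where
  "hilbertable _ \<longleftrightarrow> (\<exists>b :: 'v \<Rightarrow> 'v \<Rightarrow> real. bounded_bilinear b \<and> (\<forall>u v. b u v = b v u) \<and>
     (\<exists>c>0. \<forall>v. c * (norm v)\<^sup>2 \<le> b v v))"

text \<open>
  The subspaces \<open>\<mm>\<close> and \<open>\<qq>\<close> of \<open>\<gg>\<close> are given by their injections \<open>im : 'p \<rightarrow> \<gg>\<close> and \<open>iq : 'q \<rightarrow> \<gg>\<close>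
  (so \<open>\<mm>\<^sup>*\<close> is the type \<open>'p \<Rightarrow>\<^sub>L real\<close>), and \<open>Pm\<close>, \<open>Pq\<close> are the projections associated with the
  splitting \<open>\<gg> = \<gg>\<^bsub>me\<^esub> \<oplus> \<mm> \<oplus> \<qq>\<close>, \<open>\<gg>\<^sub>\<mu> = \<gg>\<^bsub>me\<^esub> \<oplus> \<mm>\<close>.
\<close>

definition isotropy_splitting ::
  "'e::banach set \<Rightarrow> 'e set \<Rightarrow> ('p::real_normed_vector \<Rightarrow>\<^sub>L 'e) \<Rightarrow> ('e \<Rightarrow>\<^sub>L 'p) \<Rightarrow>
   ('q::real_normed_vector \<Rightarrow>\<^sub>L 'e) \<Rightarrow> ('e \<Rightarrow>\<^sub>L 'q) \<Rightarrow> bool" where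
  "isotropy_splitting gme gmu im Pm iq Pq \<longleftrightarrow> inj (blinfun_apply im) \<and> inj (blinfun_apply iq) \<and>
     direct_sum gme (range im) gmu \<and> direct_sum gmu (range iq) UNIV \<and>
     (\<forall>\<alpha>\<in>gme. \<forall>\<beta> \<gamma>. Pm (\<alpha> + im \<beta> + iq \<gamma>) = \<beta> \<and> Pq (\<alpha> + im \<beta> + iq \<gamma>) = \<gamma>)"


section \<open>Slice mappings\<close>

text \<open>
  Smooth, injective, and with an inverse that locally extends to a smooth map on an open
  subset of \<open>M\<close>:
\<close>

definition diffeo_onto_image ::
  "('x::banach, 'm::t2_space) atlas \<Rightarrow> 'y::banach set \<Rightarrow> ('y \<Rightarrow> 'm) \<Rightarrow> bool" where
  "diffeo_onto_image AM \<U> \<Psi> \<longleftrightarrow> msmooth_on vec_atlas AM \<U> \<Psi> \<and> inj_on \<Psi> \<U> \<and>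
     (\<forall>p\<in>\<U>. \<exists>N r. \<Psi> p \<in> N \<and> msmooth_on AM vec_atlas N r \<and>
        (\<forall>p'\<in>\<U>. \<Psi> p' \<in> N \<longrightarrow> r (\<Psi> p') = p'))"

definition slice_mapping ::
  "'g::t2_space monoid \<Rightarrow> ('e::banach, 'g) atlas \<Rightarrow> ('x::banach, 'm::t2_space) atlas \<Rightarrow>
   ('g \<Rightarrow> 'm \<Rightarrow> 'm) \<Rightarrow> ('m \<Rightarrow> 'e \<Rightarrow>\<^sub>L real) \<Rightarrow> 'm \<Rightarrow>
   ('p::real_normed_vector \<Rightarrow>\<^sub>L 'e) \<Rightarrow> ('e \<Rightarrow>\<^sub>L 'p) \<Rightarrow> ('q::real_normed_vector \<Rightarrow>\<^sub>L 'e) \<Rightarrow>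
   (('p \<Rightarrow>\<^sub>L real) \<times> 'v::banach) set \<Rightarrow> (('p \<Rightarrow>\<^sub>L real) \<times> 'v \<Rightarrow> 'm) \<Rightarrow> bool" where
  "slice_mapping G AG AM act J me im Pm iq \<U> \<Psi> \<longleftrightarrow>
     open \<U> \<and> (0, 0) \<in> \<U> \<and> diffeo_onto_image AM \<U> \<Psi> \<and>
     \<Psi> (0, 0) = me \<and>
     (\<forall>p\<in>\<U>. (\<lambda>\<zeta>. inf_gen G AG AM act \<zeta> (\<Psi> p)) ` (range im + range iq)
             + range (mderiv vec_atlas AM \<Psi> p) = UNIV) \<and>
     (\<forall>\<delta>\<eta> \<delta>v. mderiv vec_atlas vec_atlas (J \<circ> \<Psi>) (0, 0) (\<delta>\<eta>, \<delta>v) = \<delta>\<eta> o\<^sub>L Pm)"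

text \<open>
  The subspace \<open>V\<close> of \<open>X\<close> is the image of the Banach space \<open>'v\<close> under the linear embedding \<open>iV\<close>.
\<close>

definition slice_from_chart ::
  "'g::t2_space monoid \<Rightarrow> ('e::banach, 'g) atlas \<Rightarrow> ('x::banach, 'm::t2_space) atlas \<Rightarrow>
   ('g \<Rightarrow> 'm \<Rightarrow> 'm) \<Rightarrow> ('m \<Rightarrow> 'e \<Rightarrow>\<^sub>L real) \<Rightarrow> 'm \<Rightarrow> 'e set \<Rightarrow>
   ('p::real_normed_vector \<Rightarrow>\<^sub>L 'e) \<Rightarrow> ('e \<Rightarrow>\<^sub>L 'p) \<Rightarrow> ('q::real_normed_vector \<Rightarrow>\<^sub>L 'e) \<Rightarrow>
   'x set \<Rightarrow> ('x \<Rightarrow> 'm) \<Rightarrow> ('v::banach \<Rightarrow>\<^sub>L 'x) \<Rightarrow> 'x set \<Rightarrow>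
   (('p \<Rightarrow>\<^sub>L real) \<times> 'v \<Rightarrow> 'm) \<Rightarrow> bool" where
  "slice_from_chart G AG AM act J me gme im Pm iq U \<psi> iV W \<Psi> \<longleftrightarrow>
     compatible_chart AM (U, \<psi>) \<and> 0 \<in> U \<and> \<psi> 0 = me \<and>
     (\<exists>c>0. \<forall>v. c * norm v \<le> norm (iV v)) \<and> subspace W \<and>
     direct_sum (mderiv vec_atlas AM \<psi> 0 ` range iV)
       ((\<lambda>\<zeta>. inf_gen G AG AM act \<zeta> me) ` range im) {u. mderiv AM vec_atlas J me u = 0} \<and>
     (let A = (\<lambda>w. mderiv AM vec_atlas J me (mderiv vec_atlas AM \<psi> 0 w)) in
        bij_betw A W (annihilator (gme + range iq)) \<and>
        (\<forall>\<^sub>F (\<eta>, v) in nhds (0, 0). \<Psi> (\<eta>, v) = \<psi> (iV v + inv_into W A (\<eta> o\<^sub>L Pm))))"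

text \<open>
  \<open>\<mm>\<^sup>*\<close> is regarded as a subspace of \<open>\<gg>\<^sup>*\<close> by means of \<open>\<eta> \<mapsto> \<eta> \<circ> Pm\<close>. The coadjoint action on \<open>\<mm>\<^sup>*\<close>
  and the adjoint action on \<open>\<mm>\<close> are those on \<open>\<gg>\<^sup>*\<close> and \<open>\<gg>\<close> read through the identifications.
\<close>

definition mstar_act ::
  "'g monoid \<Rightarrow> ('e::banach, 'g) atlas \<Rightarrow> ('p::real_normed_vector \<Rightarrow>\<^sub>L 'e) \<Rightarrow> ('e \<Rightarrow>\<^sub>L 'p) \<Rightarrow>
   'g \<Rightarrow> ('p \<Rightarrow>\<^sub>L real) \<Rightarrow> 'p \<Rightarrow>\<^sub>L real" where
  "mstar_act G AG im Pm g \<eta> = coAd G AG g (\<eta> o\<^sub>L Pm) o\<^sub>L im"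

definition linear_action ::
  "'g::t2_space monoid \<Rightarrow> 'g set \<Rightarrow> ('g \<Rightarrow> 'v::real_normed_vector \<Rightarrow>\<^sub>L 'v) \<Rightarrow> bool" where
  "linear_action G H \<tau> \<longleftrightarrow> \<tau> \<one>\<^bsub>G\<^esub> = id_blinfun \<and>
     (\<forall>a\<in>H. \<forall>b\<in>H. \<tau> (a \<otimes>\<^bsub>G\<^esub> b) = \<tau> a o\<^sub>L \<tau> b) \<and>
     continuous_on (H \<times> UNIV) (\<lambda>(a, v). \<tau> a v)"

definition equivariant_slice ::
  "'g::t2_space monoid \<Rightarrow> ('e::banach, 'g) atlas \<Rightarrow> ('g \<Rightarrow> 'm \<Rightarrow> 'm) \<Rightarrow> 'g set \<Rightarrow>
   ('p::real_normed_vector \<Rightarrow>\<^sub>L 'e) \<Rightarrow> ('e \<Rightarrow>\<^sub>L 'p) \<Rightarrow> ('g \<Rightarrow> 'v::banach \<Rightarrow>\<^sub>L 'v) \<Rightarrow>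
   (('p \<Rightarrow>\<^sub>L real) \<times> 'v) set \<Rightarrow> (('p \<Rightarrow>\<^sub>L real) \<times> 'v \<Rightarrow> 'm) \<Rightarrow> bool" where
  "equivariant_slice G AG act H im Pm \<tau> \<U> \<Psi> \<longleftrightarrow>
     (\<forall>g\<in>H. coAd G AG g ` range (\<lambda>\<eta>. \<eta> o\<^sub>L Pm) \<subseteq> range (\<lambda>\<eta>. \<eta> o\<^sub>L Pm)) \<and>
     linear_action G H \<tau> \<and>
     (\<forall>g\<in>H. \<forall>(\<eta>, v)\<in>\<U>. (mstar_act G AG im Pm g \<eta>, \<tau> g v) \<in> \<U> \<and>
        \<Psi> (mstar_act G AG im Pm g \<eta>, \<tau> g v) = act g (\<Psi> (\<eta>, v)))"

text \<open>The contragredient action on \<open>V\<^sup>*\<close>:\<close>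

definition contragredient ::
  "'g monoid \<Rightarrow> ('g \<Rightarrow> 'v::real_normed_vector \<Rightarrow>\<^sub>L 'v) \<Rightarrow> 'g \<Rightarrow> ('v \<Rightarrow>\<^sub>L real) \<Rightarrow> 'v \<Rightarrow>\<^sub>L real" where
  "contragredient G \<tau> g \<phi> = \<phi> o\<^sub>L \<tau> (inv\<^bsub>G\<^esub> g)"


section \<open>The reduction procedure\<close>

definition partial_fst ::
  "('a::real_normed_vector \<times> 'b \<Rightarrow> real) \<Rightarrow> 'a \<times> 'b \<Rightarrow> 'a \<Rightarrow>\<^sub>L real" where
  "partial_fst f = (\<lambda>(a, b). Blinfun (frechet_derivative (\<lambda>x. f (x, b)) (at a)))"

definition partial_snd ::
  "('a \<times> 'b::real_normed_vector \<Rightarrow> real) \<Rightarrow> 'a \<times> 'b \<Rightarrow> 'b \<Rightarrow>\<^sub>L real" where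
  "partial_snd f = (\<lambda>(a, b). Blinfun (frechet_derivative (\<lambda>y. f (a, y)) (at b)))"

text \<open>
  \<open>f\<close>, defined near \<open>0\<close> in \<open>P\<close> with values in \<open>Q\<close>, is the unique local solution \<open>y = f p\<close>,
  \<open>f 0 = 0\<close>, of \<open>E p y\<close> provided by the Implicit Function Theorem. Neighbourhoods are relative
  to \<open>P\<close> and \<open>Q\<close>; values of \<open>f\<close> away from the origin are irrelevant.
\<close>

definition local_solution ::
  "'a::real_normed_vector set \<Rightarrow> 'b::real_normed_vector set \<Rightarrow> ('a \<Rightarrow> 'b \<Rightarrow> bool) \<Rightarrow>
   ('a \<Rightarrow> 'b) \<Rightarrow> bool" where
  "local_solution P Q E f \<longleftrightarrow> f 0 = 0 \<and>
     (\<exists>N N'. open N \<and> 0 \<in> N \<and> open N' \<and> 0 \<in> N' \<and> continuous_on (P \<inter> N) f \<and>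
        (\<forall>p\<in>P \<inter> N. f p \<in> Q \<inter> N' \<and> (\<forall>y\<in>Q \<inter> N'. E p y \<longleftrightarrow> y = f p)))"

text \<open>\<open>\<H> - j\<^sup>\<zeta>\<close>:\<close>

definition aug_ham ::
  "('m \<Rightarrow> real) \<Rightarrow> ('m \<Rightarrow> 'e::real_normed_vector \<Rightarrow>\<^sub>L real) \<Rightarrow> ('s \<Rightarrow> 'm) \<Rightarrow> 'e \<Rightarrow> 's \<Rightarrow> real" where
  "aug_ham h J \<Psi> \<zeta> p = h (\<Psi> p) - J (\<Psi> p) \<zeta>"

definition step1_equation ::
  "'g monoid \<Rightarrow> ('e::banach, 'g) atlas \<Rightarrow> ('m \<Rightarrow> 'e \<Rightarrow>\<^sub>L real) \<Rightarrow> 'e \<Rightarrow>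
   ('p::real_normed_vector \<Rightarrow>\<^sub>L 'e) \<Rightarrow> ('q::real_normed_vector \<Rightarrow>\<^sub>L 'e) \<Rightarrow>
   (('p \<Rightarrow>\<^sub>L real) \<times> 'v \<Rightarrow> 'm) \<Rightarrow> ('p \<Rightarrow>\<^sub>L real) \<times> 'v \<times> 'e \<times> 'p \<Rightarrow> 'q \<Rightarrow> bool" where
  "step1_equation G AG J \<xi> im iq \<Psi> = (\<lambda>(\<eta>, v, \<alpha>, \<beta>) c.
     ad_star G AG (\<xi> + \<alpha> + im \<beta> + iq c) (J (\<Psi> (\<eta>, v))) o\<^sub>L iq = 0)"

definition omega1 ::
  "'e::banach \<Rightarrow> ('p::real_normed_vector \<Rightarrow>\<^sub>L 'e) \<Rightarrow> ('q::real_normed_vector \<Rightarrow>\<^sub>L 'e) \<Rightarrow>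
   (('p \<Rightarrow>\<^sub>L real) \<times> 'v \<times> 'e \<times> 'p \<Rightarrow> 'q) \<Rightarrow> ('p \<Rightarrow>\<^sub>L real) \<times> 'v \<times> 'e \<times> 'p \<Rightarrow> 'e" where
  "omega1 \<xi> im iq \<gamma> = (\<lambda>(\<eta>, v, \<alpha>, \<beta>). \<xi> + \<alpha> + im \<beta> + iq (\<gamma> (\<eta>, v, \<alpha>, \<beta>)))"

definition step2_equation ::
  "('m \<Rightarrow> real) \<Rightarrow> ('m \<Rightarrow> 'e::banach \<Rightarrow>\<^sub>L real) \<Rightarrow>
   (('p::real_normed_vector \<Rightarrow>\<^sub>L real) \<times> 'v \<Rightarrow> 'm) \<Rightarrow>
   (('p \<Rightarrow>\<^sub>L real) \<times> 'v \<times> 'e \<times> 'p \<Rightarrow> 'e) \<Rightarrow> ('p \<Rightarrow>\<^sub>L real) \<times> 'v \<times> 'e \<Rightarrow> 'p \<Rightarrow> bool" where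
  "step2_equation h J \<Psi> \<omega>1 = (\<lambda>(\<eta>, v, \<alpha>) b.
     partial_fst (aug_ham h J \<Psi> (\<omega>1 (\<eta>, v, \<alpha>, b))) (\<eta>, v) = 0)"

definition omega2 ::
  "('a \<times> 'v \<times> 'e \<times> 'p \<Rightarrow> 'e) \<Rightarrow> ('a \<times> 'v \<times> 'e \<Rightarrow> 'p) \<Rightarrow> 'a \<times> 'v \<times> 'e \<Rightarrow> 'e" where
  "omega2 \<omega>1 \<beta> = (\<lambda>(\<eta>, v, \<alpha>). \<omega>1 (\<eta>, v, \<alpha>, \<beta> (\<eta>, v, \<alpha>)))"

text \<open>\<open>\<langle>\<L> v, w\<rangle> = D\<^bsub>VV\<^esub>(\<H> - j\<^sup>\<xi>)(0,0)(v, w)\<close>:\<close>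

definition hess_V ::
  "('m \<Rightarrow> real) \<Rightarrow> ('m \<Rightarrow> 'e::banach \<Rightarrow>\<^sub>L real) \<Rightarrow>
   (('p::real_normed_vector \<Rightarrow>\<^sub>L real) \<times> 'v::real_normed_vector \<Rightarrow> 'm) \<Rightarrow> 'e \<Rightarrow>
   'v \<Rightarrow> 'v \<Rightarrow>\<^sub>L real" where
  "hess_V h J \<Psi> \<xi> = frechet_derivative (\<lambda>v. partial_snd (aug_ham h J \<Psi> \<xi>) (0, v)) (at 0)"

definition step3_equation ::
  "('m \<Rightarrow> real) \<Rightarrow> ('m \<Rightarrow> 'e::banach \<Rightarrow>\<^sub>L real) \<Rightarrow>
   (('p::real_normed_vector \<Rightarrow>\<^sub>L real) \<times> 'v::real_normed_vector \<Rightarrow> 'm) \<Rightarrow>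
   (('p \<Rightarrow>\<^sub>L real) \<times> 'v \<times> 'e \<Rightarrow> 'e) \<Rightarrow> (('v \<Rightarrow>\<^sub>L real) \<Rightarrow> 'v \<Rightarrow>\<^sub>L real) \<Rightarrow>
   ('p \<Rightarrow>\<^sub>L real) \<times> 'v \<times> 'e \<Rightarrow> 'v \<Rightarrow> bool" where
  "step3_equation h J \<Psi> \<omega>2 \<P> = (\<lambda>(\<eta>, v0, \<alpha>) y.
     let d = partial_snd (aug_ham h J \<Psi> (\<omega>2 (\<eta>, v0 + y, \<alpha>))) (\<eta>, v0 + y) in d - \<P> d = 0)"

definition Xi_map ::
  "('a \<times> 'v::real_normed_vector \<times> 'e \<Rightarrow> 'e) \<Rightarrow> ('a \<times> 'v \<times> 'e \<Rightarrow> 'v) \<Rightarrow> 'a \<times> 'v \<times> 'e \<Rightarrow> 'e" where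
  "Xi_map \<omega>2 v1 = (\<lambda>(\<eta>, v0, \<alpha>). \<omega>2 (\<eta>, v0 + v1 (\<eta>, v0, \<alpha>), \<alpha>))"

definition B_map ::
  "('m \<Rightarrow> real) \<Rightarrow> ('m \<Rightarrow> 'e::banach \<Rightarrow>\<^sub>L real) \<Rightarrow>
   (('p::real_normed_vector \<Rightarrow>\<^sub>L real) \<times> 'v::real_normed_vector \<Rightarrow> 'm) \<Rightarrow>
   (('p \<Rightarrow>\<^sub>L real) \<times> 'v \<times> 'e \<Rightarrow> 'e) \<Rightarrow> (('v \<Rightarrow>\<^sub>L real) \<Rightarrow> 'v \<Rightarrow>\<^sub>L real) \<Rightarrow>
   (('p \<Rightarrow>\<^sub>L real) \<times> 'v \<times> 'e \<Rightarrow> 'v) \<Rightarrow> ('p \<Rightarrow>\<^sub>L real) \<times> 'v \<times> 'e \<Rightarrow> 'v \<Rightarrow>\<^sub>L real" where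
  "B_map h J \<Psi> \<Xi> \<P> v1 = (\<lambda>(\<eta>, v0, \<alpha>).
     \<P> (partial_snd (aug_ham h J \<Psi> (\<Xi> (\<eta>, v0, \<alpha>))) (\<eta>, v0 + v1 (\<eta>, v0, \<alpha>))))"

definition rho_map ::
  "'g monoid \<Rightarrow> ('e::banach, 'g) atlas \<Rightarrow> ('m \<Rightarrow> 'e \<Rightarrow>\<^sub>L real) \<Rightarrow>
   ('p::real_normed_vector \<Rightarrow>\<^sub>L 'e) \<Rightarrow> (('p \<Rightarrow>\<^sub>L real) \<times> 'v::real_normed_vector \<Rightarrow> 'm) \<Rightarrow>
   (('p \<Rightarrow>\<^sub>L real) \<times> 'v \<times> 'e \<Rightarrow> 'e) \<Rightarrow> (('p \<Rightarrow>\<^sub>L real) \<times> 'v \<times> 'e \<Rightarrow> 'v) \<Rightarrow>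
   ('p \<Rightarrow>\<^sub>L real) \<times> 'v \<times> 'e \<Rightarrow> 'p \<Rightarrow>\<^sub>L real" where
  "rho_map G AG J im \<Psi> \<Xi> v1 = (\<lambda>(\<eta>, v0, \<alpha>).
     ad_star G AG (\<Xi> (\<eta>, v0, \<alpha>)) (J (\<Psi> (\<eta>, v0 + v1 (\<eta>, v0, \<alpha>)))) o\<^sub>L im)"

end

theory Submission
  imports Defs
begin

text \<open>
  Each of the maps \<open>\<gamma>\<close>, \<open>\<beta>\<close>, \<open>v\<^sub>1\<close> is the unique small solution \<open>y = f p\<close> of an equation \<open>E p y\<close>. If
  \<open>E p y\<close> implies \<open>E (g p) (g y)\<close>, then \<open>g (f p)\<close> and \<open>f (g p)\<close> both solve the equation at \<open>g p\<close>, and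
  uniqueness makes them equal -- provided that \<open>g p\<close> and \<open>g (f p)\<close> do not leave the neighbourhoods on
  which the solution is unique. One neighbourhood serves all \<open>g\<close> in \<open>G\<^bsub>me\<^esub> \<inter> G\<^sub>\<xi>\<close> because this group is
  compact: the action is proper, so \<open>G\<^bsub>me\<^esub>\<close> is compact, and \<open>G\<^sub>\<xi>\<close> is closed. By the tube lemma a compact
  group that acts continuously and fixes the origin has arbitrarily small invariant neighbourhoods
  of it. This is \<open>local_solution_equivariant\<close>.

  The equations are invariant for the following reasons. Equivariance of \<open>J\<close> and \<open>\<Psi>\<close>, together with
  \<open>Ad g \<xi> = \<xi>\<close> and \<open>ad (Ad g \<zeta>) = Ad g \<circ> ad \<zeta> \<circ> Ad g\<^sup>-\<^sup>1\<close>, gives step 1. For the other two steps one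
  differentiates the identity \<open>(\<H> - j\<^bsup>Ad g \<zeta>\<^esup>)(g p) = (\<H> - j\<^sup>\<zeta>)(p)\<close> along \<open>\<mm>\<^sup>*\<close> and along \<open>V\<close>, where
  \<open>\<zeta>\<close> is \<open>\<omega>\<^sub>1\<close> or \<open>\<omega>\<^sub>2\<close>, known to be equivariant from the preceding step. Differentiating twice along
  \<open>V\<close> at the origin, with \<open>\<zeta> = \<xi>\<close>, shows that \<open>\<L>\<close> is equivariant; hence its kernel and range are
  invariant and the projection onto \<open>V\<^sub>2\<close> along the range commutes with the group. The maps \<open>\<Xi>\<close>, \<open>B\<close>
  and \<open>\<rho>\<close> are composed of equivariant maps.

  Two points require more than formal manipulation. First, derivatives are defined by choice, so
  a derivative may be transported by \<open>g\<close> only where it exists. Two derivatives are enough for everything,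
  and the pointwise notion \<open>twice_diff_at\<close> replaces smoothness throughout. In particular \<open>Ad\<close> is
  differentiable at the identity, being a partial derivative of the conjugation \<open>(g, a) \<mapsto> g a g\<^sup>-\<^sup>1\<close>.

  Secondly, \<open>\<gg>\<^bsub>me\<^esub>\<close>, defined by one-parameter subgroups of \<open>G\<^bsub>me\<^esub>\<close>, has to be invariant under \<open>Ad g\<close>. The
  description \<open>\<gg>\<^bsub>me\<^esub> = {\<zeta>. \<zeta>\<^sub>M(me) = 0}\<close> makes this a consequence of the chain rule. Its nontrivial
  half, which usually comes from the exponential map, is here a consequence of uniqueness in steps 1
  and 2: if \<open>\<zeta>\<^sub>M(me) = 0\<close>, then the \<open>\<mm>\<close>- and \<open>\<qq>\<close>-components of \<open>\<zeta>\<close> can be added, in any multiple,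
  to the trivial solutions of these steps, so they vanish (\<open>mem_gme\<close>).
\<close>


section \<open>Maps that are twice differentiable at a point\<close>

text \<open>
  Differentiable near \<open>x\<close>, with a derivative that is differentiable at \<open>x\<close> itself in the operator
  norm. Unlike \<open>C\<^sup>2\<close> on an open set, this is a condition at one point, and it is closed under
  composition.
\<close>

definition twice_diff_at ::
  "('a::real_normed_vector \<Rightarrow> 'b::real_normed_vector) \<Rightarrow> 'a \<Rightarrow> bool" where
  "twice_diff_at f x \<longleftrightarrow>
     (\<exists>f'. (\<forall>\<^sub>F y in nhds x. (f has_derivative blinfun_apply (f' y)) (at y)) \<and>
           f' differentiable (at x))"

lemma twice_diff_at_has_derivative:
  assumes "twice_diff_at f x"
  shows "(f has_derivative frechet_derivative f (at x)) (at x)"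
  using assms unfolding twice_diff_at_def frechet_derivative_works[symmetric]
  by (auto simp: differentiable_def dest: eventually_nhds_x_imp_x)

lemma twice_diff_at_tendsto:
  assumes "twice_diff_at f x"
  shows "(f \<longlongrightarrow> f x) (nhds x)"
  using has_derivative_continuous[OF twice_diff_at_has_derivative[OF assms]]
  by (simp add: continuous_at tendsto_at_iff_tendsto_nhds)

lemma has_derivative_cong_nhds:
  assumes "(f has_derivative f') (at x)" and "\<forall>\<^sub>F y in nhds x. f y = g y"
  shows "(g has_derivative f') (at x)"
  using has_derivative_transform_eventually[OF assms(1), of g]
    eventually_nhds_x_imp_x[OF assms(2)] assms(2)
  by (simp add: eventually_nhds_conv_at)

lemma twice_diff_at_cong:
  assumes "twice_diff_at f x" and "\<forall>\<^sub>F y in nhds x. f y = g y"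
  shows "twice_diff_at g x"
proof -
  obtain f' where f': "\<forall>\<^sub>F y in nhds x. (f has_derivative blinfun_apply (f' y)) (at y)"
    "f' differentiable (at x)"
    using assms(1) unfolding twice_diff_at_def by blast
  have "\<forall>\<^sub>F y in nhds x. \<forall>\<^sub>F z in nhds y. f z = g z"
    using assms(2) by (simp add: eventually_eventually)
  with f'(1) have "\<forall>\<^sub>F y in nhds x. (g has_derivative blinfun_apply (f' y)) (at y)"
    by eventually_elim (rule has_derivative_cong_nhds)
  with f'(2) show ?thesis unfolding twice_diff_at_def by blast
qed

lemma twice_diff_at_compose:
  assumes f: "twice_diff_at f x" and g: "twice_diff_at g (f x)"
  shows "twice_diff_at (\<lambda>y. g (f y)) x"
proof -
  obtain f' where f': "\<forall>\<^sub>F y in nhds x. (f has_derivative blinfun_apply (f' y)) (at y)"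
    "f' differentiable (at x)"
    using f unfolding twice_diff_at_def by blast
  obtain g' where g': "\<forall>\<^sub>F y in nhds (f x). (g has_derivative blinfun_apply (g' y)) (at y)"
    "g' differentiable (at (f x))"
    using g unfolding twice_diff_at_def by blast
  have "\<forall>\<^sub>F y in nhds x. (g has_derivative blinfun_apply (g' (f y))) (at (f y))"
    using g'(1) twice_diff_at_tendsto[OF f] by (rule eventually_compose_filterlim)
  with f'(1) have "\<forall>\<^sub>F y in nhds x.
      ((\<lambda>y. g (f y)) has_derivative blinfun_apply (g' (f y) o\<^sub>L f' y)) (at y)"
  proof eventually_elim
    case (elim y)
    show ?case
      using diff_chain_at[OF elim] by (simp add: o_def blinfun_compose.rep_eq)
  qed
  moreover have "(\<lambda>y. g' (f y) o\<^sub>L f' y) differentiable (at x)"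
  proof -
    have "(\<lambda>y. g' (f y)) differentiable (at x)"
      using differentiable_chain_at[of f x g'] g'(2) twice_diff_at_has_derivative[OF f]
      by (auto simp: o_def differentiable_def)
    then show ?thesis
      using f'(2) bounded_bilinear.FDERIV[OF bounded_bilinear_blinfun_compose]
      unfolding differentiable_def by (elim exE) (rule exI)
  qed
  ultimately show ?thesis
    unfolding twice_diff_at_def by (intro exI[of _ "\<lambda>y. g' (f y) o\<^sub>L f' y"] conjI)
qed

lemma twice_diff_at_bounded_linear:
  assumes "bounded_linear f" shows "twice_diff_at f x"
  unfolding twice_diff_at_def
  by (rule exI[of _ "\<lambda>_. Blinfun f"])
     (simp add: bounded_linear_Blinfun_apply bounded_linear_imp_has_derivative assms)

lemma twice_diff_at_const: "twice_diff_at (\<lambda>_. c) x"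
  unfolding twice_diff_at_def
  by (rule exI[of _ "\<lambda>_. 0"]) (auto simp: zero_blinfun.rep_eq)

lemma twice_diff_at_add:
  assumes "twice_diff_at f x" and "twice_diff_at g x"
  shows "twice_diff_at (\<lambda>y. f y + g y) x"
proof -
  obtain f' g' where f': "\<forall>\<^sub>F y in nhds x. (f has_derivative blinfun_apply (f' y)) (at y)"
    "f' differentiable (at x)"
    and g': "\<forall>\<^sub>F y in nhds x. (g has_derivative blinfun_apply (g' y)) (at y)"
    "g' differentiable (at x)"
    using assms unfolding twice_diff_at_def by blast
  have "\<forall>\<^sub>F y in nhds x. ((\<lambda>y. f y + g y) has_derivative blinfun_apply (f' y + g' y)) (at y)"
    using f'(1) g'(1)
    by eventually_elim (auto simp: plus_blinfun.rep_eq intro: has_derivative_add)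
  moreover have "(\<lambda>y. f' y + g' y) differentiable (at x)"
    using f'(2) g'(2) by (rule differentiable_add)
  ultimately show ?thesis
    unfolding twice_diff_at_def by (intro exI[of _ "\<lambda>y. f' y + g' y"] conjI)
qed

lemma twice_diff_at_Pair:
  assumes f: "twice_diff_at f x" and g: "twice_diff_at g x"
  shows "twice_diff_at (\<lambda>y. (f y, g y)) x"
proof -
  have "twice_diff_at (\<lambda>y. (f y, 0)) x"
    by (rule twice_diff_at_compose[OF f, where g = "\<lambda>z. (z, 0)"])
       (intro twice_diff_at_bounded_linear bounded_linear_intros)
  moreover have "twice_diff_at (\<lambda>y. (0, g y)) x"
    by (rule twice_diff_at_compose[OF g, where g = "\<lambda>z. (0, z)"])
       (intro twice_diff_at_bounded_linear bounded_linear_intros)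
  ultimately show ?thesis
    using twice_diff_at_add by fastforce
qed

lemma twice_diff_at_fst: "twice_diff_at fst x" and twice_diff_at_snd: "twice_diff_at snd x"
  by (rule twice_diff_at_bounded_linear[OF bounded_linear_fst]
      twice_diff_at_bounded_linear[OF bounded_linear_snd])+

text \<open>
  The first two members of the sequence of multilinear maps in \<^const>\<open>smooth_on\<close> are the
  derivatives of \<open>f\<close>. Only linearity in the first argument is part of that definition, so linearity of
  the second derivative in its second argument has to be recovered from the first derivative.
\<close>

lemma smooth_on_twice_diff_at:
  assumes "smooth_on S f" and x: "x \<in> S"
  shows "twice_diff_at f x"
proof -
  obtain D where S: "open S" and D: "(\<forall>x\<in>S. D 0 x [] = f x) \<and>
       (\<forall>n. \<forall>x\<in>S.
          (\<forall>vs. length vs = n \<longrightarrow> linear (\<lambda>v. D (Suc n) x (v # vs))) \<and>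
          (\<exists>K. \<forall>vs. length vs = Suc n \<longrightarrow>
             norm (D (Suc n) x vs) \<le> K * prod_list (map norm vs)) \<and>
          (\<forall>\<epsilon>>0. \<exists>\<delta>>0. \<forall>y\<in>S. norm (y - x) < \<delta> \<longrightarrow> (\<forall>vs. length vs = n \<longrightarrow>
             norm (D n y vs - D n x vs - D (Suc n) x ((y - x) # vs))
               \<le> \<epsilon> * norm (y - x) * prod_list (map norm vs))))"
    using assms(1) unfolding smooth_on_def by (elim conjE exE) (rule that, assumption, rule conjI)
  have D0: "D 0 x [] = f x" if "x \<in> S" for x
    using D that by blast
  have lin: "linear (\<lambda>v. D (Suc n) x (v # vs))" if "x \<in> S" "length vs = n" for n x vs
    using D that by blast
  have bdd: "\<exists>K. \<forall>vs. length vs = Suc n \<longrightarrow>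
      norm (D (Suc n) x vs) \<le> K * prod_list (map norm vs)" if "x \<in> S" for n x
    using D that by blast
  have der: "\<exists>\<delta>>0. \<forall>y\<in>S. norm (y - x) < \<delta> \<longrightarrow> (\<forall>vs. length vs = n \<longrightarrow>
      norm (D n y vs - D n x vs - D (Suc n) x ((y - x) # vs))
        \<le> \<epsilon> * norm (y - x) * prod_list (map norm vs))" if "x \<in> S" "\<epsilon> > 0" for n x \<epsilon>
    using D that by blast
  have bl1: "bounded_linear (\<lambda>v. D (Suc 0) y [v])" if "y \<in> S" for y
  proof -
    obtain K where "\<forall>vs. length vs = Suc 0 \<longrightarrow>
        norm (D (Suc 0) y vs) \<le> K * prod_list (map norm vs)" using bdd[OF \<open>y \<in> S\<close>] by blast
    then have K: "norm (D (Suc 0) y [v]) \<le> norm v * K" for v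
      by (elim allE[of _ "[v]"]) (simp add: mult.commute)
    show ?thesis
      by (rule bounded_linear_intro[of _ K])
         (use lin[OF that, of "[]" 0] K in \<open>auto simp: linear_iff\<close>)
  qed
  define f' where "f' y = Blinfun (\<lambda>v. D (Suc 0) y [v])" for y
  have f'_apply: "f' y v = D (Suc 0) y [v]" if "y \<in> S" for y v
    unfolding f'_def by (simp add: bl1[OF that] bounded_linear_Blinfun_apply)
  have has_der: "(f has_derivative blinfun_apply (f' y)) (at y)" if y: "y \<in> S" for y
  proof -
    have "(f has_derivative blinfun_apply (f' y)) (at y within S)"
      unfolding has_derivative_within_alt2
    proof (intro conjI allI impI)
      fix \<epsilon> :: real assume "\<epsilon> > 0"
      then obtain \<delta> where \<delta>: "\<delta> > 0" "\<And>z. z \<in> S \<Longrightarrow> norm (z - y) < \<delta> \<Longrightarrow>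
          norm (D 0 z [] - D 0 y [] - D (Suc 0) y [z - y]) \<le> \<epsilon> * norm (z - y)"
        using der[OF y \<open>\<epsilon> > 0\<close>, of 0] by auto
      show "\<forall>\<^sub>F z in at y within S. norm (f z - f y - f' y (z - y)) \<le> \<epsilon> * norm (z - y)"
        unfolding eventually_at
        by (rule exI[of _ \<delta>]) (use \<delta> y in \<open>auto simp: D0 f'_apply dist_norm\<close>)
    qed (rule blinfun.bounded_linear_right)
    then show ?thesis using at_within_open[OF y S] by simp
  qed
  obtain K where K: "\<And>w v. norm (D (Suc (Suc 0)) x [w, v]) \<le> K * (norm w * norm v)"
    and "K \<ge> 0"
  proof -
    obtain K where "\<forall>vs. length vs = Suc (Suc 0) \<longrightarrow>
        norm (D (Suc (Suc 0)) x vs) \<le> K * prod_list (map norm vs)" using bdd[OF x] by blast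
    then have "norm (D (Suc (Suc 0)) x [w, v]) \<le> K * (norm w * norm v)" for w v
      by (elim allE[of _ "[w, v]"]) simp
    moreover have "K * (norm w * norm v) \<le> \<bar>K\<bar> * (norm w * norm v)" for w v :: 'a
      by (intro mult_right_mono) auto
    ultimately show thesis using that[of "\<bar>K\<bar>"] order_trans by (metis abs_ge_zero)
  qed
  have linw: "linear (\<lambda>w. D (Suc (Suc 0)) x [w, v])" for v
    using lin[OF x, of "[v]" "Suc 0"] by simp
  have der2: "((\<lambda>y. D (Suc 0) y [v]) has_derivative (\<lambda>w. D (Suc (Suc 0)) x [w, v])) (at x)" for v
  proof -
    have "((\<lambda>y. D (Suc 0) y [v]) has_derivative (\<lambda>w. D (Suc (Suc 0)) x [w, v])) (at x within S)"
      unfolding has_derivative_within_alt2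
    proof (intro conjI allI impI)
      show "bounded_linear (\<lambda>w. D (Suc (Suc 0)) x [w, v])"
        by (rule bounded_linear_intro[of _ "K * norm v"])
           (use linw[of v] K in \<open>auto simp: linear_iff mult.commute mult.left_commute\<close>)
      fix \<epsilon> :: real assume "\<epsilon> > 0"
      \<comment> \<open>The estimate is homogeneous in \<open>v\<close>; the summand \<open>1\<close> takes care of \<open>v = 0\<close>.\<close>
      then have "\<epsilon> / (norm v + 1) > 0" by (simp add: add_nonneg_pos)
      then obtain \<delta> where \<delta>: "\<delta> > 0" "\<And>z. z \<in> S \<Longrightarrow> norm (z - x) < \<delta> \<Longrightarrow>
          norm (D (Suc 0) z [v] - D (Suc 0) x [v] - D (Suc (Suc 0)) x [z - x, v])
            \<le> \<epsilon> / (norm v + 1) * norm (z - x) * norm v"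
      proof -
        obtain \<delta> where "\<delta> > 0" and \<delta>: "\<forall>y\<in>S. norm (y - x) < \<delta> \<longrightarrow> (\<forall>vs. length vs = Suc 0 \<longrightarrow>
            norm (D (Suc 0) y vs - D (Suc 0) x vs - D (Suc (Suc 0)) x ((y - x) # vs))
              \<le> \<epsilon> / (norm v + 1) * norm (y - x) * prod_list (map norm vs))"
          using der[OF x \<open>\<epsilon> / (norm v + 1) > 0\<close>] by blast
        have "norm (D (Suc 0) z [v] - D (Suc 0) x [v] - D (Suc (Suc 0)) x [z - x, v])
            \<le> \<epsilon> / (norm v + 1) * norm (z - x) * norm v" if "z \<in> S" "norm (z - x) < \<delta>" for z
          using \<delta>[rule_format, OF that, of "[v]"] by simp
        with \<open>\<delta> > 0\<close> show thesis by (rule that)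
      qed
      moreover have "\<epsilon> / (norm v + 1) * norm (z - x) * norm v \<le> \<epsilon> * norm (z - x)" for z
      proof -
        have "norm v / (norm v + 1) \<le> 1"
          by (simp add: divide_simps add_nonneg_pos)
        then have "\<epsilon> * norm (z - x) * (norm v / (norm v + 1)) \<le> \<epsilon> * norm (z - x) * 1"
          using \<open>\<epsilon> > 0\<close> by (intro mult_left_mono) auto
        then show ?thesis by (simp add: mult_ac)
      qed
      ultimately have "norm (D (Suc 0) z [v] - D (Suc 0) x [v] - D (Suc (Suc 0)) x [z - x, v])
            \<le> \<epsilon> * norm (z - x)" if "z \<in> S" "norm (z - x) < \<delta>" for z
        using that order_trans by blast
      then show "\<forall>\<^sub>F z in at x within S. norm (D (Suc 0) z [v] - D (Suc 0) x [v] -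
          D (Suc (Suc 0)) x [z - x, v]) \<le> \<epsilon> * norm (z - x)"
        unfolding eventually_at using \<delta>(1) by (auto simp: dist_norm)
    qed
    then show ?thesis using at_within_open[OF x S] by simp
  qed
  have near: "\<forall>\<^sub>F y in nhds x. y \<in> S" using S x by (simp add: eventually_nhds_in_open)
  \<comment> \<open>The first derivative is linear in \<open>v\<close> at every point, and derivatives are unique.\<close>
  have linv: "linear (\<lambda>v. D (Suc (Suc 0)) x [w, v])" for w
  proof (rule linearI)
    fix a b
    have "((\<lambda>y. D (Suc 0) y [a + b]) has_derivative
        (\<lambda>w. D (Suc (Suc 0)) x [w, a] + D (Suc (Suc 0)) x [w, b])) (at x)"
    proof (rule has_derivative_cong_nhds[OF has_derivative_add[OF der2[of a] der2[of b]]])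
      show "\<forall>\<^sub>F y in nhds x. D (Suc 0) y [a] + D (Suc 0) y [b] = D (Suc 0) y [a + b]"
        using near by eventually_elim (simp add: linear_add[OF lin[of _ "[]" 0, simplified]])
    qed
    then show "D (Suc (Suc 0)) x [w, a + b] = D (Suc (Suc 0)) x [w, a] + D (Suc (Suc 0)) x [w, b]"
      by (rule fun_cong[OF has_derivative_unique[OF der2[of "a + b"]]])
  next
    fix r :: real and a
    have "((\<lambda>y. D (Suc 0) y [r *\<^sub>R a]) has_derivative
        (\<lambda>w. r *\<^sub>R D (Suc (Suc 0)) x [w, a])) (at x)"
    proof (rule has_derivative_cong_nhds[OF has_derivative_scaleR_right[OF der2[of a]]])
      show "\<forall>\<^sub>F y in nhds x. r *\<^sub>R D (Suc 0) y [a] = D (Suc 0) y [r *\<^sub>R a]"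
        using near by eventually_elim (simp add: linear_scale[OF lin[of _ "[]" 0, simplified]])
    qed
    then show "D (Suc (Suc 0)) x [w, r *\<^sub>R a] = r *\<^sub>R D (Suc (Suc 0)) x [w, a]"
      by (rule fun_cong[OF has_derivative_unique[OF der2[of "r *\<^sub>R a"]]])
  qed
  have bb: "bounded_bilinear (\<lambda>w v. D (Suc (Suc 0)) x [w, v])"
    by (rule bounded_bilinear.intro)
       (use linw linv K in \<open>auto simp: linear_iff mult_ac intro!: exI[of _ K]\<close>)
  define f'' where "f'' w = Blinfun (\<lambda>v. D (Suc (Suc 0)) x [w, v])" for w
  have f''_apply: "f'' w v = D (Suc (Suc 0)) x [w, v]" for w v
    unfolding f''_def
    by (simp add: bounded_linear_Blinfun_apply bounded_bilinear.bounded_linear_right[OF bb])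
  have "(f' has_derivative f'') (at x within S)"
    unfolding has_derivative_within_alt2
  proof (intro conjI allI impI)
    show "bounded_linear f''"
    proof (rule bounded_linear_intro[of _ K])
      show "norm (f'' w) \<le> norm w * K" for w
      proof (rule norm_blinfun_bound)
        show "norm (f'' w v) \<le> norm w * K * norm v" for v
          using K[of w v] by (simp add: f''_apply mult_ac)
      qed (use \<open>K \<ge> 0\<close> in simp)
      show "f'' (a + b) = f'' a + f'' b" for a b
        by (rule blinfun_eqI) (simp add: f''_apply plus_blinfun.rep_eq linear_add[OF linw])
      show "f'' (r *\<^sub>R a) = r *\<^sub>R f'' a" for r a
        by (rule blinfun_eqI) (simp add: f''_apply scaleR_blinfun.rep_eq linear_scale[OF linw])
    qed
    fix \<epsilon> :: real assume "\<epsilon> > 0"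
    show "\<forall>\<^sub>F z in at x within S. norm (f' z - f' x - f'' (z - x)) \<le> \<epsilon> * norm (z - x)"
    proof -
      obtain \<delta> where "\<delta> > 0" and \<delta>: "\<forall>y\<in>S. norm (y - x) < \<delta> \<longrightarrow> (\<forall>vs. length vs = Suc 0 \<longrightarrow>
          norm (D (Suc 0) y vs - D (Suc 0) x vs - D (Suc (Suc 0)) x ((y - x) # vs))
            \<le> \<epsilon> * norm (y - x) * prod_list (map norm vs))"
        using der[OF x \<open>\<epsilon> > 0\<close>] by blast
      have "norm (f' z - f' x - f'' (z - x)) \<le> \<epsilon> * norm (z - x)"
        if "z \<in> S" "norm (z - x) < \<delta>" for z
      proof (rule norm_blinfun_bound)
        show "norm ((f' z - f' x - f'' (z - x)) v) \<le> \<epsilon> * norm (z - x) * norm v" for v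
          using \<delta>[rule_format, OF that, of "[v]"] that x
          by (simp add: minus_blinfun.rep_eq f'_apply f''_apply)
      qed (use \<open>\<epsilon> > 0\<close> in simp)
      with \<open>\<delta> > 0\<close> show ?thesis
        unfolding eventually_at by (auto simp: dist_norm)
    qed
  qed
  then have "f' differentiable (at x)"
    using at_within_open[OF x S] by (auto simp: differentiable_def)
  moreover have "\<forall>\<^sub>F y in nhds x. (f has_derivative blinfun_apply (f' y)) (at y)"
    using near by eventually_elim (rule has_der)
  ultimately show ?thesis
    unfolding twice_diff_at_def by (intro exI[of _ f'] conjI)
qed

lemma twice_diff_at_differentiable: "twice_diff_at f x \<Longrightarrow> f differentiable (at x)"
  by (rule differentiableI[OF twice_diff_at_has_derivative])

lemma has_derivative_restrict_fst:
  assumes "(f has_derivative f') (at (a, b))"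
  shows "((\<lambda>x. f (x, b)) has_derivative (\<lambda>v. f' (v, 0))) (at a)"
proof -
  have "((\<lambda>x. (x, b)) has_derivative (\<lambda>v. (v, 0))) (at a)"
    by (intro has_derivative_Pair has_derivative_const has_derivative_ident)
  from diff_chain_at[OF this assms] show ?thesis by (simp add: o_def)
qed

lemma has_derivative_restrict_snd:
  assumes "(f has_derivative f') (at (a, b))"
  shows "((\<lambda>y. f (a, y)) has_derivative (\<lambda>v. f' (0, v))) (at b)"
proof -
  have "((\<lambda>y. (a, y)) has_derivative (\<lambda>v. (0, v))) (at b)"
    by (intro has_derivative_Pair has_derivative_const has_derivative_ident)
  from diff_chain_at[OF this assms] show ?thesis by (simp add: o_def)
qed

text \<open>
  Differentiating in the second variable costs one of the two available derivatives: the partial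
  derivative is still differentiable at the base point, jointly in both variables. Restricted to the
  first variable this is what makes \<open>Ad\<close> differentiable; restricted to the second it is what makes
  the Hessian on \<open>V\<close> an honest derivative.
\<close>

lemma twice_diff_at_partial_snd:
  fixes F :: "'a::real_normed_vector \<times> 'b::real_normed_vector \<Rightarrow> 'c::real_normed_vector"
  assumes "twice_diff_at F (a, b)"
  obtains D :: "'a \<times> 'b \<Rightarrow> 'b \<Rightarrow>\<^sub>L 'c"
  where "\<forall>\<^sub>F z in nhds (a, b). ((\<lambda>y. F (fst z, y)) has_derivative blinfun_apply (D z)) (at (snd z))"
    and "D differentiable (at (a, b))"
proof -
  obtain F' where F': "\<forall>\<^sub>F z in nhds (a, b). (F has_derivative blinfun_apply (F' z)) (at z)"
    "F' differentiable (at (a, b))"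
    using assms unfolding twice_diff_at_def by blast
  define inr :: "'b \<Rightarrow>\<^sub>L ('a \<times> 'b)" where "inr = Blinfun (\<lambda>v. (0, v))"
  have inr: "inr v = (0, v)" for v
    unfolding inr_def by (rule bounded_linear_Blinfun_apply[THEN fun_cong])
       (intro bounded_linear_Pair bounded_linear_zero bounded_linear_ident)
  have inr_fun: "blinfun_apply (F' z o\<^sub>L inr) = (\<lambda>v. F' z (0, v))" for z
    by (simp add: fun_eq_iff inr)
  show thesis
  proof (rule that)
    show "\<forall>\<^sub>F z in nhds (a, b).
        ((\<lambda>y. F (fst z, y)) has_derivative blinfun_apply (F' z o\<^sub>L inr)) (at (snd z))"
      using F'(1)
    proof eventually_elim
      case (elim z)
      show ?case
        unfolding inr_fun by (rule has_derivative_restrict_snd) (simp add: elim)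
    qed
    obtain F'' where "(F' has_derivative F'') (at (a, b))"
      using F'(2) by (auto simp: differentiable_def)
    from bounded_linear.has_derivative[OF
        bounded_bilinear.bounded_linear_left[OF bounded_bilinear_blinfun_compose] this]
    show "(\<lambda>z. F' z o\<^sub>L inr) differentiable (at (a, b))" by (rule differentiableI)
  qed
qed

lemma partial_fst_has_derivative:
  assumes "F differentiable (at (a, b))"
  shows "((\<lambda>x. F (x, b)) has_derivative blinfun_apply (partial_fst F (a, b))) (at a)"
proof -
  obtain F' where "(F has_derivative F') (at (a, b))"
    using assms by (auto simp: differentiable_def)
  note * = has_derivative_restrict_fst[OF this]
  show ?thesis
    using * has_derivative_bounded_linear[OF *]
    by (simp add: partial_fst_def frechet_derivative_at[OF *, symmetric] bounded_linear_Blinfun_apply)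
qed

lemma partial_snd_has_derivative:
  assumes "F differentiable (at (a, b))"
  shows "((\<lambda>y. F (a, y)) has_derivative blinfun_apply (partial_snd F (a, b))) (at b)"
proof -
  obtain F' where "(F has_derivative F') (at (a, b))"
    using assms by (auto simp: differentiable_def)
  note * = has_derivative_restrict_snd[OF this]
  show ?thesis
    using * has_derivative_bounded_linear[OF *]
    by (simp add: partial_snd_def frechet_derivative_at[OF *, symmetric] bounded_linear_Blinfun_apply)
qed

lemma partial_snd_differentiable:
  assumes "twice_diff_at F (a, b)"
  shows "(\<lambda>y. partial_snd F (a, y)) differentiable (at b)"
proof -
  obtain D where D: "\<forall>\<^sub>F z in nhds (a, b).
      ((\<lambda>y. F (fst z, y)) has_derivative blinfun_apply (D z)) (at (snd z))"
    "D differentiable (at (a, b))"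
    by (rule twice_diff_at_partial_snd[OF assms])
  have "filterlim (\<lambda>y. (a, y)) (nhds (a, b)) (nhds b)"
    by (intro tendsto_Pair tendsto_const filterlim_ident)
  from eventually_compose_filterlim[OF D(1) this] have "\<forall>\<^sub>F y in nhds b.
      ((\<lambda>y. F (a, y)) has_derivative blinfun_apply (D (a, y))) (at y)"
    by simp
  then have ev: "\<forall>\<^sub>F y in nhds b. D (a, y) = partial_snd F (a, y)"
  proof eventually_elim
    case (elim y)
    show ?case
      by (simp add: partial_snd_def blinfun_apply_inverse flip: frechet_derivative_at[OF elim])
  qed
  obtain D' where "(D has_derivative D') (at (a, b))"
    using D(2) by (auto simp: differentiable_def)
  from has_derivative_cong_nhds[OF has_derivative_restrict_snd[OF this] ev]
  show ?thesis by (rule differentiableI)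
qed


section \<open>Tangent maps in the preferred charts\<close>

text \<open>
  Continuity at a point is expressed with \<^const>\<open>nhds\<close> on both sides, so that limits can be composed
  without excluding the base point.
\<close>

lemma continuous_on_open_tendsto_nhds:
  assumes "continuous_on S f" and "open S" and "x \<in> S"
  shows "(f \<longlongrightarrow> f x) (nhds x)"
proof -
  have "(f \<longlongrightarrow> f x) (at x within S)"
    using assms by (simp add: continuous_on_def)
  then show ?thesis
    unfolding at_within_open[OF assms(3,2)] by (rule tendsto_at_iff_tendsto_nhds[THEN iffD1])
qed

text \<open>
  Only one chart per point enters \<^const>\<open>mderiv\<close>, so the chain rule is a statement about atlases
  of this kind, in which nothing is asked of the transition maps.
\<close>

definition charts_cover :: "('x::real_normed_vector, 'm::topological_space) atlas \<Rightarrow> bool" where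
  "charts_cover A \<longleftrightarrow> (\<forall>c\<in>A. is_chart c) \<and> (\<Union>(U, \<phi>)\<in>A. \<phi> ` U) = UNIV"

lemma smooth_atlas_charts_cover: "smooth_atlas A \<Longrightarrow> charts_cover A"
  by (simp add: smooth_atlas_def charts_cover_def)

lemma charts_cover_vec_atlas: "charts_cover vec_atlas"
  by (simp add: charts_cover_def vec_atlas_def is_chart_def homeomorphism_ident)

lemma chart_at_vec_atlas: "chart_at vec_atlas x = (UNIV, \<lambda>x. x)"
  unfolding chart_at_def vec_atlas_def by (rule some_equality) auto

lemma param_at_vec_atlas [simp]: "param_at vec_atlas x = (\<lambda>x. x)"
  and coord_at_vec_atlas [simp]: "coord_at vec_atlas x = (\<lambda>x. x)"
  by (simp_all add: param_at_def coord_at_def chart_at_vec_atlas)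

definition dom_at :: "('x, 'm) atlas \<Rightarrow> 'm \<Rightarrow> 'x set" where
  "dom_at A m = fst (chart_at A m)"

context
  fixes A :: "('x::real_normed_vector, 'm::topological_space) atlas"
  assumes A: "charts_cover A"
begin

lemma chart_at_mem: "(dom_at A m, param_at A m) \<in> A"
  and chart_at_covers: "m \<in> param_at A m ` dom_at A m"
proof -
  have "m \<in> (\<Union>(U, \<phi>)\<in>A. \<phi> ` U)"
    using A by (simp add: charts_cover_def)
  then have "\<exists>c. c \<in> A \<and> m \<in> snd c ` fst c"
    by fastforce
  then have "chart_at A m \<in> A \<and> m \<in> snd (chart_at A m) ` fst (chart_at A m)"
    unfolding chart_at_def by (rule someI_ex)
  then show "(dom_at A m, param_at A m) \<in> A" "m \<in> param_at A m ` dom_at A m"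
    by (simp_all add: dom_at_def param_at_def)
qed

lemma is_chart_chart_at: "is_chart (dom_at A m, param_at A m)"
  using A chart_at_mem[of m] unfolding charts_cover_def by (elim conjE) (rule bspec)

lemma coord_at_eq: "coord_at A m = inv_into (dom_at A m) (param_at A m)"
  by (simp add: coord_at_def dom_at_def param_at_def)

lemma chart_at_homeomorphism:
  "homeomorphism (dom_at A m) (param_at A m ` dom_at A m) (param_at A m) (coord_at A m)"
  using is_chart_chart_at by (simp add: is_chart_def coord_at_eq)

lemma open_dom_at: "open (dom_at A m)"
  and open_image_dom_at: "open (param_at A m ` dom_at A m)"
  using is_chart_chart_at by (auto simp: is_chart_def)

lemma coord_at_param_at: "x \<in> dom_at A m \<Longrightarrow> coord_at A m (param_at A m x) = x"
  and param_at_coord_at: "n \<in> param_at A m ` dom_at A m \<Longrightarrow> param_at A m (coord_at A m n) = n"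
  and coord_at_mem: "n \<in> param_at A m ` dom_at A m \<Longrightarrow> coord_at A m n \<in> dom_at A m"
  using chart_at_homeomorphism[of m] by (auto simp: homeomorphism_def)

lemma param_at_center [simp]: "param_at A m (coord_at A m m) = m"
  and coord_at_center_mem: "coord_at A m m \<in> dom_at A m"
  by (rule param_at_coord_at[OF chart_at_covers] coord_at_mem[OF chart_at_covers])+

lemma tendsto_param_at: "filterlim (param_at A m) (nhds m) (nhds (coord_at A m m))"
  using continuous_on_open_tendsto_nhds[of "dom_at A m" "param_at A m" "coord_at A m m"]
    chart_at_homeomorphism[of m] open_dom_at coord_at_center_mem
  by (simp add: homeomorphism_def)

lemma tendsto_coord_at: "filterlim (coord_at A m) (nhds (coord_at A m m)) (nhds m)"
  using continuous_on_open_tendsto_nhds[of "param_at A m ` dom_at A m" "coord_at A m" m]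
    chart_at_homeomorphism[of m] open_image_dom_at chart_at_covers
  by (simp add: homeomorphism_def)

lemma eventually_in_chart: "\<forall>\<^sub>F n in nhds m. n \<in> param_at A m ` dom_at A m"
  using open_image_dom_at chart_at_covers by (rule eventually_nhds_in_open)

end

definition local_rep ::
  "('x, 'm) atlas \<Rightarrow> ('y, 'n) atlas \<Rightarrow> ('m \<Rightarrow> 'n) \<Rightarrow> 'm \<Rightarrow> 'x \<Rightarrow> 'y" where
  "local_rep A B f m x = coord_at B (f m) (f (param_at A m x))"

lemma mderiv_local_rep:
  "mderiv A B f m = frechet_derivative (local_rep A B f m) (at (coord_at A m m))"
  by (simp add: mderiv_def local_rep_def[abs_def] o_def)

text \<open>
  Continuity of \<open>f\<close> itself is a separate requirement: the local representative says nothing about points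
  that \<open>f\<close> maps outside the chosen chart of the target.
\<close>

definition mdiff_at ::
  "('x::real_normed_vector, 'm::topological_space) atlas \<Rightarrow>
   ('y::real_normed_vector, 'n::topological_space) atlas \<Rightarrow> ('m \<Rightarrow> 'n) \<Rightarrow> 'm \<Rightarrow> bool" where
  "mdiff_at A B f m \<longleftrightarrow> filterlim f (nhds (f m)) (nhds m) \<and>
     local_rep A B f m differentiable (at (coord_at A m m))"

definition mtwice_diff_at ::
  "('x::real_normed_vector, 'm::topological_space) atlas \<Rightarrow>
   ('y::real_normed_vector, 'n::topological_space) atlas \<Rightarrow> ('m \<Rightarrow> 'n) \<Rightarrow> 'm \<Rightarrow> bool" where
  "mtwice_diff_at A B f m \<longleftrightarrow> filterlim f (nhds (f m)) (nhds m) \<and>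
     twice_diff_at (local_rep A B f m) (coord_at A m m)"

lemma mtwice_diff_at_mdiff_at: "mtwice_diff_at A B f m \<Longrightarrow> mdiff_at A B f m"
  unfolding mtwice_diff_at_def mdiff_at_def differentiable_def
  by (blast dest: twice_diff_at_has_derivative)

lemma mdiff_at_has_derivative:
  "mdiff_at A B f m \<Longrightarrow>
    (local_rep A B f m has_derivative mderiv A B f m) (at (coord_at A m m))"
  by (simp add: mdiff_at_def mderiv_local_rep frechet_derivative_works)

lemma mdiff_at_bounded_linear: "mdiff_at A B f m \<Longrightarrow> bounded_linear (mderiv A B f m)"
  by (rule has_derivative_bounded_linear[OF mdiff_at_has_derivative])

lemma mderiv_eqI:
  "(local_rep A B f m has_derivative f') (at (coord_at A m m)) \<Longrightarrow> mderiv A B f m = f'"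
  by (simp add: mderiv_local_rep frechet_derivative_at[symmetric])

lemma mtwice_diff_at_vec:
  "mtwice_diff_at vec_atlas vec_atlas f x \<longleftrightarrow> twice_diff_at f x"
  by (auto simp: mtwice_diff_at_def local_rep_def[abs_def] dest: twice_diff_at_tendsto)

lemma mderiv_vec: "mderiv vec_atlas vec_atlas f x = frechet_derivative f (at x)"
  by (simp add: mderiv_local_rep local_rep_def[abs_def])

lemma mderiv_const: "mderiv A B (\<lambda>_. c) m = (\<lambda>_. 0)"
  by (rule mderiv_eqI) (simp add: local_rep_def[abs_def])

lemma mderiv_ident:
  assumes A: "charts_cover A"
  shows "mderiv A A (\<lambda>x. x) m = (\<lambda>x. x)"
proof (rule mderiv_eqI)
  have "\<forall>\<^sub>F x in nhds (coord_at A m m). x \<in> dom_at A m"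
    using open_dom_at[OF A] coord_at_center_mem[OF A] by (rule eventually_nhds_in_open)
  then have "\<forall>\<^sub>F x in nhds (coord_at A m m). x = local_rep A A (\<lambda>x. x) m x"
    by eventually_elim (simp add: local_rep_def coord_at_param_at[OF A])
  with has_derivative_ident
  show "(local_rep A A (\<lambda>x. x) m has_derivative (\<lambda>x. x)) (at (coord_at A m m))"
    by (rule has_derivative_cong_nhds)
qed

text \<open>
  Both representatives involve the chart chosen at \<open>f m\<close>, so they compose exactly, but only where
  \<open>f\<close> stays in the image of that chart.
\<close>

lemma local_rep_compose:
  assumes A: "charts_cover A" and B: "charts_cover B"
    and lim: "filterlim f (nhds (f m)) (nhds m)"
  shows "\<forall>\<^sub>F x in nhds (coord_at A m m).
      local_rep B C g (f m) (local_rep A B f m x) = local_rep A C (\<lambda>x. g (f x)) m x"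
proof -
  have "\<forall>\<^sub>F x in nhds (coord_at A m m). f (param_at A m x) \<in> param_at B (f m) ` dom_at B (f m)"
    using eventually_in_chart[OF B] filterlim_compose[OF lim tendsto_param_at[OF A]]
    by (rule eventually_compose_filterlim)
  then show ?thesis
    by eventually_elim (simp add: local_rep_def param_at_coord_at[OF B])
qed

lemma local_rep_center:
  "charts_cover A \<Longrightarrow> local_rep A B f m (coord_at A m m) = coord_at B (f m) (f m)"
  by (simp add: local_rep_def param_at_center)

lemma mtwice_diff_at_compose:
  assumes A: "charts_cover A" and B: "charts_cover B"
    and f: "mtwice_diff_at A B f m" and g: "mtwice_diff_at B C g (f m)"
  shows "mtwice_diff_at A C (\<lambda>x. g (f x)) m"
proof -
  have lim: "filterlim f (nhds (f m)) (nhds m)" "filterlim g (nhds (g (f m))) (nhds (f m))"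
    using f g by (auto simp: mtwice_diff_at_def)
  have "twice_diff_at (\<lambda>x. local_rep B C g (f m) (local_rep A B f m x)) (coord_at A m m)"
    by (rule twice_diff_at_compose[where f = "local_rep A B f m" and g = "local_rep B C g (f m)"])
       (use f g in \<open>simp_all add: mtwice_diff_at_def local_rep_center[OF A]\<close>)
  then have "twice_diff_at (local_rep A C (\<lambda>x. g (f x)) m) (coord_at A m m)"
    using local_rep_compose[OF A B lim(1)] by (rule twice_diff_at_cong)
  then show ?thesis
    unfolding mtwice_diff_at_def using filterlim_compose[OF lim(2,1)] by (intro conjI)
qed

lemma
  assumes A: "charts_cover A" and B: "charts_cover B"
    and f: "mdiff_at A B f m" and g: "mdiff_at B C g (f m)"
  shows mdiff_at_compose: "mdiff_at A C (\<lambda>x. g (f x)) m"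
    and mderiv_compose: "mderiv A C (\<lambda>x. g (f x)) m = (\<lambda>u. mderiv B C g (f m) (mderiv A B f m u))"
proof -
  have lim: "filterlim f (nhds (f m)) (nhds m)" "filterlim g (nhds (g (f m))) (nhds (f m))"
    using f g by (auto simp: mdiff_at_def)
  have "((\<lambda>x. local_rep B C g (f m) (local_rep A B f m x)) has_derivative
      (\<lambda>u. mderiv B C g (f m) (mderiv A B f m u))) (at (coord_at A m m))"
    using diff_chain_at[OF mdiff_at_has_derivative[OF f],
        of "local_rep B C g (f m)" "mderiv B C g (f m)"]
      mdiff_at_has_derivative[OF g] by (simp add: local_rep_center[OF A] o_def)
  then have *: "(local_rep A C (\<lambda>x. g (f x)) m has_derivative
      (\<lambda>u. mderiv B C g (f m) (mderiv A B f m u))) (at (coord_at A m m))"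
    using local_rep_compose[OF A B lim(1)] by (rule has_derivative_cong_nhds)
  then show "mdiff_at A C (\<lambda>x. g (f x)) m"
    unfolding mdiff_at_def using filterlim_compose[OF lim(2,1)] differentiableI by (intro conjI)
  from * show "mderiv A C (\<lambda>x. g (f x)) m = (\<lambda>u. mderiv B C g (f m) (mderiv A B f m u))"
    by (rule mderiv_eqI)
qed

lemma mdiff_at_bounded_linear_compose:
  assumes f: "mdiff_at A vec_atlas f m" and L: "bounded_linear L"
  shows "mderiv A vec_atlas (\<lambda>x. L (f x)) m = (\<lambda>u. L (mderiv A vec_atlas f m u))"
  using bounded_linear.has_derivative[OF L mdiff_at_has_derivative[OF f]]
  by (intro mderiv_eqI) (simp add: local_rep_def[abs_def])

lemma msmooth_on_chart:
  assumes f: "msmooth_on A B S f" and c: "(U, \<phi>) \<in> A" "(W, \<psi>) \<in> B"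
  shows "smooth_on {x \<in> U. \<phi> x \<in> S \<and> f (\<phi> x) \<in> \<psi> ` W} (inv_into W \<psi> \<circ> f \<circ> \<phi>)"
proof -
  have "\<forall>(U, \<phi>)\<in>A. \<forall>(W, \<psi>)\<in>B.
      smooth_on {x \<in> U. \<phi> x \<in> S \<and> f (\<phi> x) \<in> \<psi> ` W} (inv_into W \<psi> \<circ> f \<circ> \<phi>)"
    using f unfolding msmooth_on_def by (elim conjE)
  from bspec[OF bspec[OF this c(1), unfolded prod.case] c(2)] show ?thesis
    by (simp only: prod.case)
qed

lemma msmooth_on_tendsto:
  assumes f: "msmooth_on A B S f" and m: "m \<in> S"
  shows "(f \<longlongrightarrow> f m) (nhds m)"
  using f m continuous_on_open_tendsto_nhds unfolding msmooth_on_def by (elim conjE)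

lemma msmooth_on_mtwice_diff_at:
  assumes A: "charts_cover A" and B: "charts_cover B"
    and f: "msmooth_on A B S f" and m: "m \<in> S"
  shows "mtwice_diff_at A B f m"
proof -
  have "smooth_on {x \<in> dom_at A m. param_at A m x \<in> S \<and>
      f (param_at A m x) \<in> param_at B (f m) ` dom_at B (f m)}
      (inv_into (dom_at B (f m)) (param_at B (f m)) \<circ> f \<circ> param_at A m)"
    by (rule msmooth_on_chart[OF f chart_at_mem[OF A] chart_at_mem[OF B]])
  then have "twice_diff_at (inv_into (dom_at B (f m)) (param_at B (f m)) \<circ> f \<circ> param_at A m)
      (coord_at A m m)"
    by (rule smooth_on_twice_diff_at)
       (use m in \<open>simp add: coord_at_center_mem[OF A] param_at_center[OF A] chart_at_covers[OF B]\<close>)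
  then have "twice_diff_at (local_rep A B f m) (coord_at A m m)"
    by (simp add: local_rep_def[abs_def] coord_at_eq[OF B] o_def)
  then show ?thesis
    using msmooth_on_tendsto[OF f m] by (simp add: mtwice_diff_at_def)
qed

text \<open>
  The chart of the product chosen by \<^const>\<open>chart_at\<close> need not be the product of the chosen
  charts. The map is therefore expressed directly in the latter.
\<close>

lemma msmooth_on_prod_twice_diff_at:
  assumes A: "charts_cover A" and B: "charts_cover B" and C: "charts_cover C"
    and f: "msmooth_on (prod_atlas A B) C UNIV f"
  shows "twice_diff_at
    (\<lambda>(x, y). coord_at C (f (m, n)) (f (param_at A m x, param_at B n y)))
    (coord_at A m m, coord_at B n n)"
proof -
  let ?\<phi> = "map_prod (param_at A m) (param_at B n)"
  have "(dom_at A m \<times> dom_at B n, ?\<phi>) \<in> prod_atlas A B"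
    using chart_at_mem[OF A, of m] chart_at_mem[OF B, of n] by (auto simp: prod_atlas_def)
  then have "smooth_on {x \<in> dom_at A m \<times> dom_at B n. ?\<phi> x \<in> UNIV \<and>
      f (?\<phi> x) \<in> param_at C (f (m, n)) ` dom_at C (f (m, n))}
      (inv_into (dom_at C (f (m, n))) (param_at C (f (m, n))) \<circ> f \<circ> ?\<phi>)"
    by (rule msmooth_on_chart[OF f _ chart_at_mem[OF C]])
  then have "twice_diff_at (inv_into (dom_at C (f (m, n))) (param_at C (f (m, n))) \<circ> f \<circ> ?\<phi>)
      (coord_at A m m, coord_at B n n)"
    by (rule smooth_on_twice_diff_at)
       (simp add: coord_at_center_mem[OF A] coord_at_center_mem[OF B] param_at_center[OF A]
          param_at_center[OF B] chart_at_covers[OF C])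
  then show ?thesis
    by (simp add: coord_at_eq[OF C] o_def split_beta' map_prod_def)
qed

lemma
  assumes A: "charts_cover A" and B: "charts_cover B" and C: "charts_cover C"
    and f: "msmooth_on (prod_atlas A B) C UNIV (\<lambda>(a, b). f a b)"
  shows msmooth_on_prod_left: "mtwice_diff_at A C (\<lambda>a. f a n) m"
    and msmooth_on_prod_right: "mtwice_diff_at B C (\<lambda>b. f m b) n"
proof -
  have lim: "((\<lambda>(a, b). f a b) \<longlongrightarrow> f m n) (nhds (m, n))"
    using msmooth_on_tendsto[OF f, of "(m, n)"] by simp
  have "filterlim (\<lambda>a. (a, n)) (nhds (m, n)) (nhds m)" "filterlim (\<lambda>b. (m, b)) (nhds (m, n)) (nhds n)"
    by (intro tendsto_Pair tendsto_const filterlim_ident)+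
  from this[THEN filterlim_compose[OF lim]]
  have "((\<lambda>a. f a n) \<longlongrightarrow> f m n) (nhds m)" "((\<lambda>b. f m b) \<longlongrightarrow> f m n) (nhds n)"
    by simp_all
  moreover note F = msmooth_on_prod_twice_diff_at[OF A B C f, of m n]
  have "twice_diff_at (\<lambda>x. (\<lambda>(x, y). coord_at C (f m n) (f (param_at A m x) (param_at B n y)))
      (x, coord_at B n n)) (coord_at A m m)"
    by (rule twice_diff_at_compose[where f = "\<lambda>x. (x, coord_at B n n)"])
       (intro twice_diff_at_Pair twice_diff_at_const twice_diff_at_bounded_linear
          bounded_linear_ident, use F in simp)
  then have "twice_diff_at (local_rep A C (\<lambda>a. f a n) m) (coord_at A m m)"
    by (simp add: local_rep_def[abs_def] param_at_center[OF B])
  moreover have "twice_diff_at (\<lambda>y. (\<lambda>(x, y). coord_at C (f m n) (f (param_at A m x) (param_at B n y)))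
      (coord_at A m m, y)) (coord_at B n n)"
    by (rule twice_diff_at_compose[where f = "\<lambda>y. (coord_at A m m, y)"])
       (intro twice_diff_at_Pair twice_diff_at_const twice_diff_at_bounded_linear
          bounded_linear_ident, use F in simp)
  then have "twice_diff_at (local_rep B C (\<lambda>b. f m b) n) (coord_at B n n)"
    by (simp add: local_rep_def[abs_def] param_at_center[OF A])
  ultimately show "mtwice_diff_at A C (\<lambda>a. f a n) m" "mtwice_diff_at B C (\<lambda>b. f m b) n"
    by (simp_all add: mtwice_diff_at_def)
qed

section \<open>The adjoint representation\<close>

lemma blinfun_compose_id_right: "T o\<^sub>L id_blinfun = T"
  by (rule blinfun_eqI) simp

locale lie_grp =
  fixes G :: "'g::t2_space monoid" (structure) and AG :: "('e::banach, 'g) atlas"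
  assumes lie: "lie_group G AG"
begin

sublocale group G
  using lie by (simp add: lie_group_def)

lemma in_carrier [simp, intro]: "g \<in> carrier G"
  using lie by (simp add: lie_group_def)

lemma charts: "charts_cover AG"
  using lie by (simp add: lie_group_def smooth_atlas_charts_cover)

lemma mult_smooth: "msmooth_on (prod_atlas AG AG) AG UNIV (\<lambda>(a, b). a \<otimes> b)"
  and inv_smooth: "msmooth_on AG AG UNIV (\<lambda>a. inv a)"
  using lie by (simp_all add: lie_group_def)

lemma tendsto_mult_pair: "((\<lambda>(a, b). a \<otimes> b) \<longlongrightarrow> a \<otimes> b) (nhds (a, b))"
  using msmooth_on_tendsto[OF mult_smooth, of "(a, b)"] by simp

lemma tendsto_mult_group:
  assumes "(f \<longlongrightarrow> a) F" and "(g \<longlongrightarrow> b) F" shows "((\<lambda>x. f x \<otimes> g x) \<longlongrightarrow> a \<otimes> b) F"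
  using filterlim_compose[OF tendsto_mult_pair tendsto_Pair[OF assms]] by simp

lemma tendsto_inv_group:
  assumes "(f \<longlongrightarrow> a) F" shows "((\<lambda>x. inv (f x)) \<longlongrightarrow> inv a) F"
  by (rule filterlim_compose[OF _ assms]) (rule msmooth_on_tendsto[OF inv_smooth UNIV_I])

abbreviation conj_by :: "'g \<Rightarrow> 'g \<Rightarrow> 'g" where
  "conj_by g a \<equiv> g \<otimes> a \<otimes> inv g"

lemma mdiff_at_conj_by: "mdiff_at AG AG (conj_by g) a"
proof -
  have "mtwice_diff_at AG AG (\<lambda>a. g \<otimes> a) a" "mtwice_diff_at AG AG (\<lambda>a. a \<otimes> inv g) (g \<otimes> a)"
    using msmooth_on_prod_right[OF charts charts charts mult_smooth]
      msmooth_on_prod_left[OF charts charts charts mult_smooth] by blast+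
  from mtwice_diff_at_compose[OF charts charts this] show ?thesis
    by (rule mtwice_diff_at_mdiff_at)
qed

lemma Ad_apply: "Ad G AG g v = mderiv AG AG (conj_by g) \<one> v"
  using mdiff_at_bounded_linear[OF mdiff_at_conj_by]
  by (simp add: Ad_def bounded_linear_Blinfun_apply)

lemma Ad_one [simp]: "Ad G AG \<one> = id_blinfun"
  by (rule blinfun_eqI) (simp add: Ad_apply mderiv_ident[OF charts])

lemma Ad_mult: "Ad G AG (g \<otimes> h) = Ad G AG g o\<^sub>L Ad G AG h"
proof (rule blinfun_eqI)
  fix v
  have "mderiv AG AG (\<lambda>a. conj_by g (conj_by h a)) \<one> =
      (\<lambda>u. mderiv AG AG (conj_by g) (conj_by h \<one>) (mderiv AG AG (conj_by h) \<one> u))"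
    by (rule mderiv_compose[OF charts charts mdiff_at_conj_by mdiff_at_conj_by])
  moreover have "(\<lambda>a. conj_by g (conj_by h a)) = conj_by (g \<otimes> h)"
    by (simp add: fun_eq_iff m_assoc inv_mult_group)
  ultimately show "Ad G AG (g \<otimes> h) v = (Ad G AG g o\<^sub>L Ad G AG h) v"
    by (simp add: Ad_apply blinfun_compose.rep_eq)
qed

lemma Ad_inv_cancel [simp]:
  "Ad G AG (inv g) (Ad G AG g v) = v" "Ad G AG g (Ad G AG (inv g) v) = v"
  using Ad_mult[of "inv g" g] Ad_mult[of g "inv g"]
  by (metis Ad_one blinfun_apply_blinfun_compose blinfun_apply_id_blinfun id_apply in_carrier l_inv,
      metis Ad_one blinfun_apply_blinfun_compose blinfun_apply_id_blinfun id_apply in_carrier r_inv)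

text \<open>
  With \<open>m\<close> and \<open>i\<close> the coordinate expressions of multiplication and inversion, \<open>g a g\<^sup>-\<^sup>1 = g (a g\<^sup>-\<^sup>1)\<close>
  reads \<open>m(x, m(y, i x))\<close>. This holds only as long as the intermediate products stay in the
  chart, hence near the identity.
\<close>

lemma conj_by_chart_twice_diff_at:
  "twice_diff_at (\<lambda>(x, y). coord_at AG \<one> (conj_by (param_at AG \<one> x) (param_at AG \<one> y)))
     (coord_at AG \<one> \<one>, coord_at AG \<one> \<one>)"
proof -
  let ?\<phi> = "param_at AG \<one>" and ?\<kappa> = "coord_at AG \<one>"
  let ?e = "?\<kappa> \<one>"
  let ?i = "\<lambda>x. ?\<kappa> (inv (?\<phi> x))" and ?m = "\<lambda>(x, y). ?\<kappa> (?\<phi> x \<otimes> ?\<phi> y)"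
  have m: "twice_diff_at ?m (?e, ?e)"
    using msmooth_on_prod_twice_diff_at[OF charts charts charts mult_smooth, of \<one> \<one>]
    by simp
  have i: "twice_diff_at ?i ?e"
    using msmooth_on_mtwice_diff_at[OF charts charts inv_smooth UNIV_I, of \<one>]
    by (simp add: mtwice_diff_at_def local_rep_def[abs_def])
  have ie: "?i ?e = ?e" and me: "?m (?e, ?e) = ?e"
    by (simp_all add: param_at_center[OF charts])
  have "twice_diff_at (\<lambda>z. ?i (fst z)) (?e, ?e)"
    by (rule twice_diff_at_compose[where f = fst and g = ?i]) (simp_all add: twice_diff_at_fst i)
  with twice_diff_at_snd have "twice_diff_at (\<lambda>z. (snd z, ?i (fst z))) (?e, ?e)"
    by (rule twice_diff_at_Pair)
  then have "twice_diff_at (\<lambda>z. ?m (snd z, ?i (fst z))) (?e, ?e)"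
    by (rule twice_diff_at_compose[where f = "\<lambda>z. (snd z, ?i (fst z))" and g = ?m])
       (use m ie in simp)
  with twice_diff_at_fst have "twice_diff_at (\<lambda>z. (fst z, ?m (snd z, ?i (fst z)))) (?e, ?e)"
    by (rule twice_diff_at_Pair)
  then have *: "twice_diff_at (\<lambda>z. ?m (fst z, ?m (snd z, ?i (fst z)))) (?e, ?e)"
    by (rule twice_diff_at_compose[where f = "\<lambda>z. (fst z, ?m (snd z, ?i (fst z)))" and g = ?m])
       (use m ie me in simp)
  have lims: "((\<lambda>z. ?\<phi> (fst z)) \<longlongrightarrow> \<one>) (nhds (?e, ?e))" "((\<lambda>z. ?\<phi> (snd z)) \<longlongrightarrow> \<one>) (nhds (?e, ?e))"
    by (rule filterlim_compose[OF tendsto_param_at[OF charts]],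
        use twice_diff_at_tendsto[OF twice_diff_at_fst, of "(?e, ?e)"]
          twice_diff_at_tendsto[OF twice_diff_at_snd, of "(?e, ?e)"] in simp)+
  have inv_lim: "((\<lambda>z. inv (?\<phi> (fst z))) \<longlongrightarrow> \<one>) (nhds (?e, ?e))"
    using tendsto_inv_group[OF lims(1)] by simp
  have mult_lim: "((\<lambda>z. ?\<phi> (snd z) \<otimes> inv (?\<phi> (fst z))) \<longlongrightarrow> \<one>) (nhds (?e, ?e))"
    using tendsto_mult_group[OF lims(2) inv_lim] by simp
  have "\<forall>\<^sub>F z in nhds (?e, ?e). ?m (fst z, ?m (snd z, ?i (fst z))) =
      (\<lambda>(x, y). ?\<kappa> (conj_by (?\<phi> x) (?\<phi> y))) z"
    using eventually_compose_filterlim[OF eventually_in_chart[OF charts, of \<one>] inv_lim]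
      eventually_compose_filterlim[OF eventually_in_chart[OF charts, of \<one>] mult_lim]
    by eventually_elim (simp add: split_beta' param_at_coord_at[OF charts] m_assoc)
  with * show ?thesis by (rule twice_diff_at_cong)
qed

text \<open>
  \<open>Ad (\<phi> x)\<close> is the partial derivative of the conjugation in its second variable.
\<close>

lemma Ad_chart_differentiable:
  "(\<lambda>x. Ad G AG (param_at AG \<one> x)) differentiable (at (coord_at AG \<one> \<one>))"
proof -
  let ?\<phi> = "param_at AG \<one>" and ?\<kappa> = "coord_at AG \<one>"
  let ?e = "?\<kappa> \<one>" and ?K = "\<lambda>(x, y). coord_at AG \<one> (conj_by (param_at AG \<one> x) (param_at AG \<one> y))"
  obtain D where D: "\<forall>\<^sub>F z in nhds (?e, ?e).
      ((\<lambda>y. ?K (fst z, y)) has_derivative blinfun_apply (D z)) (at (snd z))"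
    "D differentiable (at (?e, ?e))"
    by (rule twice_diff_at_partial_snd[OF conj_by_chart_twice_diff_at])
  have "filterlim (\<lambda>x. (x, ?e)) (nhds (?e, ?e)) (nhds ?e)"
    by (intro tendsto_Pair tendsto_const filterlim_ident)
  from eventually_compose_filterlim[OF D(1) this] have "\<forall>\<^sub>F x in nhds ?e.
      ((\<lambda>y. ?K (x, y)) has_derivative blinfun_apply (D (x, ?e))) (at ?e)"
    by simp
  then have ev: "\<forall>\<^sub>F x in nhds ?e. D (x, ?e) = Ad G AG (?\<phi> x)"
  proof eventually_elim
    case (elim x)
    then have "(local_rep AG AG (conj_by (?\<phi> x)) \<one> has_derivative blinfun_apply (D (x, ?e))) (at ?e)"
      by (simp add: local_rep_def[abs_def])
    then have "mderiv AG AG (conj_by (?\<phi> x)) \<one> = blinfun_apply (D (x, ?e))"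
      by (rule mderiv_eqI)
    then show ?case
      by (intro blinfun_eqI) (simp add: Ad_apply)
  qed
  obtain D' where "(D has_derivative D') (at (?e, ?e))"
    using D(2) by (auto simp: differentiable_def)
  from has_derivative_cong_nhds[OF has_derivative_restrict_fst[OF this] ev]
  show ?thesis by (rule differentiableI)
qed

lemma mdiff_at_Ad: "mdiff_at AG vec_atlas (Ad G AG) \<one>"
  unfolding mdiff_at_def
proof
  show "local_rep AG vec_atlas (Ad G AG) \<one> differentiable (at (coord_at AG \<one> \<one>))"
    using Ad_chart_differentiable by (simp add: local_rep_def[abs_def])
  have "((\<lambda>x. Ad G AG (param_at AG \<one> x)) \<longlongrightarrow> Ad G AG \<one>) (nhds (coord_at AG \<one> \<one>))"
    using differentiable_imp_continuous_within[OF Ad_chart_differentiable]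
      tendsto_at_iff_tendsto_nhds[of "\<lambda>x. Ad G AG (param_at AG \<one> x)" "coord_at AG \<one> \<one>"]
    unfolding continuous_at by (simp add: param_at_center[OF charts])
  from filterlim_compose[OF this tendsto_coord_at[OF charts]]
  have "((\<lambda>a. Ad G AG (param_at AG \<one> (coord_at AG \<one> a))) \<longlongrightarrow> Ad G AG \<one>) (nhds \<one>)" .
  moreover have "\<forall>\<^sub>F a in nhds \<one>. Ad G AG (param_at AG \<one> (coord_at AG \<one> a)) = Ad G AG a"
    using eventually_in_chart[OF charts, of \<one>]
    by eventually_elim (simp add: param_at_coord_at[OF charts])
  ultimately show "(Ad G AG \<longlongrightarrow> Ad G AG \<one>) (nhds \<one>)"
    by (rule Lim_transform_eventually)
qed

text \<open>
  A homomorphism into bounded operators that is continuous at the identity is continuous everywhere,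
  by translation.
\<close>

lemma continuous_Ad: "continuous_on UNIV (Ad G AG)"
  unfolding continuous_on_def
proof
  fix g
  have "((\<lambda>a. inv g \<otimes> a) \<longlongrightarrow> inv g \<otimes> g) (at g)"
    by (intro tendsto_mult_group tendsto_const tendsto_ident_at)
  then have "((\<lambda>a. inv g \<otimes> a) \<longlongrightarrow> \<one>) (at g)" by simp
  from filterlim_compose[OF _ this, of "Ad G AG" "nhds (Ad G AG \<one>)"]
  have "((\<lambda>a. Ad G AG (inv g \<otimes> a)) \<longlongrightarrow> Ad G AG \<one>) (at g)"
    using mdiff_at_Ad unfolding mdiff_at_def by blast
  then have "((\<lambda>a. Ad G AG g o\<^sub>L Ad G AG (inv g \<otimes> a)) \<longlongrightarrow> Ad G AG g o\<^sub>L Ad G AG \<one>) (at g)"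
    by (intro bounded_bilinear.tendsto[OF bounded_bilinear_blinfun_compose] tendsto_const)
  then show "(Ad G AG \<longlongrightarrow> Ad G AG g) (at g within UNIV)"
    by (simp del: Ad_one flip: Ad_mult m_assoc)
qed

lemma continuous_on_Ad: "continuous_on S (\<lambda>x. Ad G AG (f x))" if "continuous_on S f"
  using continuous_on_compose2[OF continuous_Ad that] by simp

lemma ad_linear: "bounded_linear (ad G AG)"
  using mdiff_at_bounded_linear[OF mdiff_at_Ad] by (simp add: ad_def[abs_def])

text \<open>
  The derivative of \<open>Ad (g a g\<^sup>-\<^sup>1) = Ad g \<circ> Ad a \<circ> Ad g\<^sup>-\<^sup>1\<close> at \<open>a = 1\<close>.
\<close>

lemma ad_Ad: "ad G AG (Ad G AG g \<zeta>) = Ad G AG g o\<^sub>L ad G AG \<zeta> o\<^sub>L Ad G AG (inv g)"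
proof -
  let ?C = "\<lambda>T. Ad G AG g o\<^sub>L T o\<^sub>L Ad G AG (inv g)"
  have bl: "bounded_linear ?C"
    by (intro bounded_linear_compose[OF
          bounded_bilinear.bounded_linear_left[OF bounded_bilinear_blinfun_compose]
          bounded_bilinear.bounded_linear_right[OF bounded_bilinear_blinfun_compose]])
  have "mderiv AG vec_atlas (\<lambda>a. Ad G AG (conj_by g a)) \<one> =
      (\<lambda>u. mderiv AG vec_atlas (Ad G AG) (conj_by g \<one>) (mderiv AG AG (conj_by g) \<one> u))"
    by (rule mderiv_compose[OF charts charts mdiff_at_conj_by]) (simp add: mdiff_at_Ad)
  moreover have "mderiv AG vec_atlas (\<lambda>a. ?C (Ad G AG a)) \<one> =
      (\<lambda>u. ?C (mderiv AG vec_atlas (Ad G AG) \<one> u))"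
    by (rule mdiff_at_bounded_linear_compose[OF mdiff_at_Ad bl])
  moreover have "(\<lambda>a. Ad G AG (conj_by g a)) = (\<lambda>a. ?C (Ad G AG a))"
    by (simp add: Ad_mult)
  ultimately show ?thesis
    by (simp add: ad_def Ad_apply fun_eq_iff)
qed

lemma one_param_zero: "one_param G AG \<zeta> c \<Longrightarrow> c 0 = \<one>"
  unfolding one_param_def by (metis add_0 in_carrier l_cancel_one)

lemma one_param_mdiff_at: "one_param G AG \<zeta> c \<Longrightarrow> mdiff_at vec_atlas AG c t"
  unfolding one_param_def
  by (intro mtwice_diff_at_mdiff_at
      msmooth_on_mtwice_diff_at[OF charts_cover_vec_atlas charts, of UNIV]) auto

end

section \<open>Invariant neighbourhoods and implicitly defined maps\<close>

definition invariant_nhds ::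
  "'g set \<Rightarrow> ('g \<Rightarrow> 'a::real_normed_vector \<Rightarrow> 'a) \<Rightarrow> bool" where
  "invariant_nhds H a \<longleftrightarrow> (\<forall>S. open S \<and> 0 \<in> S \<longrightarrow>
     (\<exists>T. open T \<and> 0 \<in> T \<and> T \<subseteq> S \<and> (\<forall>g\<in>H. a g ` T \<subseteq> T)))"

lemma invariant_nhdsE:
  assumes "invariant_nhds H a" and "open S" and "0 \<in> S"
  obtains T where "open T" "0 \<in> T" "T \<subseteq> S" "\<And>g x. g \<in> H \<Longrightarrow> x \<in> T \<Longrightarrow> a g x \<in> T"
  using assms unfolding invariant_nhds_def by (metis image_subset_iff)

lemma invariant_nhds_map_prod:
  fixes a :: "'g \<Rightarrow> 'a::real_normed_vector \<Rightarrow> 'a" and b :: "'g \<Rightarrow> 'b::real_normed_vector \<Rightarrow> 'b"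
  assumes a: "invariant_nhds H a" and b: "invariant_nhds H b"
  shows "invariant_nhds H (\<lambda>g. map_prod (a g) (b g))"
  unfolding invariant_nhds_def
proof (intro allI impI, elim conjE)
  fix S :: "('a \<times> 'b) set" assume "open S" "0 \<in> S"
  then obtain A B where AB: "open A" "open B" "(0, 0) \<in> A \<times> B" "A \<times> B \<subseteq> S"
    using open_prod_elim[of S "(0, 0)"] by (metis zero_prod_def)
  obtain A' where A': "open A'" "0 \<in> A'" "A' \<subseteq> A" "\<And>g x. g \<in> H \<Longrightarrow> x \<in> A' \<Longrightarrow> a g x \<in> A'"
    using AB by (blast intro: invariant_nhdsE[OF a])
  obtain B' where B': "open B'" "0 \<in> B'" "B' \<subseteq> B" "\<And>g x. g \<in> H \<Longrightarrow> x \<in> B' \<Longrightarrow> b g x \<in> B'"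
    using AB by (blast intro: invariant_nhdsE[OF b])
  show "\<exists>T. open T \<and> 0 \<in> T \<and> T \<subseteq> S \<and> (\<forall>g\<in>H. map_prod (a g) (b g) ` T \<subseteq> T)"
    by (rule exI[of _ "A' \<times> B'"])
       (use A' B' AB(4) in \<open>auto simp: open_Times zero_prod_def\<close>)
qed

text \<open>
  The points whose whole orbit stays in \<open>S\<close> form an invariant set; it is open by the tube
  lemma. The group enters only through its product \<open>m\<close> and unit \<open>e\<close> on \<open>H\<close>.
\<close>

lemma compact_group_invariant_nhds:
  fixes a :: "'g::topological_space \<Rightarrow> 'a::real_normed_vector \<Rightarrow> 'a"
  assumes H: "compact H" and cont: "continuous_on (H \<times> UNIV) (\<lambda>(g, x). a g x)"
    and zero: "\<And>g. g \<in> H \<Longrightarrow> a g 0 = 0"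
    and comp: "\<And>g h x. g \<in> H \<Longrightarrow> h \<in> H \<Longrightarrow> m g h \<in> H \<and> a (m g h) x = a g (a h x)"
    and unit: "e \<in> H" "\<And>x. a e x = x"
  shows "invariant_nhds H a"
  unfolding invariant_nhds_def
proof (intro allI impI, elim conjE)
  fix S :: "'a set" assume S: "open S" "0 \<in> S"
  define T where "T = {x. \<forall>g\<in>H. a g x \<in> S}"
  have "open T"
    unfolding open_subopen[of T]
  proof
    fix x assume x: "x \<in> T"
    obtain W where W: "open W" "W \<inter> (H \<times> UNIV) = (\<lambda>(g, x). a g x) -` S \<inter> (H \<times> UNIV)"
      using cont S(1) unfolding continuous_on_open_invariant by blast
    have "\<forall>g\<in>H. \<exists>A B. open A \<and> open B \<and> g \<in> A \<and> x \<in> B \<and> A \<times> B \<subseteq> W"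
    proof
      fix g assume "g \<in> H"
      then have "(g, x) \<in> W" using W(2) x by (auto simp: T_def)
      from open_prod_elim[OF W(1) this] show "\<exists>A B. open A \<and> open B \<and> g \<in> A \<and> x \<in> B \<and> A \<times> B \<subseteq> W"
        by (metis mem_Sigma_iff)
    qed
    then obtain A B where AB: "\<And>g. g \<in> H \<Longrightarrow> open (A g) \<and> open (B g) \<and> g \<in> A g \<and> x \<in> B g \<and> A g \<times> B g \<subseteq> W"
      by metis
    obtain F where F: "F \<subseteq> H" "finite F" "H \<subseteq> (\<Union>g\<in>F. A g)"
      using compactE_image[OF H, of H A] AB by blast
    have "open (\<Inter>g\<in>F. B g)" "x \<in> (\<Inter>g\<in>F. B g)"
      using F AB by (auto intro!: open_INT)
    moreover have "(\<Inter>g\<in>F. B g) \<subseteq> T"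
    proof
      fix y assume y: "y \<in> (\<Inter>g\<in>F. B g)"
      show "y \<in> T" unfolding T_def
      proof (intro CollectI ballI)
        fix g assume "g \<in> H"
        then obtain f where "f \<in> F" "g \<in> A f" using F(3) by blast
        then have "(g, y) \<in> W" using AB F(1) y by blast
        then have "(g, y) \<in> W \<inter> (H \<times> UNIV)" using \<open>g \<in> H\<close> by simp
        then show "a g y \<in> S" unfolding W(2) by simp
      qed
    qed
    ultimately show "\<exists>V. open V \<and> x \<in> V \<and> V \<subseteq> T" by blast
  qed
  moreover have "0 \<in> T" using zero S(2) by (simp add: T_def)
  moreover have "T \<subseteq> S"
  proof
    fix x assume "x \<in> T"
    then have "a e x \<in> S" using unit(1) by (simp add: T_def)
    then show "x \<in> S" by (simp add: unit(2))
  qed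
  moreover have "a g ` T \<subseteq> T" if g: "g \<in> H" for g
  proof (rule image_subsetI)
    fix x assume x: "x \<in> T"
    show "a g x \<in> T" unfolding T_def
    proof (intro CollectI ballI)
      fix h assume "h \<in> H"
      then have "m h g \<in> H" "a (m h g) x = a h (a g x)" using comp g by auto
      with x show "a h (a g x) \<in> S" unfolding T_def by force
    qed
  qed
  ultimately show "\<exists>T. open T \<and> 0 \<in> T \<and> T \<subseteq> S \<and> (\<forall>g\<in>H. a g ` T \<subseteq> T)" by blast
qed

lemma local_solutionE:
  assumes "local_solution P Q E f"
  obtains N N' where "f 0 = 0" "open N" "0 \<in> N" "open N'" "0 \<in> N'" "continuous_on (P \<inter> N) f"
    "\<And>p. p \<in> P \<Longrightarrow> p \<in> N \<Longrightarrow> f p \<in> Q \<and> f p \<in> N'"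
    "\<And>p y. p \<in> P \<Longrightarrow> p \<in> N \<Longrightarrow> y \<in> Q \<Longrightarrow> y \<in> N' \<Longrightarrow> E p y \<longleftrightarrow> y = f p"
proof -
  obtain N N' where f0: "f 0 = 0" and N: "open N" "0 \<in> N" "open N'" "0 \<in> N'"
    and cont: "continuous_on (P \<inter> N) f"
    and f: "\<forall>p\<in>P \<inter> N. f p \<in> Q \<inter> N' \<and> (\<forall>y\<in>Q \<inter> N'. E p y \<longleftrightarrow> y = f p)"
    using assms unfolding local_solution_def by (elim conjE exE) (rule that)
  show thesis
    by (rule that[OF f0 N cont]) (use f in simp_all)
qed

text \<open>
  Uniqueness transfers the symmetry of an equation to its solution. The invariance of the equation need
  hold only near the origin of the joint space, on \<open>M\<close>; the graph of \<open>f\<close> over the resulting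
  neighbourhood lies in \<open>M\<close>, so that a later step can impose further conditions on the values of \<open>f\<close>.
\<close>

lemma local_solution_equivariant:
  assumes sol: "local_solution P Q E f" and P0: "0 \<in> P"
    and a: "invariant_nhds H a" and b: "invariant_nhds H b"
    and P: "\<And>g p. g \<in> H \<Longrightarrow> p \<in> P \<Longrightarrow> a g p \<in> P"
    and Q: "\<And>g y. g \<in> H \<Longrightarrow> y \<in> Q \<Longrightarrow> b g y \<in> Q"
    and M: "open M" "(0, 0) \<in> M"
    and E: "\<And>g p y. g \<in> H \<Longrightarrow> p \<in> P \<Longrightarrow> y \<in> Q \<Longrightarrow> (p, y) \<in> M \<Longrightarrow> E p y \<Longrightarrow> E (a g p) (b g y)"
  obtains N where "open N" "0 \<in> N" "\<And>g p. g \<in> H \<Longrightarrow> p \<in> N \<Longrightarrow> a g p \<in> N"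
    "\<And>p. p \<in> P \<Longrightarrow> p \<in> N \<Longrightarrow> f p \<in> Q \<and> (p, f p) \<in> M"
    "\<And>g p. g \<in> H \<Longrightarrow> p \<in> P \<Longrightarrow> p \<in> N \<Longrightarrow> f (a g p) = b g (f p)"
proof -
  obtain N0 N0' where f0: "f 0 = 0" and N0: "open N0" "0 \<in> N0" "open N0'" "0 \<in> N0'"
    and cont: "continuous_on (P \<inter> N0) f"
    and f: "\<And>p. p \<in> P \<Longrightarrow> p \<in> N0 \<Longrightarrow> f p \<in> Q \<and> f p \<in> N0'"
    and uniq: "\<And>p y. p \<in> P \<Longrightarrow> p \<in> N0 \<Longrightarrow> y \<in> Q \<Longrightarrow> y \<in> N0' \<Longrightarrow> E p y \<longleftrightarrow> y = f p"
    by (rule local_solutionE[OF sol]) blast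
  obtain A B where AB: "open A" "open B" "(0, 0) \<in> A \<times> B" "A \<times> B \<subseteq> M"
    by (rule open_prod_elim[OF M])
  have "open (N0' \<inter> B)" "0 \<in> N0' \<inter> B" using N0 AB by auto
  then obtain B' where B': "open B'" "0 \<in> B'" "B' \<subseteq> N0' \<inter> B" "\<And>g y. g \<in> H \<Longrightarrow> y \<in> B' \<Longrightarrow> b g y \<in> B'"
    by (rule invariant_nhdsE[OF b]) blast
  have "(f \<longlongrightarrow> 0) (at 0 within P \<inter> N0)"
    using cont P0 N0(2) f0 unfolding continuous_on_def by (metis IntI)
  then have "\<forall>\<^sub>F p in at 0 within P \<inter> N0. f p \<in> B'"
    using B'(1,2) by (rule topological_tendstoD)
  then obtain C where C: "open C" "0 \<in> C" "\<And>p. p \<in> C \<Longrightarrow> p \<in> P \<Longrightarrow> p \<in> N0 \<Longrightarrow> f p \<in> B'"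
    unfolding eventually_at_topological using f0 B'(2) by (metis IntI)
  have "open (C \<inter> N0 \<inter> A)" "0 \<in> C \<inter> N0 \<inter> A" using N0 AB C by auto
  then obtain N where N: "open N" "0 \<in> N" "N \<subseteq> C \<inter> N0 \<inter> A" "\<And>g p. g \<in> H \<Longrightarrow> p \<in> N \<Longrightarrow> a g p \<in> N"
    by (rule invariant_nhdsE[OF a]) blast
  show thesis
  proof
    show M: "f p \<in> Q \<and> (p, f p) \<in> M" if "p \<in> P" "p \<in> N" for p
      using that N(3) C(3) f B'(3) AB(4) by blast
    show "f (a g p) = b g (f p)" if g: "g \<in> H" and p: "p \<in> P" "p \<in> N" for g p
    proof -
      have p': "p \<in> N0" "f p \<in> B'" using p N(3) C(3) by auto
      have fp: "f p \<in> Q" "f p \<in> N0'" using f[OF p(1) p'(1)] by auto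
      have "E p (f p)" using uniq[OF p(1) p'(1) fp] by simp
      then have "E (a g p) (b g (f p))" using E g p M fp by blast
      moreover have "b g (f p) \<in> Q" "b g (f p) \<in> N0'"
        using B'(3) B'(4)[OF g p'(2)] Q[OF g fp(1)] by auto
      moreover have "a g p \<in> P" "a g p \<in> N0"
        using N(3) N(4)[OF g p(2)] P[OF g p(1)] by auto
      ultimately have "b g (f p) = f (a g p)" using uniq by blast
      then show ?thesis by simp
    qed
  qed (use N in auto)
qed

lemma local_solution_zero:
  assumes sol: "local_solution P Q E f" and P0: "0 \<in> P" and Q0: "0 \<in> Q"
  shows "E 0 0"
proof -
  obtain N0 N0' where "f 0 = 0" "0 \<in> N0" "0 \<in> N0'"
    "\<And>p y. p \<in> P \<Longrightarrow> p \<in> N0 \<Longrightarrow> y \<in> Q \<Longrightarrow> y \<in> N0' \<Longrightarrow> E p y \<longleftrightarrow> y = f p"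
    by (rule local_solutionE[OF sol]) blast
  with P0 Q0 show ?thesis by metis
qed

text \<open>
  A whole line of solutions at parameter \<open>0\<close> contradicts local uniqueness, unless it is the origin.
\<close>

lemma local_solution_ray:
  fixes E :: "'a::real_normed_vector \<Rightarrow> 'b::real_normed_vector \<Rightarrow> bool"
  assumes sol: "local_solution P UNIV E f" and P0: "0 \<in> P"
    and ray: "\<And>t. E 0 (t *\<^sub>R y)"
  shows "y = 0"
proof -
  obtain N0 N0' where f0: "f 0 = 0" "0 \<in> N0" and N': "open N0'" "0 \<in> N0'"
    and uniq: "\<And>p y. p \<in> P \<Longrightarrow> p \<in> N0 \<Longrightarrow> y \<in> UNIV \<Longrightarrow> y \<in> N0' \<Longrightarrow> E p y \<longleftrightarrow> y = f p"
    by (rule local_solutionE[OF sol]) blast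
  have "((\<lambda>t. t *\<^sub>R y) \<longlongrightarrow> 0 *\<^sub>R y) (at_right (0::real))"
    by (intro tendsto_intros)
  then have "\<forall>\<^sub>F t in at_right (0::real). t *\<^sub>R y \<in> N0'"
    using N' by (simp add: topological_tendstoD)
  then have "\<forall>\<^sub>F t in at_right (0::real). y = 0"
    using eventually_at_right_less[of "0::real"]
  proof eventually_elim
    case (elim t)
    have "t *\<^sub>R y = f 0" using uniq[of 0 "t *\<^sub>R y"] P0 f0 elim ray by blast
    then show ?case using elim f0 by simp
  qed
  then show ?thesis by (simp add: trivial_limit_at_right_real)
qed

lemma proj_along_apply:
  assumes "direct_sum S T UNIV" and "t \<in> T" and "s \<in> S"
  shows "proj_along T S (s + t) = t"
  unfolding proj_along_def
proof (rule the_equality)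
  fix y assume y: "y \<in> T \<and> s + t - y \<in> S"
  have "subspace S" "subspace T" "S \<inter> T = {0}" using assms(1) by (auto simp: direct_sum_def)
  have "t - y \<in> T"
    using subspace_diff[OF \<open>subspace T\<close> assms(2)] y by auto
  moreover have "(s + t - y) - s \<in> S"
    using subspace_diff[OF \<open>subspace S\<close> conjunct2[OF y] assms(3)] .
  ultimately have "t - y \<in> S \<inter> T" by simp
  then show "y = t" using \<open>S \<inter> T = {0}\<close> by simp
qed (use assms in simp)

lemma proj_along_commute:
  assumes ST: "direct_sum S T UNIV" and f: "\<And>x y. f (x + y) = f x + f y"
    and S: "\<And>x. x \<in> S \<Longrightarrow> f x \<in> S" and T: "\<And>x. x \<in> T \<Longrightarrow> f x \<in> T"
  shows "proj_along T S (f x) = f (proj_along T S x)"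
proof -
  have "x \<in> S + T" using ST by (simp add: direct_sum_def)
  then obtain s t where st: "x = s + t" "s \<in> S" "t \<in> T" by (rule set_plus_elim)
  then show ?thesis
    using proj_along_apply[OF ST st(3,2)] proj_along_apply[OF ST T[OF st(3)] S[OF st(2)]] by (simp add: f)
qed

section \<open>Infinitesimal generators and the momentum map\<close>

locale lie_action = lie_grp G AG for G :: "'g::t2_space monoid" (structure) and AG :: "('e::banach, 'g) atlas" +
  fixes AM :: "('x::banach, 'm::t2_space) atlas" and act :: "'g \<Rightarrow> 'm \<Rightarrow> 'm"
  assumes atlas: "charts_cover AM" and action: "proper_smooth_action G AG AM act"
begin

lemma act_smooth: "msmooth_on (prod_atlas AG AM) AM UNIV (\<lambda>(g, m). act g m)"
  using action by (simp add: proper_smooth_action_def)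

lemma act_mult: "act (g \<otimes> h) m = act g (act h m)"
  and act_one [simp]: "act \<one> m = m"
proof -
  interpret group_action G UNIV act
    using action by (simp add: proper_smooth_action_def)
  show "act (g \<otimes> h) m = act g (act h m)" by (rule composition_rule) auto
  show "act \<one> m = m" using id_eq_one by (metis UNIV_I restrict_apply')
qed

lemma act_inv_fixed: "act g m = m \<Longrightarrow> act (inv g) m = m"
  using act_mult[of "inv g" g m] by simp

lemma mdiff_at_orbit: "mdiff_at AG AM (\<lambda>g. act g m) g"
  and mdiff_at_act: "mdiff_at AM AM (act g) m"
  using msmooth_on_prod_left[OF charts atlas atlas act_smooth]
    msmooth_on_prod_right[OF charts atlas atlas act_smooth]
  by (auto intro: mtwice_diff_at_mdiff_at)

text \<open>
  The stabilizer of \<open>m\<close> is the projection of the preimage of \<open>(m, m)\<close> under the proper map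
  \<open>(g, n) \<mapsto> (g n, n)\<close>.
\<close>

lemma compact_stabilizer: "compact {g. act g m = m}"
proof -
  have "compactin euclidean {z \<in> topspace euclidean. (case z of (g, n) \<Rightarrow> (act g n, n)) = (m, m)}"
    using action unfolding proper_smooth_action_def proper_map_def by auto
  then have "compact {z. (case z of (g, n) \<Rightarrow> (act g n, n)) = (m, m)}" by simp
  then have "compact (fst ` {z. (case z of (g, n) \<Rightarrow> (act g n, n)) = (m, m)})"
    by (intro compact_continuous_image continuous_intros)
  moreover have "fst ` {z. (case z of (g, n) \<Rightarrow> (act g n, n)) = (m, m)} = {g. act g m = m}"
    by (force simp: image_iff)
  ultimately show ?thesis by simp
qed

lemma inf_gen_linear: "bounded_linear (\<lambda>\<zeta>. inf_gen G AG AM act \<zeta> m)"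
  using mdiff_at_bounded_linear[OF mdiff_at_orbit] by (simp add: inf_gen_def)

text \<open>
  Both sides differentiate \<open>a \<mapsto> (g a g\<^sup>-\<^sup>1) g m = g a m\<close> at the identity.
\<close>

lemma inf_gen_Ad:
  "inf_gen G AG AM act (Ad G AG g \<zeta>) (act g m) = mderiv AM AM (act g) m (inf_gen G AG AM act \<zeta> m)"
proof -
  have "mderiv AG AM (\<lambda>a. act (conj_by g a) (act g m)) \<one> =
      (\<lambda>u. mderiv AG AM (\<lambda>a. act a (act g m)) (conj_by g \<one>) (mderiv AG AG (conj_by g) \<one> u))"
    by (rule mderiv_compose[OF charts charts mdiff_at_conj_by mdiff_at_orbit])
  moreover have "mderiv AG AM (\<lambda>a. act g (act a m)) \<one> =
      (\<lambda>u. mderiv AM AM (act g) (act \<one> m) (mderiv AG AM (\<lambda>a. act a m) \<one> u))"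
    by (rule mderiv_compose[OF charts atlas mdiff_at_orbit mdiff_at_act])
  moreover have "(\<lambda>a. act (conj_by g a) (act g m)) = (\<lambda>a. act g (act a m))"
    by (simp add: fun_eq_iff m_assoc flip: act_mult)
  ultimately show ?thesis
    by (simp add: inf_gen_def Ad_apply fun_eq_iff)
qed

lemma inf_gen_isotropy:
  assumes "\<zeta> \<in> lie_alg_of G AG (stabilizer G act m)"
  shows "inf_gen G AG AM act \<zeta> m = 0"
proof -
  obtain c where c: "one_param G AG \<zeta> c" and stab: "\<And>t. act (c t) m = m"
    using assms by (auto simp: lie_alg_of_def stabilizer_def)
  have "mderiv vec_atlas AM (\<lambda>t. act (c t) m) 0 =
      (\<lambda>u. mderiv AG AM (\<lambda>g. act g m) (c 0) (mderiv vec_atlas AG c 0 u))"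
    by (rule mderiv_compose[OF charts_cover_vec_atlas charts one_param_mdiff_at[OF c] mdiff_at_orbit])
  then have "mderiv AG AM (\<lambda>g. act g m) \<one> (mderiv vec_atlas AG c 0 1) = 0"
    using one_param_zero[OF c] by (simp add: stab mderiv_const fun_eq_iff)
  then show ?thesis
    using c by (simp add: inf_gen_def one_param_def)
qed

text \<open>
  Equivariance of \<open>J\<close>, written without an inverse as \<open>J (g m) \<circ> Ad g = J m\<close>, is differentiated by the
  product rule at \<open>g = 1\<close>.
\<close>

lemma momentum_derivative:
  fixes J :: "'m \<Rightarrow> 'e \<Rightarrow>\<^sub>L real"
  assumes J: "\<And>g n. J (act g n) = coAd G AG g (J n)" and diff: "mdiff_at AM vec_atlas J m"
  shows "mderiv AM vec_atlas J m (inf_gen G AG AM act \<zeta> m) + (J m o\<^sub>L ad G AG \<zeta>) = 0"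
proof -
  let ?\<phi> = "param_at AG \<one>" and ?e = "coord_at AG \<one> \<one>"
  have diff': "mdiff_at AM vec_atlas J (act \<one> m)" using diff by simp
  have "mdiff_at AG vec_atlas (\<lambda>g. J (act g m)) \<one>"
    and der: "mderiv AG vec_atlas (\<lambda>g. J (act g m)) \<one> =
      (\<lambda>u. mderiv AM vec_atlas J m (inf_gen G AG AM act u m))"
    using mdiff_at_compose[OF charts atlas mdiff_at_orbit diff']
      mderiv_compose[OF charts atlas mdiff_at_orbit diff'] by (simp_all add: inf_gen_def)
  from mdiff_at_has_derivative[OF this(1)]
  have "((\<lambda>x. J (act (?\<phi> x) m)) has_derivative (\<lambda>u. mderiv AM vec_atlas J m (inf_gen G AG AM act u m))) (at ?e)"
    by (simp add: der local_rep_def[abs_def])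
  moreover have "((\<lambda>x. Ad G AG (?\<phi> x)) has_derivative (ad G AG)) (at ?e)"
    using mdiff_at_has_derivative[OF mdiff_at_Ad] by (simp add: local_rep_def[abs_def] ad_def[abs_def])
  ultimately have "((\<lambda>x. J (act (?\<phi> x) m) o\<^sub>L Ad G AG (?\<phi> x)) has_derivative
      (\<lambda>u. (J (act (?\<phi> ?e) m) o\<^sub>L ad G AG u) +
           (mderiv AM vec_atlas J m (inf_gen G AG AM act u m) o\<^sub>L Ad G AG (?\<phi> ?e)))) (at ?e)"
    by (rule bounded_bilinear.FDERIV[OF bounded_bilinear_blinfun_compose])
  moreover have "(\<lambda>x. J (act (?\<phi> x) m) o\<^sub>L Ad G AG (?\<phi> x)) = (\<lambda>x. J m)"
    by (intro ext blinfun_eqI) (simp add: J coAd_def)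
  ultimately have "((\<lambda>x. J m) has_derivative (\<lambda>u. (J m o\<^sub>L ad G AG u) +
           mderiv AM vec_atlas J m (inf_gen G AG AM act u m))) (at ?e)"
    by (simp add: param_at_center[OF charts] blinfun_compose_id_right)
  from fun_cong[OF has_derivative_unique[OF this has_derivative_const], of \<zeta>]
  show ?thesis by (simp add: add.commute)
qed

end

section \<open>Symmetry of the slice\<close>

text \<open>
  A slice that is equivariant under \<open>H = G\<^bsub>me\<^esub> \<inter> G\<^sub>\<xi>\<close>. The complements \<open>\<mm>\<close> and \<open>\<qq>\<close> are the types \<open>'p\<close> and
  \<open>'q\<close>, so the adjoint action on them has to be conjugated by injections and projections; it is
  an action because their images in \<open>\<gg>\<close> are invariant.
\<close>

locale slice_symmetry = lie_action G AG AM act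
  for G :: "'g::t2_space monoid" (structure) and AG :: "('e::banach, 'g) atlas"
    and AM :: "('x::banach, 'm::t2_space) atlas" and act :: "'g \<Rightarrow> 'm \<Rightarrow> 'm" +
  fixes \<omega> :: "'m \<Rightarrow> 'x \<Rightarrow>\<^sub>L 'x \<Rightarrow>\<^sub>L real" and J :: "'m \<Rightarrow> 'e \<Rightarrow>\<^sub>L real" and h :: "'m \<Rightarrow> real"
    and me :: 'm and \<xi> :: 'e and H :: "'g set" and gme gmu :: "'e set"
    and im :: "'p::real_normed_vector \<Rightarrow>\<^sub>L 'e" and Pm :: "'e \<Rightarrow>\<^sub>L 'p"
    and iq :: "'q::real_normed_vector \<Rightarrow>\<^sub>L 'e" and Pq :: "'e \<Rightarrow>\<^sub>L 'q"
    and \<U> :: "(('p \<Rightarrow>\<^sub>L real) \<times> 'v::banach) set" and \<Psi> :: "('p \<Rightarrow>\<^sub>L real) \<times> 'v \<Rightarrow> 'm"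
    and \<tau> :: "'g \<Rightarrow> 'v \<Rightarrow>\<^sub>L 'v"
  assumes momentum: "equivariant_momentum_map G AG AM \<omega> act J"
    and hamiltonian: "invariant_hamiltonian AM act h"
    and H_def: "H = stabilizer G act me \<inter> stabilizer G (\<lambda>g. blinfun_apply (Ad G AG g)) \<xi>"
    and gme_def: "gme = lie_alg_of G AG (stabilizer G act me)"
    and splitting: "isotropy_splitting gme gmu im Pm iq Pq"
    and slice: "slice_mapping G AG AM act J me im Pm iq \<U> \<Psi>"
    and m_invariant: "\<forall>g\<in>H. Ad G AG g ` range im \<subseteq> range im"
    and q_invariant: "\<forall>g\<in>H. Ad G AG g ` range iq \<subseteq> range iq"
    and equivariant: "equivariant_slice G AG act H im Pm \<tau> \<U> \<Psi>"
begin

lemma mem_H: "g \<in> H \<longleftrightarrow> act g me = me \<and> Ad G AG g \<xi> = \<xi>"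
  by (auto simp: H_def stabilizer_def)

lemma H_one: "\<one> \<in> H" and H_mult: "g \<in> H \<Longrightarrow> k \<in> H \<Longrightarrow> g \<otimes> k \<in> H"
  by (simp_all add: mem_H act_mult Ad_mult)

lemma H_inv: "g \<in> H \<Longrightarrow> inv g \<in> H"
  unfolding mem_H using Ad_inv_cancel(1)[of g \<xi>] by (simp add: act_inv_fixed)

lemma compact_H: "compact H"
proof -
  have "continuous_on UNIV (\<lambda>g. Ad G AG g \<xi>)"
    by (intro blinfun.continuous_on continuous_Ad continuous_on_const)
  then have "closed {g. Ad G AG g \<xi> = \<xi>}"
    by (intro closed_Collect_eq continuous_on_const)
  with compact_stabilizer[of me] have "compact ({g. act g me = me} \<inter> {g. Ad G AG g \<xi> = \<xi>})"
    by (rule compact_Int_closed)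
  moreover have "{g. act g me = me} \<inter> {g. Ad G AG g \<xi> = \<xi>} = H"
    by (auto simp: mem_H)
  ultimately show ?thesis by simp
qed

lemma J_act: "J (act g n) = coAd G AG g (J n)"
  and J_diff: "mtwice_diff_at AM vec_atlas J n"
  and J_omega: "\<omega> n (inf_gen G AG AM act \<zeta> n) w = mderiv AM vec_atlas J n w \<zeta>"
  using momentum
  by (auto simp: equivariant_momentum_map_def
      intro: msmooth_on_mtwice_diff_at[OF atlas charts_cover_vec_atlas, of UNIV])

lemma h_act: "h (act g n) = h n"
  and h_diff: "mtwice_diff_at AM vec_atlas h n"
  using hamiltonian
  by (auto simp: invariant_hamiltonian_def
      intro: msmooth_on_mtwice_diff_at[OF atlas charts_cover_vec_atlas, of UNIV])

lemma gme_subspace: "subspace gme"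
  using splitting by (simp add: isotropy_splitting_def direct_sum_def)

lemma splitting_cases:
  obtains \<alpha> b c where "\<alpha> \<in> gme" "\<zeta> = \<alpha> + im b + iq c"
proof -
  have "gme + range im = gmu" "gmu + range iq = UNIV"
    using splitting by (simp_all add: isotropy_splitting_def direct_sum_def)
  then have "\<zeta> \<in> (gme + range im) + range iq" by simp
  then obtain \<alpha> b c where "\<alpha> \<in> gme" "\<zeta> = \<alpha> + im b + iq c"
    by (auto elim!: set_plus_elim)
  then show thesis by (rule that)
qed

lemma proj_splitting:
  assumes "\<alpha> \<in> gme" shows "Pm (\<alpha> + im b + iq c) = b" and "Pq (\<alpha> + im b + iq c) = c"
  using splitting assms by (auto simp: isotropy_splitting_def)

lemma Pm_im [simp]: "Pm (im b) = b" and Pm_iq [simp]: "Pm (iq c) = 0" and Pq_iq [simp]: "Pq (iq c) = c"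
  using proj_splitting[OF subspace_0[OF gme_subspace], of b 0]
    proj_splitting[OF subspace_0[OF gme_subspace], of 0 c]
  by (simp_all add: blinfun.zero_right)

definition act_m :: "'g \<Rightarrow> 'p \<Rightarrow>\<^sub>L 'p" where
  "act_m g = Pm o\<^sub>L Ad G AG g o\<^sub>L im"

definition act_q :: "'g \<Rightarrow> 'q \<Rightarrow>\<^sub>L 'q" where
  "act_q g = Pq o\<^sub>L Ad G AG g o\<^sub>L iq"

lemma im_act_m: assumes "g \<in> H" shows "im (act_m g b) = Ad G AG g (im b)"
proof -
  have "Ad G AG g (im b) \<in> range im" using m_invariant assms by blast
  then show ?thesis by (auto simp: act_m_def)
qed

lemma iq_act_q: assumes "g \<in> H" shows "iq (act_q g c) = Ad G AG g (iq c)"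
proof -
  have "Ad G AG g (iq c) \<in> range iq" using q_invariant assms by blast
  then show ?thesis by (auto simp: act_q_def)
qed

lemma act_m_mult: "k \<in> H \<Longrightarrow> act_m (g \<otimes> k) = act_m g o\<^sub>L act_m k"
  by (rule blinfun_eqI) (simp add: act_m_def[of g] act_m_def[of "g \<otimes> k"] Ad_mult im_act_m)

lemma act_q_mult: "k \<in> H \<Longrightarrow> act_q (g \<otimes> k) = act_q g o\<^sub>L act_q k"
  by (rule blinfun_eqI) (simp add: act_q_def[of g] act_q_def[of "g \<otimes> k"] Ad_mult iq_act_q)

lemma act_m_one [simp]: "act_m \<one> = id_blinfun" and act_q_one [simp]: "act_q \<one> = id_blinfun"
  by (rule blinfun_eqI, simp add: act_m_def act_q_def)+

abbreviation act_mstar :: "'g \<Rightarrow> ('p \<Rightarrow>\<^sub>L real) \<Rightarrow> 'p \<Rightarrow>\<^sub>L real" where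
  "act_mstar g \<equiv> mstar_act G AG im Pm g"

text \<open>
  The coadjoint action on \<open>\<mm>\<^sup>*\<close> is contragredient to the adjoint action on \<open>\<mm>\<close>.
\<close>

lemma act_mstar_eq: "act_mstar g \<eta> = \<eta> o\<^sub>L act_m (inv g)"
  by (rule blinfun_eqI) (simp add: mstar_act_def coAd_def act_m_def)

lemma act_mstar_linear: "bounded_linear (act_mstar g)"
  unfolding act_mstar_eq
  by (rule bounded_bilinear.bounded_linear_left[OF bounded_bilinear_blinfun_compose])

lemma act_mstar_mult:
  assumes "g \<in> H" shows "act_mstar (g \<otimes> k) \<eta> = act_mstar g (act_mstar k \<eta>)"
  using act_m_mult[OF H_inv[OF assms], of "inv k"]
  by (intro blinfun_eqI) (simp add: act_mstar_eq inv_mult_group)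

lemma act_mstar_one [simp]: "act_mstar \<one> \<eta> = \<eta>"
  by (simp add: act_mstar_eq blinfun_compose_id_right)

lemma act_mstar_cancel: "g \<in> H \<Longrightarrow> act_mstar g (act_mstar (inv g) \<eta>) = \<eta>"
  by (simp flip: act_mstar_mult)

lemma tau_one [simp]: "\<tau> \<one> = id_blinfun"
  and tau_mult: "g \<in> H \<Longrightarrow> k \<in> H \<Longrightarrow> \<tau> (g \<otimes> k) = \<tau> g o\<^sub>L \<tau> k"
  and tau_continuous: "continuous_on (H \<times> UNIV) (\<lambda>(g, v). \<tau> g v)"
  using equivariant by (simp_all add: equivariant_slice_def linear_action_def)

lemma tau_cancel:
  assumes "g \<in> H" shows "\<tau> g (\<tau> (inv g) v) = v"
  using tau_mult[OF assms H_inv[OF assms]] by (metis blinfun_apply_blinfun_compose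
      blinfun_apply_id_blinfun id_apply in_carrier r_inv tau_one)

lemma slice_open: "open \<U>" and slice_zero: "(0, 0) \<in> \<U>" and slice_center: "\<Psi> (0, 0) = me"
  and slice_derivative: "mderiv vec_atlas vec_atlas (J \<circ> \<Psi>) (0, 0) (d\<eta>, dv) = d\<eta> o\<^sub>L Pm"
  using slice by (simp_all add: slice_mapping_def)

lemma slice_diff: "p \<in> \<U> \<Longrightarrow> mtwice_diff_at vec_atlas AM \<Psi> p"
  using slice unfolding slice_mapping_def diffeo_onto_image_def
  by (blast intro: msmooth_on_mtwice_diff_at[OF charts_cover_vec_atlas atlas])

lemma slice_act:
  assumes "g \<in> H" and "(\<eta>, v) \<in> \<U>"
  shows "(act_mstar g \<eta>, \<tau> g v) \<in> \<U>" and "\<Psi> (act_mstar g \<eta>, \<tau> g v) = act g (\<Psi> (\<eta>, v))"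
  using equivariant assms by (auto simp: equivariant_slice_def)

lemma invariant_nhds_Ad: "invariant_nhds H (\<lambda>g. blinfun_apply (Ad G AG g))"
proof (rule compact_group_invariant_nhds[OF compact_H, where m = "\<lambda>g k. g \<otimes> k" and e = \<one>])
  show "continuous_on (H \<times> UNIV) (\<lambda>(g, x). Ad G AG g x)"
    unfolding split_beta'
    by (intro blinfun.continuous_on continuous_on_Ad continuous_intros)
qed (auto simp: H_mult H_one Ad_mult blinfun.zero_right)

lemma invariant_nhds_act_m: "invariant_nhds H (\<lambda>g. blinfun_apply (act_m g))"
proof (rule compact_group_invariant_nhds[OF compact_H, where m = "\<lambda>g k. g \<otimes> k" and e = \<one>])
  show "continuous_on (H \<times> UNIV) (\<lambda>(g, x). act_m g x)"
    unfolding split_beta' act_m_def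
    by (intro blinfun.continuous_on bounded_bilinear.continuous_on[OF bounded_bilinear_blinfun_compose]
        continuous_on_Ad continuous_intros)
qed (auto simp: H_mult H_one act_m_mult blinfun.zero_right)

lemma invariant_nhds_act_q: "invariant_nhds H (\<lambda>g. blinfun_apply (act_q g))"
proof (rule compact_group_invariant_nhds[OF compact_H, where m = "\<lambda>g k. g \<otimes> k" and e = \<one>])
  show "continuous_on (H \<times> UNIV) (\<lambda>(g, x). act_q g x)"
    unfolding split_beta' act_q_def
    by (intro blinfun.continuous_on bounded_bilinear.continuous_on[OF bounded_bilinear_blinfun_compose]
        continuous_on_Ad continuous_intros)
qed (auto simp: H_mult H_one act_q_mult blinfun.zero_right)

lemma invariant_nhds_tau: "invariant_nhds H (\<lambda>g. blinfun_apply (\<tau> g))"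
proof (rule compact_group_invariant_nhds[OF compact_H, where m = "\<lambda>g k. g \<otimes> k" and e = \<one>])
  show "continuous_on (H \<times> UNIV) (\<lambda>(g, x). \<tau> g x)" by (rule tau_continuous)
qed (auto simp: H_mult H_one tau_mult blinfun.zero_right)

lemma invariant_nhds_act_mstar: "invariant_nhds H act_mstar"
proof (rule compact_group_invariant_nhds[OF compact_H, where m = "\<lambda>g k. g \<otimes> k" and e = \<one>])
  have "continuous_on UNIV (\<lambda>g. inv g)"
    using inv_smooth by (simp add: msmooth_on_def)
  then have "continuous_on (H \<times> UNIV) (\<lambda>x. inv (fst x))"
    by (rule continuous_on_compose2) (auto intro: continuous_intros)
  then show "continuous_on (H \<times> UNIV) (\<lambda>(g, x). act_mstar g x)"
    unfolding split_beta' act_mstar_eq act_m_def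
    by (intro bounded_bilinear.continuous_on[OF bounded_bilinear_blinfun_compose]
        continuous_on_Ad continuous_intros)
qed (auto simp: H_mult H_one act_mstar_mult linear_0[OF bounded_linear.linear[OF act_mstar_linear]])

lemma J_slice_act:
  assumes "g \<in> H" and "(\<eta>, v) \<in> \<U>"
  shows "J (\<Psi> (act_mstar g \<eta>, \<tau> g v)) = coAd G AG g (J (\<Psi> (\<eta>, v)))"
  by (simp add: slice_act[OF assms] J_act)

text \<open>
  The identity from which the symmetry of steps 2 and 3 and of \<open>\<L>\<close> is obtained by differentiation.
\<close>

lemma aug_ham_act:
  assumes "g \<in> H" and "(\<eta>, v) \<in> \<U>"
  shows "aug_ham h J \<Psi> (Ad G AG g \<zeta>) (act_mstar g \<eta>, \<tau> g v) = aug_ham h J \<Psi> \<zeta> (\<eta>, v)"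
  by (simp add: aug_ham_def slice_act[OF assms] J_act h_act coAd_def)

lemma h_slice_diff:
  assumes "p \<in> \<U>" shows "twice_diff_at (\<lambda>p. h (\<Psi> p)) p"
  using mtwice_diff_at_compose[OF charts_cover_vec_atlas atlas slice_diff[OF assms] h_diff]
  by (simp add: mtwice_diff_at_vec)

lemma J_slice_diff:
  assumes "p \<in> \<U>" shows "twice_diff_at (\<lambda>p. J (\<Psi> p)) p"
  using mtwice_diff_at_compose[OF charts_cover_vec_atlas atlas slice_diff[OF assms] J_diff]
  by (simp add: mtwice_diff_at_vec)

lemma aug_ham_diff:
  assumes "p \<in> \<U>" shows "twice_diff_at (aug_ham h J \<Psi> \<zeta>) p"
proof -
  have "bounded_linear (\<lambda>\<nu>::'e \<Rightarrow>\<^sub>L real. - \<nu> \<zeta>)"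
    by (intro bounded_linear_minus blinfun.bounded_linear_left)
  then have "twice_diff_at (\<lambda>p. - J (\<Psi> p) \<zeta>) p"
    by (intro twice_diff_at_compose[OF J_slice_diff[OF assms], where g = "\<lambda>\<nu>. - blinfun_apply \<nu> \<zeta>"]
        twice_diff_at_bounded_linear)
  from twice_diff_at_add[OF h_slice_diff[OF assms] this]
  show ?thesis by (simp add: aug_ham_def[abs_def])
qed

text \<open>
  Chain rule for the linear bijection \<open>\<tau> g\<close>. The identity of the augmented Hamiltonians holds on the open
  set \<open>\<U>\<close> only, which is enough for derivatives at its points.
\<close>

lemma partial_snd_act:
  assumes g: "g \<in> H" and p: "(\<eta>, v) \<in> \<U>"
  shows "partial_snd (aug_ham h J \<Psi> (Ad G AG g \<zeta>)) (act_mstar g \<eta>, \<tau> g v) =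
    contragredient G \<tau> g (partial_snd (aug_ham h J \<Psi> \<zeta>) (\<eta>, v))" (is "?A = contragredient G \<tau> g ?C")
proof (rule blinfun_eqI)
  fix w
  have "\<forall>\<^sub>F y in nhds v. (\<eta>, y) \<in> \<U>"
    by (rule eventually_compose_filterlim[OF eventually_nhds_in_open[OF slice_open p]])
       (intro tendsto_Pair tendsto_const filterlim_ident)
  then have ev: "\<forall>\<^sub>F y in nhds v.
      aug_ham h J \<Psi> (Ad G AG g \<zeta>) (act_mstar g \<eta>, \<tau> g y) = aug_ham h J \<Psi> \<zeta> (\<eta>, y)"
    by eventually_elim (rule aug_ham_act[OF g])
  have "((\<lambda>y. aug_ham h J \<Psi> (Ad G AG g \<zeta>) (act_mstar g \<eta>, \<tau> g y)) has_derivative (\<lambda>y. ?A (\<tau> g y))) (at v)"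
    by (rule has_derivative_compose[OF bounded_linear_imp_has_derivative[OF blinfun.bounded_linear_right]
        partial_snd_has_derivative[OF twice_diff_at_differentiable[OF aug_ham_diff[OF slice_act(1)[OF g p]]]]])
  from has_derivative_cong_nhds[OF this ev]
  have "((\<lambda>y. aug_ham h J \<Psi> \<zeta> (\<eta>, y)) has_derivative (\<lambda>y. ?A (\<tau> g y))) (at v)" .
  from has_derivative_unique[OF this
      partial_snd_has_derivative[OF twice_diff_at_differentiable[OF aug_ham_diff[OF p]]]]
  have "?A (\<tau> g y) = ?C y" for y by (rule fun_cong)
  from this[of "\<tau> (inv g) w"] show "?A w = contragredient G \<tau> g ?C w"
    by (simp add: contragredient_def tau_cancel[OF g])
qed

lemma partial_fst_act:
  assumes g: "g \<in> H" and p: "(\<eta>, v) \<in> \<U>"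
  shows "partial_fst (aug_ham h J \<Psi> (Ad G AG g \<zeta>)) (act_mstar g \<eta>, \<tau> g v) d =
    partial_fst (aug_ham h J \<Psi> \<zeta>) (\<eta>, v) (act_mstar (inv g) d)" (is "?A d = ?C (act_mstar (inv g) d)")
proof -
  have "\<forall>\<^sub>F y in nhds \<eta>. (y, v) \<in> \<U>"
    by (rule eventually_compose_filterlim[OF eventually_nhds_in_open[OF slice_open p]])
       (intro tendsto_Pair tendsto_const filterlim_ident)
  then have ev: "\<forall>\<^sub>F y in nhds \<eta>.
      aug_ham h J \<Psi> (Ad G AG g \<zeta>) (act_mstar g y, \<tau> g v) = aug_ham h J \<Psi> \<zeta> (y, v)"
    by eventually_elim (rule aug_ham_act[OF g])
  have "((\<lambda>y. aug_ham h J \<Psi> (Ad G AG g \<zeta>) (act_mstar g y, \<tau> g v)) has_derivative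
      (\<lambda>y. ?A (act_mstar g y))) (at \<eta>)"
    by (rule has_derivative_compose[OF bounded_linear_imp_has_derivative[OF act_mstar_linear]
        partial_fst_has_derivative[OF twice_diff_at_differentiable[OF aug_ham_diff[OF slice_act(1)[OF g p]]]]])
  from has_derivative_cong_nhds[OF this ev]
  have "((\<lambda>y. aug_ham h J \<Psi> \<zeta> (y, v)) has_derivative (\<lambda>y. ?A (act_mstar g y))) (at \<eta>)" .
  from has_derivative_unique[OF this
      partial_fst_has_derivative[OF twice_diff_at_differentiable[OF aug_ham_diff[OF p]]]]
  have "?A (act_mstar g y) = ?C y" for y by (rule fun_cong)
  from this[of "act_mstar (inv g) d"] show ?thesis
    by (simp add: act_mstar_cancel[OF g])
qed

lemma ad_star_act: "ad_star G AG (Ad G AG g \<zeta>) (coAd G AG g \<nu>) = coAd G AG g (ad_star G AG \<zeta> \<nu>)"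
  by (rule blinfun_eqI) (simp add: ad_star_def coAd_def ad_Ad)

lemma hess_V_has_derivative:
  "((\<lambda>v. partial_snd (aug_ham h J \<Psi> \<xi>) (0, v)) has_derivative hess_V h J \<Psi> \<xi>) (at 0)"
  using partial_snd_differentiable[OF aug_ham_diff[OF slice_zero]]
  by (simp add: hess_V_def frechet_derivative_works)

lemma contragredient_linear: "bounded_linear (contragredient G \<tau> g)"
  unfolding contragredient_def[abs_def]
  by (rule bounded_bilinear.bounded_linear_left[OF bounded_bilinear_blinfun_compose])

text \<open>
  At \<open>\<eta> = 0\<close> and \<open>\<zeta> = \<xi>\<close> both the base point and the generator are fixed by \<open>g\<close>, so the derivative
  along \<open>V\<close> is an equivariant map near \<open>0\<close>, and so is its own derivative at \<open>0\<close>.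
\<close>

lemma hess_V_act:
  assumes g: "g \<in> H"
  shows "hess_V h J \<Psi> \<xi> (\<tau> g v) = contragredient G \<tau> g (hess_V h J \<Psi> \<xi> v)"
proof -
  let ?\<phi> = "\<lambda>v. partial_snd (aug_ham h J \<Psi> \<xi>) (0, v)"
  have "\<forall>\<^sub>F v in nhds 0. (0, v) \<in> \<U>"
    by (rule eventually_compose_filterlim[OF eventually_nhds_in_open[OF slice_open slice_zero]])
       (intro tendsto_Pair tendsto_const filterlim_ident)
  then have ev: "\<forall>\<^sub>F v in nhds 0. ?\<phi> (\<tau> g v) = contragredient G \<tau> g (?\<phi> v)"
  proof eventually_elim
    case (elim v)
    show ?case
      using partial_snd_act[OF g elim, of \<xi>] g
      by (simp add: mem_H linear_0[OF bounded_linear.linear[OF act_mstar_linear]])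
  qed
  have "(?\<phi> has_derivative hess_V h J \<Psi> \<xi>) (at (\<tau> g 0))"
    using hess_V_has_derivative by (simp add: blinfun.zero_right)
  then have "((\<lambda>v. ?\<phi> (\<tau> g v)) has_derivative (\<lambda>v. hess_V h J \<Psi> \<xi> (\<tau> g v))) (at 0)"
    by (rule has_derivative_compose[OF bounded_linear_imp_has_derivative[OF blinfun.bounded_linear_right]])
  from has_derivative_cong_nhds[OF this ev]
  have "((\<lambda>v. contragredient G \<tau> g (?\<phi> v)) has_derivative (\<lambda>v. hess_V h J \<Psi> \<xi> (\<tau> g v))) (at 0)" .
  from has_derivative_unique[OF this bounded_linear.has_derivative[OF contragredient_linear hess_V_has_derivative]]
  show ?thesis by (rule fun_cong)
qed

end

section \<open>Equivariance of the reduced maps\<close>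

locale reduction = slice_symmetry G AG AM act \<omega> J h me \<xi> H gme gmu im Pm iq Pq \<U> \<Psi> \<tau>
  for G :: "'g::t2_space monoid" (structure) and AG :: "('e::banach, 'g) atlas"
    and AM :: "('x::banach, 'm::t2_space) atlas" and act :: "'g \<Rightarrow> 'm \<Rightarrow> 'm"
    and \<omega> :: "'m \<Rightarrow> 'x \<Rightarrow>\<^sub>L 'x \<Rightarrow>\<^sub>L real" and J :: "'m \<Rightarrow> 'e \<Rightarrow>\<^sub>L real" and h :: "'m \<Rightarrow> real"
    and me :: 'm and \<xi> :: 'e and H :: "'g set" and gme gmu :: "'e set"
    and im :: "'p::real_normed_vector \<Rightarrow>\<^sub>L 'e" and Pm :: "'e \<Rightarrow>\<^sub>L 'p"
    and iq :: "'q::real_normed_vector \<Rightarrow>\<^sub>L 'e" and Pq :: "'e \<Rightarrow>\<^sub>L 'q"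
    and \<U> :: "(('p \<Rightarrow>\<^sub>L real) \<times> 'v::banach) set" and \<Psi> :: "('p \<Rightarrow>\<^sub>L real) \<times> 'v \<Rightarrow> 'm"
    and \<tau> :: "'g \<Rightarrow> 'v \<Rightarrow>\<^sub>L 'v" +
  fixes \<gamma> :: "('p \<Rightarrow>\<^sub>L real) \<times> 'v \<times> 'e \<times> 'p \<Rightarrow> 'q"
    and \<beta> :: "('p \<Rightarrow>\<^sub>L real) \<times> 'v \<times> 'e \<Rightarrow> 'p"
    and v1 :: "('p \<Rightarrow>\<^sub>L real) \<times> 'v \<times> 'e \<Rightarrow> 'v"
    and \<omega>1 :: "('p \<Rightarrow>\<^sub>L real) \<times> 'v \<times> 'e \<times> 'p \<Rightarrow> 'e"
    and \<omega>2 \<Xi> :: "('p \<Rightarrow>\<^sub>L real) \<times> 'v \<times> 'e \<Rightarrow> 'e"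
    and \<L> :: "'v \<Rightarrow> 'v \<Rightarrow>\<^sub>L real"
    and V0 V1 :: "'v set" and V2 :: "('v \<Rightarrow>\<^sub>L real) set"
    and \<P> :: "('v \<Rightarrow>\<^sub>L real) \<Rightarrow> 'v \<Rightarrow>\<^sub>L real"
  assumes step1: "local_solution {(\<eta>, v, \<alpha>, b). \<alpha> \<in> gme} UNIV (step1_equation G AG J \<xi> im iq \<Psi>) \<gamma>"
    and \<omega>1_def: "\<omega>1 = omega1 \<xi> im iq \<gamma>"
    and step2: "local_solution {(\<eta>, v, \<alpha>). \<alpha> \<in> gme} UNIV (step2_equation h J \<Psi> \<omega>1) \<beta>"
    and \<omega>2_def: "\<omega>2 = omega2 \<omega>1 \<beta>"
    and \<L>_def: "\<L> = hess_V h J \<Psi> \<xi>"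
    and V0_def: "V0 = {v. \<L> v = 0}"
    and V1_sum: "direct_sum V0 V1 UNIV"
    and V2_sum: "direct_sum (range \<L>) V2 UNIV"
    and V1_invariant: "\<forall>g\<in>H. \<tau> g ` V1 \<subseteq> V1"
    and V2_invariant: "\<forall>g\<in>H. contragredient G \<tau> g ` V2 \<subseteq> V2"
    and \<P>_def: "\<P> = proj_along V2 (range \<L>)"
    and step3: "local_solution {(\<eta>, v0, \<alpha>). v0 \<in> V0 \<and> \<alpha> \<in> gme} V1 (step3_equation h J \<Psi> \<omega>2 \<P>) v1"
    and \<Xi>_def: "\<Xi> = Xi_map \<omega>2 v1"
begin

text \<open>
  Since \<open>D(J \<circ> \<Psi>)(0, 0)\<close> is \<open>\<eta> \<mapsto> \<eta> \<circ> Pm\<close>, the momentum part of the derivative along \<open>\<mm>\<^sup>*\<close> at the origin sees exactly the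
  \<open>\<mm>\<close>-component of \<open>\<zeta>\<close>.
\<close>

lemma partial_fst_center:
  "partial_fst (aug_ham h J \<Psi> \<zeta>) (0, 0) d = partial_fst (\<lambda>p. h (\<Psi> p)) (0, 0) d - d (Pm \<zeta>)"
proof -
  have "mderiv vec_atlas vec_atlas (J \<circ> \<Psi>) (0, 0) = (\<lambda>(d, w). d o\<^sub>L Pm)"
    by (simp add: fun_eq_iff slice_derivative)
  then have "((\<lambda>p. J (\<Psi> p)) has_derivative (\<lambda>(d, w). d o\<^sub>L Pm)) (at (0, 0))"
    using twice_diff_at_has_derivative[OF J_slice_diff[OF slice_zero]]
    by (simp add: mderiv_vec o_def)
  then have "((\<lambda>p. J (\<Psi> p) \<zeta>) has_derivative (\<lambda>z. (case z of (d, w) \<Rightarrow> d o\<^sub>L Pm) \<zeta>)) (at (0, 0))"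
    by (rule bounded_linear.has_derivative[OF blinfun.bounded_linear_left])
  moreover have "((\<lambda>\<eta>. (\<eta>, 0)) has_derivative (\<lambda>d. (d, 0))) (at 0)"
    by (intro has_derivative_Pair has_derivative_const has_derivative_ident)
  ultimately have Jd: "((\<lambda>\<eta>. J (\<Psi> (\<eta>, 0)) \<zeta>) has_derivative
      (\<lambda>z. (case (z, 0::'v) of (d, w) \<Rightarrow> d o\<^sub>L Pm) \<zeta>)) (at 0)"
    by (rule has_derivative_compose[rotated])
  have "((\<lambda>\<eta>. h (\<Psi> (\<eta>, 0)) - J (\<Psi> (\<eta>, 0)) \<zeta>) has_derivative
      (\<lambda>d. partial_fst (\<lambda>p. h (\<Psi> p)) (0, 0) d - (case (d, 0::'v) of (d, w) \<Rightarrow> d o\<^sub>L Pm) \<zeta>)) (at 0)"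
    by (rule has_derivative_diff[OF
          partial_fst_has_derivative[OF twice_diff_at_differentiable[OF h_slice_diff[OF slice_zero]]] Jd])
  then have "((\<lambda>\<eta>. aug_ham h J \<Psi> \<zeta> (\<eta>, 0)) has_derivative
      (\<lambda>d. partial_fst (\<lambda>p. h (\<Psi> p)) (0, 0) d - d (Pm \<zeta>))) (at 0)"
    by (simp add: aug_ham_def)
  from has_derivative_unique[OF this
      partial_fst_has_derivative[OF twice_diff_at_differentiable[OF aug_ham_diff[OF slice_zero]]]]
  have "(\<lambda>d. partial_fst (\<lambda>p. h (\<Psi> p)) (0, 0) d - d (Pm \<zeta>)) = partial_fst (aug_ham h J \<Psi> \<zeta>) (0, 0)" .
  from fun_cong[OF this, of d] show ?thesis by simp
qed

lemma zero_in_gme: "0 \<in> gme"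
  by (rule subspace_0[OF gme_subspace])

text \<open>
  If all functionals vanish at \<open>b\<close>, then adding a multiple of \<open>b\<close> to the solution of step 2 at the
  origin gives another solution. Local uniqueness thus supplies the separation of points
  for which one would otherwise invoke finite dimensionality of \<open>\<mm>\<close>.
\<close>

lemma mdual_separates:
  assumes "\<And>d :: 'p \<Rightarrow>\<^sub>L real. d b = 0" shows "b = 0"
proof (rule local_solution_ray[OF step2])
  fix t :: real
  have "step2_equation h J \<Psi> \<omega>1 0 0"
    by (rule local_solution_zero[OF step2]) (simp_all add: zero_prod_def zero_in_gme)
  then have "partial_fst (\<lambda>p. h (\<Psi> p)) (0, 0) d - d (Pm (\<omega>1 (0, 0, 0, 0))) = 0" for d
    by (simp add: step2_equation_def zero_prod_def flip: partial_fst_center)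
  then show "step2_equation h J \<Psi> \<omega>1 0 (t *\<^sub>R b)"
    unfolding step2_equation_def zero_prod_def prod.case
    by (intro blinfun_eqI)
       (simp add: partial_fst_center \<omega>1_def omega1_def blinfun.bilinear_simps assms)
qed (simp add: zero_prod_def zero_in_gme)

text \<open>
  Let \<open>\<zeta>\<^sub>M(me) = 0\<close>, and let \<open>\<kappa>\<close> be the component of \<open>\<zeta>\<close> in \<open>\<mm> \<oplus> \<qq>\<close>; then \<open>\<kappa>\<^sub>M(me) = 0\<close> too. Since
  \<open>\<omega>(\<kappa>\<^sub>M, \<cdot>) = \<langle>dJ, \<kappa>\<rangle>\<close>, the image of \<open>dJ(me)\<close> annihilates \<open>\<kappa>\<close>; the derivative of \<open>J \<circ> \<Psi>\<close> shows
  that this image contains \<open>\<mm>\<^sup>*\<close>, so the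
  \<open>\<mm>\<close>-component of \<open>\<kappa>\<close> is zero. Moreover \<open>ad\<^sup>*\<^sub>\<kappa> \<mu> = 0\<close>, so multiples of \<open>\<kappa>\<close> may be added to the
  solution of step 1 at the origin, and local uniqueness gives \<open>\<kappa> = 0\<close>.
\<close>

lemma mem_gme: "\<zeta> \<in> gme \<longleftrightarrow> inf_gen G AG AM act \<zeta> me = 0"
proof
  assume "\<zeta> \<in> gme" then show "inf_gen G AG AM act \<zeta> me = 0"
    unfolding gme_def by (rule inf_gen_isotropy)
next
  assume \<zeta>: "inf_gen G AG AM act \<zeta> me = 0"
  obtain \<alpha> b c where \<alpha>: "\<alpha> \<in> gme" and split: "\<zeta> = \<alpha> + im b + iq c"
    by (rule splitting_cases)
  have "inf_gen G AG AM act \<alpha> me = 0" using \<alpha> unfolding gme_def by (rule inf_gen_isotropy)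
  moreover have "im b + iq c = \<zeta> - \<alpha>" by (simp add: split)
  ultimately have k: "inf_gen G AG AM act (im b + iq c) me = 0"
    using linear_diff[OF bounded_linear.linear[OF inf_gen_linear]] \<zeta> by simp
  have Jk: "mderiv AM vec_atlas J me w (im b + iq c) = 0" for w
    using J_omega[of me "im b + iq c" w] by (simp add: k blinfun.bilinear_simps)
  have "d b = 0" for d :: "'p \<Rightarrow>\<^sub>L real"
  proof -
    have "mderiv vec_atlas vec_atlas (\<lambda>p. J (\<Psi> p)) (0, 0) =
        (\<lambda>u. mderiv AM vec_atlas J (\<Psi> (0, 0)) (mderiv vec_atlas AM \<Psi> (0, 0) u))"
      by (rule mderiv_compose[OF charts_cover_vec_atlas atlas
            mtwice_diff_at_mdiff_at[OF slice_diff[OF slice_zero]] mtwice_diff_at_mdiff_at[OF J_diff]])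
    from fun_cong[OF this, of "(d, 0)"]
    have "d o\<^sub>L Pm = mderiv AM vec_atlas J me (mderiv vec_atlas AM \<Psi> (0, 0) (d, 0))"
      using slice_derivative[of d 0] by (simp add: o_def slice_center)
    then have "(d o\<^sub>L Pm) (im b + iq c) = 0" by (simp only: Jk)
    then show ?thesis by (simp add: blinfun.bilinear_simps)
  qed
  then have b: "b = 0" by (rule mdual_separates)
  have ad: "J me o\<^sub>L ad G AG (iq c) = 0"
    using momentum_derivative[OF J_act mtwice_diff_at_mdiff_at[OF J_diff], of me "iq c"] k
      mdiff_at_bounded_linear[OF mtwice_diff_at_mdiff_at[OF J_diff], of me]
    by (simp add: b blinfun.bilinear_simps linear_0[OF bounded_linear.linear])
  have "c = 0"
  proof (rule local_solution_ray[OF step1])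
    fix t :: real
    have "step1_equation G AG J \<xi> im iq \<Psi> 0 0"
      by (rule local_solution_zero[OF step1]) (simp_all add: zero_prod_def zero_in_gme)
    then have "J me o\<^sub>L ad G AG \<xi> o\<^sub>L iq = 0"
      by (simp add: step1_equation_def zero_prod_def slice_center ad_star_def blinfun.bilinear_simps)
    from arg_cong[OF this, of blinfun_apply] have "J me (ad G AG \<xi> (iq i)) = 0" for i
      by (simp add: fun_eq_iff)
    moreover from arg_cong[OF ad, of blinfun_apply] have "J me (ad G AG (iq c) w) = 0" for w
      by (simp add: fun_eq_iff)
    moreover have "ad G AG (\<xi> + t *\<^sub>R iq c) = ad G AG \<xi> + t *\<^sub>R ad G AG (iq c)"
      using bounded_linear.linear[OF ad_linear] by (simp add: linear_add linear_scale)
    ultimately show "step1_equation G AG J \<xi> im iq \<Psi> 0 (t *\<^sub>R c)"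
      unfolding step1_equation_def zero_prod_def prod.case
      by (intro blinfun_eqI) (simp add: slice_center ad_star_def blinfun.bilinear_simps)
  qed (simp add: zero_prod_def zero_in_gme)
  then show "\<zeta> \<in> gme" using \<alpha> by (simp add: split b blinfun.zero_right)
qed

lemma Ad_gme:
  assumes "g \<in> H" and "\<alpha> \<in> gme" shows "Ad G AG g \<alpha> \<in> gme"
  using inf_gen_Ad[of g \<alpha> me] assms
    linear_0[OF bounded_linear.linear[OF mdiff_at_bounded_linear[OF mdiff_at_act]]]
  by (simp add: mem_gme mem_H)

text \<open>
  Step 1 at \<open>g p\<close> is the image under the coadjoint action of step 1 at \<open>p\<close>. The condition of
  vanishing on \<open>\<qq>\<close> is preserved because \<open>\<qq>\<close> is invariant.
\<close>

lemma omega1_act: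
  obtains N where "open N" "0 \<in> N"
    "\<And>g \<eta> v \<alpha> b. g \<in> H \<Longrightarrow> \<alpha> \<in> gme \<Longrightarrow> (\<eta>, v, \<alpha>, b) \<in> N \<Longrightarrow>
      \<omega>1 (act_mstar g \<eta>, \<tau> g v, Ad G AG g \<alpha>, act_m g b) = Ad G AG g (\<omega>1 (\<eta>, v, \<alpha>, b))"
proof -
  let ?a = "\<lambda>g. map_prod (act_mstar g) (map_prod (blinfun_apply (\<tau> g))
      (map_prod (blinfun_apply (Ad G AG g)) (blinfun_apply (act_m g))))"
  let ?M = "(\<lambda>z :: (('p \<Rightarrow>\<^sub>L real) \<times> 'v \<times> 'e \<times> 'p) \<times> 'q. (fst (fst z), fst (snd (fst z)))) -` \<U>"
  have M: "open ?M"
    by (intro open_vimage slice_open continuous_intros)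
  have E: "step1_equation G AG J \<xi> im iq \<Psi> (?a g p) (act_q g c)"
    if g: "g \<in> H" and "(p, c) \<in> ?M" and eq: "step1_equation G AG J \<xi> im iq \<Psi> p c" for g p c
  proof -
    obtain \<eta> v \<alpha> b where p: "p = (\<eta>, v, \<alpha>, b)" by (metis surj_pair)
    have U: "(\<eta>, v) \<in> \<U>" using that(2) p by simp
    define \<nu> where "\<nu> = ad_star G AG (\<xi> + \<alpha> + im b + iq c) (J (\<Psi> (\<eta>, v)))"
    have \<nu>: "\<nu> (iq y) = 0" for y
      using eq unfolding step1_equation_def p \<nu>_def prod.case
      by (metis blinfun_apply_blinfun_compose zero_blinfun.rep_eq)
    have "\<xi> + Ad G AG g \<alpha> + im (act_m g b) + iq (act_q g c) = Ad G AG g (\<xi> + \<alpha> + im b + iq c)"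
      using g by (simp add: im_act_m iq_act_q blinfun.bilinear_simps mem_H)
    then have "ad_star G AG (\<xi> + Ad G AG g \<alpha> + im (act_m g b) + iq (act_q g c))
        (J (\<Psi> (act_mstar g \<eta>, \<tau> g v))) = coAd G AG g \<nu>"
      by (simp add: J_slice_act[OF g U] ad_star_act \<nu>_def)
    moreover have "coAd G AG g \<nu> o\<^sub>L iq = 0"
      by (rule blinfun_eqI) (simp add: coAd_def \<nu> flip: iq_act_q[OF H_inv[OF g]])
    ultimately show ?thesis
      by (simp add: step1_equation_def p)
  qed
  obtain N where "open N" "0 \<in> N"
    and N: "\<And>g p. g \<in> H \<Longrightarrow> p \<in> {(\<eta>, v, \<alpha>, b). \<alpha> \<in> gme} \<Longrightarrow> p \<in> N \<Longrightarrow> \<gamma> (?a g p) = act_q g (\<gamma> p)"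
  proof (rule local_solution_equivariant[OF step1, where H = H and a = ?a and
        b = "\<lambda>g. blinfun_apply (act_q g)" and M = ?M])
    show "invariant_nhds H ?a"
      by (intro invariant_nhds_map_prod invariant_nhds_act_mstar invariant_nhds_tau
          invariant_nhds_Ad invariant_nhds_act_m)
    show "invariant_nhds H (\<lambda>g. blinfun_apply (act_q g))" by (rule invariant_nhds_act_q)
  qed (use M E slice_zero in \<open>auto simp: zero_prod_def zero_in_gme Ad_gme\<close>)
  show thesis
  proof (rule that[OF \<open>open N\<close> \<open>0 \<in> N\<close>])
    fix g \<eta> v \<alpha> b assume g: "g \<in> H" and "\<alpha> \<in> gme" "(\<eta>, v, \<alpha>, b) \<in> N"
    then have "\<gamma> (act_mstar g \<eta>, \<tau> g v, Ad G AG g \<alpha>, act_m g b) = act_q g (\<gamma> (\<eta>, v, \<alpha>, b))"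
      using N[of g "(\<eta>, v, \<alpha>, b)"] by simp
    then show "\<omega>1 (act_mstar g \<eta>, \<tau> g v, Ad G AG g \<alpha>, act_m g b) = Ad G AG g (\<omega>1 (\<eta>, v, \<alpha>, b))"
      using g by (simp add: \<omega>1_def omega1_def im_act_m iq_act_q blinfun.bilinear_simps mem_H)
  qed
qed

text \<open>
  Invariance of the equation of step 2 rests on equivariance of \<open>\<omega>\<^sub>1\<close> at \<open>(\<eta>, v, \<alpha>, b)\<close>, which is
  available near the origin only; this is the second condition in the definition of the open set.
\<close>

lemma omega2_act:
  obtains N where "open N" "0 \<in> N"
    "\<And>g \<eta> v \<alpha>. g \<in> H \<Longrightarrow> \<alpha> \<in> gme \<Longrightarrow> (\<eta>, v, \<alpha>) \<in> N \<Longrightarrow>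
      \<omega>2 (act_mstar g \<eta>, \<tau> g v, Ad G AG g \<alpha>) = Ad G AG g (\<omega>2 (\<eta>, v, \<alpha>))"
proof -
  obtain N1 where N1: "open N1" "0 \<in> N1"
    and omega1: "\<And>g \<eta> v \<alpha> b. g \<in> H \<Longrightarrow> \<alpha> \<in> gme \<Longrightarrow> (\<eta>, v, \<alpha>, b) \<in> N1 \<Longrightarrow>
      \<omega>1 (act_mstar g \<eta>, \<tau> g v, Ad G AG g \<alpha>, act_m g b) = Ad G AG g (\<omega>1 (\<eta>, v, \<alpha>, b))"
    by (rule omega1_act) (rule that)
  let ?a = "\<lambda>g. map_prod (act_mstar g) (map_prod (blinfun_apply (\<tau> g)) (blinfun_apply (Ad G AG g)))"
  let ?M = "(\<lambda>z :: (('p \<Rightarrow>\<^sub>L real) \<times> 'v \<times> 'e) \<times> 'p. (fst (fst z), fst (snd (fst z)))) -` \<U> \<inter>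
    (\<lambda>z. (fst (fst z), fst (snd (fst z)), snd (snd (fst z)), snd z)) -` N1"
  have M: "open ?M"
    by (intro open_Int open_vimage slice_open N1(1) continuous_intros)
  have E: "step2_equation h J \<Psi> \<omega>1 (?a g p) (act_m g b)"
    if g: "g \<in> H" and p: "p \<in> {(\<eta>, v, \<alpha>). \<alpha> \<in> gme}" and M: "(p, b) \<in> ?M"
      and eq: "step2_equation h J \<Psi> \<omega>1 p b" for g p b
  proof -
    obtain \<eta> v \<alpha> where p': "p = (\<eta>, v, \<alpha>)" by (metis surj_pair)
    have U: "(\<eta>, v) \<in> \<U>" and N: "(\<eta>, v, \<alpha>, b) \<in> N1" and \<alpha>: "\<alpha> \<in> gme"
      using M p p' by simp_all
    have "partial_fst (aug_ham h J \<Psi> (Ad G AG g (\<omega>1 (\<eta>, v, \<alpha>, b)))) (act_mstar g \<eta>, \<tau> g v) = 0"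
      using eq by (intro blinfun_eqI) (simp add: step2_equation_def p' partial_fst_act[OF g U])
    then show ?thesis
      by (simp add: step2_equation_def p' omega1[OF g \<alpha> N])
  qed
  obtain N where "open N" "0 \<in> N"
    and M': "\<And>p. p \<in> {(\<eta>, v, \<alpha>). \<alpha> \<in> gme} \<Longrightarrow> p \<in> N \<Longrightarrow> \<beta> p \<in> UNIV \<and> (p, \<beta> p) \<in> ?M"
    and N: "\<And>g p. g \<in> H \<Longrightarrow> p \<in> {(\<eta>, v, \<alpha>). \<alpha> \<in> gme} \<Longrightarrow> p \<in> N \<Longrightarrow> \<beta> (?a g p) = act_m g (\<beta> p)"
  proof (rule local_solution_equivariant[OF step2, where H = H and a = ?a and
        b = "\<lambda>g. blinfun_apply (act_m g)" and M = ?M])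
    show "invariant_nhds H ?a"
      by (intro invariant_nhds_map_prod invariant_nhds_act_mstar invariant_nhds_tau invariant_nhds_Ad)
    show "invariant_nhds H (\<lambda>g. blinfun_apply (act_m g))" by (rule invariant_nhds_act_m)
  qed (use M E slice_zero N1(2) in \<open>auto simp: zero_prod_def zero_in_gme Ad_gme\<close>)
  show thesis
  proof (rule that[OF \<open>open N\<close> \<open>0 \<in> N\<close>])
    fix g \<eta> v \<alpha> assume g: "g \<in> H" and \<alpha>: "\<alpha> \<in> gme" and p: "(\<eta>, v, \<alpha>) \<in> N"
    have "\<beta> (act_mstar g \<eta>, \<tau> g v, Ad G AG g \<alpha>) = act_m g (\<beta> (\<eta>, v, \<alpha>))"
      using N[OF g _ p] \<alpha> by simp
    moreover have "(\<eta>, v, \<alpha>, \<beta> (\<eta>, v, \<alpha>)) \<in> N1" using M'[OF _ p] \<alpha> by simp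
    ultimately show "\<omega>2 (act_mstar g \<eta>, \<tau> g v, Ad G AG g \<alpha>) = Ad G AG g (\<omega>2 (\<eta>, v, \<alpha>))"
      by (simp add: \<omega>2_def omega2_def omega1[OF g \<alpha>])
  qed
qed

lemma \<L>_act: "g \<in> H \<Longrightarrow> \<L> (\<tau> g v) = contragredient G \<tau> g (\<L> v)"
  unfolding \<L>_def by (rule hess_V_act)

lemma tau_V0: "g \<in> H \<Longrightarrow> v \<in> V0 \<Longrightarrow> \<tau> g v \<in> V0"
  using linear_0[OF bounded_linear.linear[OF contragredient_linear]] by (simp add: V0_def \<L>_act)

lemma \<P>_act:
  assumes "g \<in> H" shows "\<P> (contragredient G \<tau> g \<phi>) = contragredient G \<tau> g (\<P> \<phi>)"
  unfolding \<P>_def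
proof (rule proj_along_commute[OF V2_sum])
  show "contragredient G \<tau> g (x + y) = contragredient G \<tau> g x + contragredient G \<tau> g y" for x y
    by (rule linear_add[OF bounded_linear.linear[OF contragredient_linear]])
  show "contragredient G \<tau> g x \<in> range \<L>" if "x \<in> range \<L>" for x
    using that by (auto simp flip: \<L>_act[OF assms])
qed (use V2_invariant assms in blast)

text \<open>
  Equivariance of \<open>v\<^sub>1\<close> and \<open>\<Xi>\<close>. In step 3 the second argument is \<open>v\<^sub>0 + v\<^sub>1\<close>, so the conditions for the
  equivariance of \<open>\<omega>\<^sub>2\<close> and of the derivatives along \<open>V\<close> are imposed on this sum, both on the set where the
  equation is invariant and on the graph of \<open>v\<^sub>1\<close>.
\<close>

lemma reduced_maps_act:
  obtains N where "open N" "0 \<in> N"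
    "\<And>g \<eta> v0 \<alpha>. g \<in> H \<Longrightarrow> (\<eta>, v0, \<alpha>) \<in> N \<Longrightarrow> (act_mstar g \<eta>, \<tau> g v0, Ad G AG g \<alpha>) \<in> N"
    "\<And>\<eta> v0 \<alpha>. v0 \<in> V0 \<Longrightarrow> \<alpha> \<in> gme \<Longrightarrow> (\<eta>, v0, \<alpha>) \<in> N \<Longrightarrow> (\<eta>, v0 + v1 (\<eta>, v0, \<alpha>)) \<in> \<U>"
    "\<And>g \<eta> v0 \<alpha>. g \<in> H \<Longrightarrow> v0 \<in> V0 \<Longrightarrow> \<alpha> \<in> gme \<Longrightarrow> (\<eta>, v0, \<alpha>) \<in> N \<Longrightarrow>
      v1 (act_mstar g \<eta>, \<tau> g v0, Ad G AG g \<alpha>) = \<tau> g (v1 (\<eta>, v0, \<alpha>))"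
    "\<And>g \<eta> v0 \<alpha>. g \<in> H \<Longrightarrow> v0 \<in> V0 \<Longrightarrow> \<alpha> \<in> gme \<Longrightarrow> (\<eta>, v0, \<alpha>) \<in> N \<Longrightarrow>
      \<Xi> (act_mstar g \<eta>, \<tau> g v0, Ad G AG g \<alpha>) = Ad G AG g (\<Xi> (\<eta>, v0, \<alpha>))"
proof -
  obtain N2 where N2: "open N2" "0 \<in> N2"
    and omega2: "\<And>g \<eta> v \<alpha>. g \<in> H \<Longrightarrow> \<alpha> \<in> gme \<Longrightarrow> (\<eta>, v, \<alpha>) \<in> N2 \<Longrightarrow>
      \<omega>2 (act_mstar g \<eta>, \<tau> g v, Ad G AG g \<alpha>) = Ad G AG g (\<omega>2 (\<eta>, v, \<alpha>))"
    by (rule omega2_act) (rule that)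
  let ?P = "{(\<eta> :: 'p \<Rightarrow>\<^sub>L real, v0, \<alpha>). v0 \<in> V0 \<and> \<alpha> \<in> gme}"
  let ?a = "\<lambda>g. map_prod (act_mstar g) (map_prod (blinfun_apply (\<tau> g)) (blinfun_apply (Ad G AG g)))"
  let ?M = "(\<lambda>z :: (('p \<Rightarrow>\<^sub>L real) \<times> 'v \<times> 'e) \<times> 'v. (fst (fst z), fst (snd (fst z)) + snd z)) -` \<U> \<inter>
    (\<lambda>z. (fst (fst z), fst (snd (fst z)) + snd z, snd (snd (fst z)))) -` N2"
  have M: "open ?M"
    by (intro open_Int open_vimage slice_open N2(1) continuous_intros)
  have E: "step3_equation h J \<Psi> \<omega>2 \<P> (?a g p) (\<tau> g y)"
    if g: "g \<in> H" and p: "p \<in> ?P" and M: "(p, y) \<in> ?M"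
      and eq: "step3_equation h J \<Psi> \<omega>2 \<P> p y" for g p y
  proof -
    obtain \<eta> v0 \<alpha> where p': "p = (\<eta>, v0, \<alpha>)" by (metis surj_pair)
    have U: "(\<eta>, v0 + y) \<in> \<U>" and N: "(\<eta>, v0 + y, \<alpha>) \<in> N2" and \<alpha>: "\<alpha> \<in> gme"
      using M p p' by simp_all
    define d where "d = partial_snd (aug_ham h J \<Psi> (\<omega>2 (\<eta>, v0 + y, \<alpha>))) (\<eta>, v0 + y)"
    have "d - \<P> d = 0" using eq by (simp add: step3_equation_def p' d_def Let_def)
    moreover have "partial_snd (aug_ham h J \<Psi> (\<omega>2 (act_mstar g \<eta>, \<tau> g v0 + \<tau> g y, Ad G AG g \<alpha>)))
        (act_mstar g \<eta>, \<tau> g v0 + \<tau> g y) = contragredient G \<tau> g d"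
      using partial_snd_act[OF g U] by (simp add: omega2[OF g \<alpha> N] d_def flip: blinfun.add_right)
    ultimately show ?thesis
      by (simp add: step3_equation_def p' Let_def \<P>_act[OF g])
  qed
  have V0: "0 \<in> V0" and V1: "0 \<in> V1"
    using V1_sum by (auto simp: direct_sum_def intro: subspace_0)
  obtain N where N: "open N" "0 \<in> N" "\<And>g p. g \<in> H \<Longrightarrow> p \<in> N \<Longrightarrow> ?a g p \<in> N"
    and M': "\<And>p. p \<in> ?P \<Longrightarrow> p \<in> N \<Longrightarrow> v1 p \<in> V1 \<and> (p, v1 p) \<in> ?M"
    and v1: "\<And>g p. g \<in> H \<Longrightarrow> p \<in> ?P \<Longrightarrow> p \<in> N \<Longrightarrow> v1 (?a g p) = \<tau> g (v1 p)"
  proof (rule local_solution_equivariant[OF step3, where H = H and a = ?a and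
        b = "\<lambda>g. blinfun_apply (\<tau> g)" and M = ?M])
    show "invariant_nhds H ?a"
      by (intro invariant_nhds_map_prod invariant_nhds_act_mstar invariant_nhds_tau invariant_nhds_Ad)
    show "invariant_nhds H (\<lambda>g. blinfun_apply (\<tau> g))" by (rule invariant_nhds_tau)
    show "\<tau> g y \<in> V1" if "g \<in> H" "y \<in> V1" for g y
      using V1_invariant that by blast
  qed (use M E slice_zero N2(2) V0 in \<open>auto simp: zero_prod_def zero_in_gme Ad_gme tau_V0\<close>)
  show thesis
  proof (rule that[OF \<open>open N\<close> \<open>0 \<in> N\<close>])
    show "(act_mstar g \<eta>, \<tau> g v0, Ad G AG g \<alpha>) \<in> N" if "g \<in> H" "(\<eta>, v0, \<alpha>) \<in> N" for g \<eta> v0 \<alpha>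
      using N(3)[OF that] by simp
  next
    fix \<eta> v0 \<alpha> assume p: "v0 \<in> V0" "\<alpha> \<in> gme" "(\<eta>, v0, \<alpha>) \<in> N"
    show "(\<eta>, v0 + v1 (\<eta>, v0, \<alpha>)) \<in> \<U>" using M'[OF _ p(3)] p by simp
    have N2': "(\<eta>, v0 + v1 (\<eta>, v0, \<alpha>), \<alpha>) \<in> N2" using M'[OF _ p(3)] p by simp
    fix g assume g: "g \<in> H"
    show *: "v1 (act_mstar g \<eta>, \<tau> g v0, Ad G AG g \<alpha>) = \<tau> g (v1 (\<eta>, v0, \<alpha>))"
      using v1[OF g _ p(3)] p by simp
    show "\<Xi> (act_mstar g \<eta>, \<tau> g v0, Ad G AG g \<alpha>) = Ad G AG g (\<Xi> (\<eta>, v0, \<alpha>))"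
      using omega2[OF g p(2) N2'] by (simp add: \<Xi>_def Xi_map_def * flip: blinfun.add_right)
  qed
qed

lemma B_map_act:
  assumes g: "g \<in> H" and U: "(\<eta>, v0 + v1 (\<eta>, v0, \<alpha>)) \<in> \<U>"
    and v1: "v1 (act_mstar g \<eta>, \<tau> g v0, Ad G AG g \<alpha>) = \<tau> g (v1 (\<eta>, v0, \<alpha>))"
    and \<Xi>: "\<Xi> (act_mstar g \<eta>, \<tau> g v0, Ad G AG g \<alpha>) = Ad G AG g (\<Xi> (\<eta>, v0, \<alpha>))"
  shows "B_map h J \<Psi> \<Xi> \<P> v1 (act_mstar g \<eta>, \<tau> g v0, Ad G AG g \<alpha>) =
    contragredient G \<tau> g (B_map h J \<Psi> \<Xi> \<P> v1 (\<eta>, v0, \<alpha>))"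
  using partial_snd_act[OF g U]
  by (simp add: B_map_def v1 \<Xi> \<P>_act[OF g] flip: blinfun.add_right)

lemma rho_map_act:
  assumes g: "g \<in> H" and U: "(\<eta>, v0 + v1 (\<eta>, v0, \<alpha>)) \<in> \<U>"
    and v1: "v1 (act_mstar g \<eta>, \<tau> g v0, Ad G AG g \<alpha>) = \<tau> g (v1 (\<eta>, v0, \<alpha>))"
    and \<Xi>: "\<Xi> (act_mstar g \<eta>, \<tau> g v0, Ad G AG g \<alpha>) = Ad G AG g (\<Xi> (\<eta>, v0, \<alpha>))"
  shows "rho_map G AG J im \<Psi> \<Xi> v1 (act_mstar g \<eta>, \<tau> g v0, Ad G AG g \<alpha>) =
    act_mstar g (rho_map G AG J im \<Psi> \<Xi> v1 (\<eta>, v0, \<alpha>))"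
proof -
  have "coAd G AG g \<nu> o\<^sub>L im = act_mstar g (\<nu> o\<^sub>L im)" for \<nu>
    by (rule blinfun_eqI) (simp add: coAd_def act_mstar_eq im_act_m[OF H_inv[OF g]])
  then show ?thesis
    using J_slice_act[OF g U] by (simp add: rho_map_def v1 \<Xi> ad_star_act flip: blinfun.add_right)
qed

end

section \<open>The equivariance theorem\<close>

theorem proposition3p3:
  fixes G :: "'g::t2_space monoid"
    and AG :: "('e::banach, 'g) atlas"
    and AM :: "('x::banach, 'm::t2_space) atlas"
    and \<omega> :: "'m \<Rightarrow> 'x \<Rightarrow>\<^sub>L 'x \<Rightarrow>\<^sub>L real"
    and act :: "'g \<Rightarrow> 'm \<Rightarrow> 'm"
    and J :: "'m \<Rightarrow> 'e \<Rightarrow>\<^sub>L real"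
    and h :: "'m \<Rightarrow> real"
    and me :: 'm and \<xi> :: 'e and \<mu> :: "'e \<Rightarrow>\<^sub>L real"
    and H :: "'g set" and gme :: "'e set"
    and im :: "'p::real_normed_vector \<Rightarrow>\<^sub>L 'e" and Pm :: "'e \<Rightarrow>\<^sub>L 'p"
    and iq :: "'q::real_normed_vector \<Rightarrow>\<^sub>L 'e" and Pq :: "'e \<Rightarrow>\<^sub>L 'q"
    and U :: "'x set" and \<psi> :: "'x \<Rightarrow> 'm"
    and iV :: "'v::banach \<Rightarrow>\<^sub>L 'x" and W :: "'x set"
    and \<U> :: "(('p \<Rightarrow>\<^sub>L real) \<times> 'v) set" and \<Psi> :: "('p \<Rightarrow>\<^sub>L real) \<times> 'v \<Rightarrow> 'm"
    and \<tau> :: "'g \<Rightarrow> 'v \<Rightarrow>\<^sub>L 'v"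
    and \<gamma> :: "('p \<Rightarrow>\<^sub>L real) \<times> 'v \<times> 'e \<times> 'p \<Rightarrow> 'q"
    and \<beta> :: "('p \<Rightarrow>\<^sub>L real) \<times> 'v \<times> 'e \<Rightarrow> 'p"
    and v1 :: "('p \<Rightarrow>\<^sub>L real) \<times> 'v \<times> 'e \<Rightarrow> 'v"
    and \<omega>1 :: "('p \<Rightarrow>\<^sub>L real) \<times> 'v \<times> 'e \<times> 'p \<Rightarrow> 'e"
    and \<omega>2 \<Xi> :: "('p \<Rightarrow>\<^sub>L real) \<times> 'v \<times> 'e \<Rightarrow> 'e"
    and \<L> :: "'v \<Rightarrow> 'v \<Rightarrow>\<^sub>L real"
    and V0 V1 :: "'v set" and V2 :: "('v \<Rightarrow>\<^sub>L real) set"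
    and \<P> :: "('v \<Rightarrow>\<^sub>L real) \<Rightarrow> 'v \<Rightarrow>\<^sub>L real"
    and B :: "('p \<Rightarrow>\<^sub>L real) \<times> 'v \<times> 'e \<Rightarrow> 'v \<Rightarrow>\<^sub>L real"
    and \<rho> :: "('p \<Rightarrow>\<^sub>L real) \<times> 'v \<times> 'e \<Rightarrow> 'p \<Rightarrow>\<^sub>L real"
  assumes "lie_group G AG"
    and "symplectic_manifold AM \<omega>"
    and "proper_smooth_action G AG AM act"
    and "equivariant_momentum_map G AG AM \<omega> act J"
    and "invariant_hamiltonian AM act h"
    and "relative_equilibrium G AG AM \<omega> act h me \<xi>"
    and mu: "\<mu> = J me"
    and H: "H = stabilizer G act me \<inter> stabilizer G (\<lambda>g. blinfun_apply (Ad G AG g)) \<xi>"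
    and gme: "gme = lie_alg_of G AG (stabilizer G act me)"
    \<comment> \<open>the splitting of the Lie algebra and the slice mapping\<close>
    and "isotropy_splitting gme (lie_alg_of G AG (stabilizer G (coAd G AG) \<mu>)) im Pm iq Pq"
    and "slice_mapping G AG AM act J me im Pm iq \<U> \<Psi>"
    and "slice_from_chart G AG AM act J me gme im Pm iq U \<psi> iV W \<Psi>"
    \<comment> \<open>invariance of \<open>\<mm>\<close>, \<open>\<qq>\<close>, \<open>V\<close>, \<open>W\<close> and equivariance of the slice mapping\<close>
    and "\<forall>g\<in>H. Ad G AG g ` range im \<subseteq> range im"
    and "\<forall>g\<in>H. Ad G AG g ` range iq \<subseteq> range iq"
    and "\<forall>g\<in>H. mderiv AM AM (act g) me ` mderiv vec_atlas AM \<psi> 0 ` range iV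
                  \<subseteq> mderiv vec_atlas AM \<psi> 0 ` range iV"
    and "\<forall>g\<in>H. mderiv AM AM (act g) me ` mderiv vec_atlas AM \<psi> 0 ` W
                  \<subseteq> mderiv vec_atlas AM \<psi> 0 ` W"
    and "equivariant_slice G AG act H im Pm \<tau> \<U> \<Psi>"
    \<comment> \<open>step 1\<close>
    and "local_solution {(\<eta>, v, \<alpha>, b). \<alpha> \<in> gme} UNIV (step1_equation G AG J \<xi> im iq \<Psi>) \<gamma>"
    and om1: "\<omega>1 = omega1 \<xi> im iq \<gamma>"
    \<comment> \<open>step 2\<close>
    and "local_solution {(\<eta>, v, \<alpha>). \<alpha> \<in> gme} UNIV (step2_equation h J \<Psi> \<omega>1) \<beta>"
    and om2: "\<omega>2 = omega2 \<omega>1 \<beta>"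
    \<comment> \<open>step 3\<close>
    and L: "\<L> = hess_V h J \<Psi> \<xi>"
    and "fin_dim (UNIV :: 'v set) \<or> hilbertable TYPE('v) \<and> fredholm \<L>"
    and V0: "V0 = {v. \<L> v = 0}"
    and "closed V1" and "direct_sum V0 V1 UNIV"
    and "closed V2" and "direct_sum (range \<L>) V2 UNIV"
    and "\<forall>g\<in>H. \<tau> g ` V1 \<subseteq> V1"
    and "\<forall>g\<in>H. contragredient G \<tau> g ` V2 \<subseteq> V2"
    and P: "\<P> = proj_along V2 (range \<L>)"
    and "local_solution {(\<eta>, v0, \<alpha>). v0 \<in> V0 \<and> \<alpha> \<in> gme} V1 (step3_equation h J \<Psi> \<omega>2 \<P>) v1"
    \<comment> \<open>the reduced maps\<close>
    and Xi: "\<Xi> = Xi_map \<omega>2 v1"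
    and B: "B = B_map h J \<Psi> \<Xi> \<P> v1"
    and rho: "\<rho> = rho_map G AG J im \<Psi> \<Xi> v1"
  shows "(\<forall>g\<in>H. \<forall>v. \<L> (\<tau> g v) = contragredient G \<tau> g (\<L> v)) \<and>
    (\<exists>N. open N \<and> 0 \<in> N \<and>
      (\<forall>g\<in>H. \<forall>\<eta> v0 \<alpha>. (\<eta>, v0, \<alpha>) \<in> N \<and> v0 \<in> V0 \<and> \<alpha> \<in> gme \<longrightarrow>
        (let p = (\<eta>, v0, \<alpha>);
             gp = (mstar_act G AG im Pm g \<eta>, \<tau> g v0, Ad G AG g \<alpha>)
         in gp \<in> N \<and> \<tau> g v0 \<in> V0 \<and> Ad G AG g \<alpha> \<in> gme \<and>
            \<Xi> gp = Ad G AG g (\<Xi> p) \<and>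
            v1 gp = \<tau> g (v1 p) \<and>
            B gp = contragredient G \<tau> g (B p) \<and>
            \<rho> gp = mstar_act G AG im Pm g (\<rho> p))))"
proof -
  have AM: "charts_cover AM"
    using assms(2) by (simp add: symplectic_manifold_def smooth_atlas_charts_cover)
  interpret reduction G AG AM act \<omega> J h me \<xi> H gme
    "lie_alg_of G AG (stabilizer G (coAd G AG) \<mu>)" im Pm iq Pq \<U> \<Psi> \<tau> \<gamma> \<beta> v1 \<omega>1 \<omega>2 \<Xi> \<L> V0 V1 V2 \<P>
    by unfold_locales (fact AM | fact assms)+
  obtain N where N: "open N" "0 \<in> N"
      "\<And>g \<eta> v0 \<alpha>. g \<in> H \<Longrightarrow> (\<eta>, v0, \<alpha>) \<in> N \<Longrightarrow> (act_mstar g \<eta>, \<tau> g v0, Ad G AG g \<alpha>) \<in> N"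
    and U: "\<And>\<eta> v0 \<alpha>. v0 \<in> V0 \<Longrightarrow> \<alpha> \<in> gme \<Longrightarrow> (\<eta>, v0, \<alpha>) \<in> N \<Longrightarrow> (\<eta>, v0 + v1 (\<eta>, v0, \<alpha>)) \<in> \<U>"
    and v1: "\<And>g \<eta> v0 \<alpha>. g \<in> H \<Longrightarrow> v0 \<in> V0 \<Longrightarrow> \<alpha> \<in> gme \<Longrightarrow> (\<eta>, v0, \<alpha>) \<in> N \<Longrightarrow>
      v1 (act_mstar g \<eta>, \<tau> g v0, Ad G AG g \<alpha>) = \<tau> g (v1 (\<eta>, v0, \<alpha>))"
    and \<Xi>: "\<And>g \<eta> v0 \<alpha>. g \<in> H \<Longrightarrow> v0 \<in> V0 \<Longrightarrow> \<alpha> \<in> gme \<Longrightarrow> (\<eta>, v0, \<alpha>) \<in> N \<Longrightarrow>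
      \<Xi> (act_mstar g \<eta>, \<tau> g v0, Ad G AG g \<alpha>) = Ad G AG g (\<Xi> (\<eta>, v0, \<alpha>))"
    by (rule reduced_maps_act) (rule that)
  show ?thesis
  proof (intro conjI exI[of _ N] ballI allI impI; (elim conjE)?)
    fix g \<eta> v0 \<alpha> assume g: "g \<in> H" and p: "(\<eta>, v0, \<alpha>) \<in> N" "v0 \<in> V0" "\<alpha> \<in> gme"
    note U' = U[OF p(2,3,1)] and v1' = v1[OF g p(2,3,1)] and \<Xi>' = \<Xi>[OF g p(2,3,1)]
    show "let p = (\<eta>, v0, \<alpha>); gp = (act_mstar g \<eta>, \<tau> g v0, Ad G AG g \<alpha>)
      in gp \<in> N \<and> \<tau> g v0 \<in> V0 \<and> Ad G AG g \<alpha> \<in> gme \<and> \<Xi> gp = Ad G AG g (\<Xi> p) \<and>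
         v1 gp = \<tau> g (v1 p) \<and> B gp = contragredient G \<tau> g (B p) \<and> \<rho> gp = act_mstar g (\<rho> p)"
      unfolding Let_def B rho
      by (intro conjI N(3)[OF g p(1)] tau_V0[OF g p(2)] Ad_gme[OF g p(3)] \<Xi>' v1'
          B_map_act[OF g U' v1' \<Xi>'] rho_map_act[OF g U' v1' \<Xi>'])
  qed (simp_all add: N(1,2) \<L>_act)
qed

end
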